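(* Let $T$ be an operator function on an interval $\Delta\subset\mathbb R$ satisfying Assumptions (A1)–(A3) and condition (VM). Let $\mu_1,\mu_2\in\Delta$ with $\mu_1<\mu_2$. If there exist $\mathcal M\in\mathbb M^+_{\mu_1}$ and $a>0$ such that $$\mathfrak t(\mu_2)[x]\ge a\|x\|^2\quad\text{for all }x\in\mathcal M,$$ then $\mu_2\in\rho(T)$.
   Context: $\mathcal H$ is a complex Hilbert space; "subspace" means linear manifold, not necessarily closed. For a self-adjoint operator $A$ with spectral measure $E$, its form is $\mathfrak a[x,y]=\int_{\mathbb R}\mu\,d\langle E(\mu)x,y\rangle$ for $x,y\in\mathrm{dom}(\mathfrak a):=\mathrm{dom}(|A|^{1/2})$, and $\mathfrak a[x]:=\mathfrak a[x,x]$ (so $\mathfrak a[x,y]=\langle Ax,y\rangle$ for $x\in\mathrm{dom}A$, $y\in\mathrm{dom}\,\mathfrak a$). A subspace $\mathcal L\subset\mathrm{dom}(\mathfrak a)$ is $\mathfrak a$-non-negative if $\mathfrak a[x]\ge0$ for all $x\in\mathcal L$; it is maximal $\mathfrak a$-non-negative if it is not properly contained in another $\mathfrak a$-non-negative subspace of $\mathrm{dom}(\mathfrak a)$. For an operator function $T$ on $\Delta$ with closed operator values: $\sigma(T)=\{\lambda\in\Delta:0\in\sigma(T(\lambda))\}$, $\rho(T)=\{\lambda\in\Delta:0\in\rho(T(\lambda))\}$. Assumptions: (A1) $T(\lambda)$ is self-adjoint for each $\lambda\in\Delta$, with form $\mathfrak t(\lambda)$; (A2) $\mathrm{dom}\,\mathfrak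 t(\lambda)=\mathrm{dom}(|T(\lambda)|^{1/2})=:\mathcal D$ is independent of $\lambda$; (A3) for each $x\in\mathcal D\setminus\{0\}$, $\lambda\mapsto\mathfrak t(\lambda)[x]$ is continuous on $\Delta$, and if $\mathfrak t(\lambda_0)[x]=0$ for some $\lambda_0\in\Delta$ then $\mathfrak t(\lambda)[x]>0$ for $\lambda\in\Delta$, $\lambda<\lambda_0$, and $\mathfrak t(\lambda)[x]<0$ for $\lambda\in\Delta$, $\lambda>\lambda_0$. Condition (VM): for every $u\in\mathcal D$ the function $\mathfrak t(\cdot)[u]$ is differentiable on $\Delta$ (derivative denoted $\mathfrak t'(\lambda)[u]$), and for every compact subinterval $I\subset\Delta$ there exist $\varepsilon,\delta>0$ such that for all $x\in\mathcal D$ with $\|x\|=1$ and all $\lambda\in I$: $|\mathfrak t(\lambda)[x]|\le\varepsilon\Rightarrow\mathfrak t'(\lambda)[x]\le-\delta$. For $\gamma\in\Delta$, $\mathbb M^+_\gamma$ is the set of all maximal $\mathfrak t(\gamma)$-non-negative subspaces of $\mathcal D$. *)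

theory Defs
  imports "HOL-Analysis.Analysis" "HOL-Probability.Probability"
begin

class complex_vector = real_vector +
  fixes scaleC :: "complex \<Rightarrow> 'a \<Rightarrow> 'a" (infixr \<open>*\<^sub>C\<close> 75)
  assumes scaleC_add_right: "c *\<^sub>C (x + y) = c *\<^sub>C x + c *\<^sub>C y"
    and scaleC_add_left: "(b + c) *\<^sub>C x = b *\<^sub>C x + c *\<^sub>C x"
    and scaleC_scaleC: "b *\<^sub>C (c *\<^sub>C x) = (b * c) *\<^sub>C x"
    and scaleC_one: "1 *\<^sub>C x = x"
    and scaleR_scaleC: "scaleR r x = complex_of_real r *\<^sub>C x"

class complex_inner = complex_vector + real_normed_vector +
  fixes cinner :: "'a \<Rightarrow> 'a \<Rightarrow> complex"
  assumes cinner_conj_commute: "cinner x y = cnj (cinner y x)"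
    and cinner_add_left: "cinner (x + y) z = cinner x z + cinner y z"
    and cinner_scaleC_left: "cinner (c *\<^sub>C x) y = c * cinner x y"
    and cinner_self_real: "Im (cinner x x) = 0"
    and cinner_self_nonneg: "Re (cinner x x) \<ge> 0"
    and cinner_self_eq_zero: "cinner x x = 0 \<longleftrightarrow> x = 0"
    and norm_eq_sqrt_cinner: "norm x = sqrt (Re (cinner x x))"

class chilbert_space = complex_inner + complete_space

definition csubspace :: "'a::complex_vector set \<Rightarrow> bool" where
  "csubspace S \<longleftrightarrow> 0 \<in> S \<and> (\<forall>x\<in>S. \<forall>y\<in>S. x + y \<in> S) \<and> (\<forall>c. \<forall>x\<in>S. c *\<^sub>C x \<in> S)"

text \<open>An operator is given by its domain D together with a map A
(values outside D are irrelevant). Self-adjointness: densely defined, linear,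
and the graph of the adjoint equals the graph of A.\<close>
definition self_adjoint :: "'a::chilbert_space set \<Rightarrow> ('a \<Rightarrow> 'a) \<Rightarrow> bool" where
  "self_adjoint D A \<longleftrightarrow>
     csubspace D \<and> closure D = UNIV \<and>
     (\<forall>x\<in>D. \<forall>y\<in>D. A (x + y) = A x + A y) \<and>
     (\<forall>c. \<forall>x\<in>D. A (c *\<^sub>C x) = c *\<^sub>C A x) \<and>
     (\<forall>y z. (\<forall>x\<in>D. cinner (A x) y = cinner x z) \<longleftrightarrow> (y \<in> D \<and> z = A y))"

definition zero_in_resolvent :: "'a::chilbert_space set \<Rightarrow> ('a \<Rightarrow> 'a) \<Rightarrow> bool" where
  "zero_in_resolvent D A \<longleftrightarrow> bij_betw A D UNIV \<and> (\<exists>C. \<forall>x\<in>D. norm x \<le> C * norm (A x))"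

definition orth_proj :: "('a::chilbert_space \<Rightarrow> 'a) \<Rightarrow> bool" where
  "orth_proj P \<longleftrightarrow> (\<forall>x y. P (x + y) = P x + P y) \<and> (\<forall>c x. P (c *\<^sub>C x) = c *\<^sub>C P x) \<and>
     (\<forall>x. P (P x) = P x) \<and> (\<forall>x y. cinner (P x) y = cinner x (P y))"

text \<open>The scalar measure B \<mapsto> \<langle>E(B)x,x\<rangle> = \<parallel>E(B)x\<parallel>^2 on the Borel sets of the line.\<close>
definition spectral_scalar :: "(real set \<Rightarrow> 'a::chilbert_space \<Rightarrow> 'a) \<Rightarrow> 'a \<Rightarrow> real measure" where
  "spectral_scalar E x = measure_of UNIV (sets borel) (\<lambda>B. ennreal ((norm (E B x))\<^sup>2))"

text \<open>E is the spectral measure of the self-adjoint operator (D, A):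
a projection valued measure on the Borel sets with E(\<real>) = I, multiplicative,
strongly countably additive, and A = \<integral> \<mu> dE(\<mu>), i.e.
dom A = {x. \<integral> \<mu>^2 d\<langle>E(\<mu>)x,x\<rangle> < \<infinity>} and
\<langle>Ax,x\<rangle> = \<integral> \<mu> d\<langle>E(\<mu>)x,x\<rangle> on dom A (by polarization this determines
\<langle>Ax,y\<rangle>).\<close>
definition spectral_measure ::
  "'a::chilbert_space set \<Rightarrow> ('a \<Rightarrow> 'a) \<Rightarrow> (real set \<Rightarrow> 'a \<Rightarrow> 'a) \<Rightarrow> bool" where
  "spectral_measure D A E \<longleftrightarrow>
     (\<forall>B\<in>sets borel. orth_proj (E B)) \<and>
     E UNIV = id \<and>
     (\<forall>B\<in>sets borel. \<forall>C\<in>sets borel. E (B \<inter> C) = E B \<circ> E C) \<and>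
     (\<forall>F x. range F \<subseteq> sets borel \<longrightarrow> disjoint_family F \<longrightarrow>
        (\<lambda>n. \<Sum>i<n. E (F i) x) \<longlonglongrightarrow> E (\<Union>i. F i) x) \<and>
     D = {x. (\<integral>\<^sup>+ \<mu>. ennreal (\<mu>\<^sup>2) \<partial>spectral_scalar E x) < \<infinity>} \<and>
     (\<forall>x\<in>D. cinner (A x) x = complex_of_real (\<integral> \<mu>. \<mu> \<partial>spectral_scalar E x))"

text \<open>The (unique) spectral measure of a self-adjoint operator.\<close>
definition spec_meas :: "'a::chilbert_space set \<Rightarrow> ('a \<Rightarrow> 'a) \<Rightarrow> real set \<Rightarrow> 'a \<Rightarrow> 'a" where
  "spec_meas D A = (SOME E. spectral_measure D A E)"

text \<open>Form domain dom \<aa> = dom |A|^(1/2) = {x. \<integral> |\<mu>| d\<langle>E(\<mu>)x,x\<rangle> < \<infinity>}.\<close>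
definition form_dom :: "'a::chilbert_space set \<Rightarrow> ('a \<Rightarrow> 'a) \<Rightarrow> 'a set" where
  "form_dom D A = {x. (\<integral>\<^sup>+ \<mu>. ennreal \<bar>\<mu>\<bar> \<partial>spectral_scalar (spec_meas D A) x) < \<infinity>}"

definition form :: "'a::chilbert_space set \<Rightarrow> ('a \<Rightarrow> 'a) \<Rightarrow> 'a \<Rightarrow> real" where
  "form D A x = (\<integral> \<mu>. \<mu> \<partial>spectral_scalar (spec_meas D A) x)"

definition max_nonneg_subspaces :: "'a::complex_vector set \<Rightarrow> ('a \<Rightarrow> real) \<Rightarrow> 'a set set" where
  "max_nonneg_subspaces \<D> q =
     {L. csubspace L \<and> L \<subseteq> \<D> \<and> (\<forall>x\<in>L. q x \<ge> 0) \<and>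
         (\<forall>L'. csubspace L' \<and> L' \<subseteq> \<D> \<and> (\<forall>x\<in>L'. q x \<ge> 0) \<and> L \<subseteq> L' \<longrightarrow> L' = L)}"

end

theory Submission
  imports Defs
begin

text \<open>
  If \<open>0\<close> belonged to the spectrum of \<open>T(\<mu>\<^sub>2)\<close>, there would be unit vectors \<open>x\<^sub>0\<close> in its domain with
  \<open>T(\<mu>\<^sub>2) x\<^sub>0\<close> arbitrarily small. Adding such an \<open>x\<^sub>0\<close> to \<open>\<M>\<close> changes the form \<open>t(\<mu>\<^sub>2)\<close> only slightly, so
  \<open>t(\<mu>\<^sub>2)[u] \<ge> - 4 \<eta> \<parallel>u\<parallel>\<^sup>2\<close> on \<open>\<M> + span x\<^sub>0\<close> with \<open>\<eta>\<close> small. By (VM), a unit vector with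
  \<open>t(\<mu>\<^sub>1)[u] < 0\<close> has \<open>t(\<mu>\<^sub>2)[u]\<close> below a fixed negative number, hence \<open>t(\<mu>\<^sub>1) \<ge> 0\<close> on
  \<open>\<M> + span x\<^sub>0\<close>. Maximality forces \<open>x\<^sub>0 \<in> \<M>\<close>, contradicting \<open>t(\<mu>\<^sub>2)[x\<^sub>0] \<ge> a\<close>.

  The form is defined through a chosen spectral measure, so the argument rests on the spectral
  theorem for unbounded self-adjoint operators. The scalar spectral measures of the Cayley transform
  are obtained as weak limits of Fejer-type densities (Herglotz), and all algebraic identities
  for the resulting functional calculus follow from the fact that a \<open>\<sigma>\<close>-continuous linear functional on
  bounded Borel functions is determined by its values on the integer powers of
  \<open>(s - \<i>) / (s + \<i>)\<close>.
\<close>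

section \<open>Complex inner product spaces\<close>

text \<open>(VM) controls the derivative only where the form is small. The drop between
  \<open>\<mu>1\<close> and \<open>\<mu>2\<close> is quantified by an alternative: a negative value
  either ends at or below \<open>- \<epsilon>\<close>, or stays above \<open>- \<epsilon>\<close>
  throughout and then falls at rate \<open>\<delta>\<close>. Hence the bound
  \<open>min \<epsilon> (\<delta> * (\<mu>2 - \<mu>1))\<close>. (A3) keeps the value negative all
  the way, so only the negative side of the strip matters. Because \<open>spec_meas\<close> is a
  choice, nothing can be said about \<open>form\<close> before some spectral measure exists.
  Afterwards the argument rests on homogeneity, on the inclusion of the operator domain in the form
  domain, and on the expansion of \<open>form\<close> at \<open>x + y\<close> with \<open>y\<close>
  in the operator domain; these hold for every spectral measure of the operator. The Cayley
  transform replaces the operator by a unitary \<open>U\<close>, but adds the point \<open>1\<close>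
  of the circle, which corresponds to infinity. Density of the domain, which is the range of
  \<open>1 - U\<close>, excludes an atom there, and the second moment of a scalar measure decides
  whether a vector lies in that range.\<close>

lemma cinner_add_right: "cinner x (y + z) = cinner x y + cinner (x::'a::complex_inner) z"
  by (metis cinner_conj_commute cinner_add_left complex_cnj_add)

lemma cinner_scaleC_right: "cinner x (c *\<^sub>C y) = cnj c * cinner (x::'a::complex_inner) y"
  by (metis cinner_conj_commute cinner_scaleC_left complex_cnj_mult)

lemma scaleC_zero_left [simp]: "0 *\<^sub>C x = (0::'a::complex_vector)"
  using scaleC_add_left[of 0 0 x] by simp

lemma scaleC_zero_right [simp]: "c *\<^sub>C 0 = (0::'a::complex_vector)"
  using scaleC_add_right[of c 0 0] by simp

lemma scaleC_minus_left: "(- c) *\<^sub>C x = - (c *\<^sub>C (x::'a::complex_vector))"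
  by (metis add_eq_0_iff add.right_inverse scaleC_add_left scaleC_zero_left)

lemma scaleC_minus_right: "c *\<^sub>C (- x) = - (c *\<^sub>C (x::'a::complex_vector))"
  by (metis add_eq_0_iff add.right_inverse scaleC_add_right scaleC_zero_right)

lemma scaleC_diff_right: "c *\<^sub>C (x - y) = c *\<^sub>C x - c *\<^sub>C (y::'a::complex_vector)"
  using scaleC_add_right[of c x "- y"] by (simp add: scaleC_minus_right)

lemma minus_eq_scaleC: "- x = (- 1) *\<^sub>C (x::'a::complex_vector)"
  by (simp add: scaleC_minus_left scaleC_one)

lemma cinner_zero_left [simp]: "cinner 0 (x::'a::complex_inner) = 0"
  using cinner_add_left[of 0 0 x] by simp

lemma cinner_zero_right [simp]: "cinner (x::'a::complex_inner) 0 = 0"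
  using cinner_add_right[of x 0 0] by simp

lemma cinner_minus_left: "cinner (- x) (y::'a::complex_inner) = - cinner x y"
  using cinner_scaleC_left[of "-1" x y] by (simp add: scaleC_minus_left scaleC_one)

lemma cinner_minus_right: "cinner x (- y::'a::complex_inner) = - cinner x y"
  using cinner_scaleC_right[of x "-1" y] by (simp add: scaleC_minus_left scaleC_one)

lemma cinner_diff_left: "cinner (x - y) (z::'a::complex_inner) = cinner x z - cinner y z"
  using cinner_add_left[of x "- y" z] by (simp add: cinner_minus_left)

lemma cinner_diff_right: "cinner x (y - z::'a::complex_inner) = cinner x y - cinner x z"
  using cinner_add_right[of x y "- z"] by (simp add: cinner_minus_right)

lemmas cinner_simps = cinner_add_left cinner_add_right cinner_diff_left cinner_diff_right
  cinner_scaleC_left cinner_scaleC_right cinner_minus_left cinner_minus_right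

lemma cinner_sum_left: "cinner (\<Sum>i\<in>I. f i) (y::'a::complex_inner) = (\<Sum>i\<in>I. cinner (f i) y)"
  by (induction I rule: infinite_finite_induct) (auto simp: cinner_add_left)

lemma cinner_sum_right: "cinner (y::'a::complex_inner) (\<Sum>i\<in>I. f i) = (\<Sum>i\<in>I. cinner y (f i))"
  by (induction I rule: infinite_finite_induct) (auto simp: cinner_add_right)

lemma cinner_self: "cinner x x = complex_of_real ((norm (x::'a::complex_inner))\<^sup>2)"
  by (simp add: norm_eq_sqrt_cinner cinner_self_nonneg complex_eq_iff cinner_self_real)

lemma norm_sq_eq_cinner: "(norm (x::'a::complex_inner))\<^sup>2 = Re (cinner x x)"
  by (simp add: cinner_self)

lemma norm_scaleC: "norm (c *\<^sub>C x) = cmod c * norm (x::'a::complex_inner)"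
proof -
  have "(norm (c *\<^sub>C x))\<^sup>2 = Re ((c * cnj c) * cinner x x)"
    by (simp add: norm_sq_eq_cinner cinner_simps mult_ac)
  also have "\<dots> = (cmod c * norm x)\<^sup>2"
    by (simp add: complex_norm_square[symmetric] cinner_self power_mult_distrib del: of_real_power)
  finally show ?thesis by (simp add: power2_eq_iff_nonneg)
qed

lemma norm_sq_add: "(norm (x + y))\<^sup>2 = (norm x)\<^sup>2 + 2 * Re (cinner x y) + (norm (y::'a::complex_inner))\<^sup>2"
proof -
  have "Re (cinner y x) = Re (cinner x y)" by (metis cinner_conj_commute complex_cnj(1) cnj.simps(1))
  then show ?thesis by (simp add: norm_sq_eq_cinner cinner_simps)
qed

lemma parallelogram_law:
  "(norm (x + y))\<^sup>2 + (norm (x - y))\<^sup>2 = 2 * (norm x)\<^sup>2 + 2 * (norm (y::'a::complex_inner))\<^sup>2"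
  using norm_sq_add[of x y] norm_sq_add[of x "- y"] by (simp add: cinner_simps)

text \<open>Cauchy-Schwarz by Pythagoras: \<open>c *\<^sub>C y\<close> is the orthogonal projection
  of \<open>x\<close> onto the line of \<open>y\<close>.\<close>

lemma norm_cinner_le: "cmod (cinner x y) \<le> norm x * norm (y::'a::complex_inner)"
proof (cases "y = 0")
  case False
  define c where "c = cinner x y / complex_of_real ((norm y)\<^sup>2)"
  have n: "norm y > 0" using False by simp
  have "cinner (x - c *\<^sub>C y) y = 0"
    using n by (simp add: cinner_simps c_def cinner_self)
  then have "(norm ((x - c *\<^sub>C y) + c *\<^sub>C y))\<^sup>2 = (norm (x - c *\<^sub>C y))\<^sup>2 + (norm (c *\<^sub>C y))\<^sup>2"
    by (subst norm_sq_add) (simp add: cinner_simps)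
  then have "(norm (c *\<^sub>C y))\<^sup>2 \<le> (norm x)\<^sup>2" by simp
  then have "cmod c * norm y \<le> norm x" by (simp add: norm_scaleC power2_le_iff_abs_le)
  moreover have "cmod c = cmod (cinner x y) / (norm y)\<^sup>2"
    by (simp add: c_def norm_divide norm_power)
  ultimately show ?thesis using n by (simp add: field_simps power2_eq_square)
qed simp

lemma bounded_linear_cinner_left: "bounded_linear (\<lambda>x. cinner x (y::'a::complex_inner))"
  by (rule bounded_linear_intro[where K = "norm y"])
     (auto simp: cinner_simps scaleR_scaleC scaleR_conv_of_real norm_cinner_le)

lemma bounded_linear_cinner_right: "bounded_linear (\<lambda>x. cinner (y::'a::complex_inner) x)"
  by (rule bounded_linear_intro[where K = "norm y"])
     (auto simp: cinner_simps scaleR_scaleC scaleR_conv_of_real norm_cinner_le mult.commute[of _ "norm y"])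

lemmas tendsto_cinner_left = bounded_linear.tendsto[OF bounded_linear_cinner_left]
lemmas tendsto_cinner_right = bounded_linear.tendsto[OF bounded_linear_cinner_right]

lemma cinner_ext_right:
  assumes "\<And>x. cinner x y = cinner x (z::'a::complex_inner)"
  shows "y = z"
proof -
  have "cinner (y - z) (y - z) = 0" using assms[of "y - z"] by (simp add: cinner_diff_right)
  then show ?thesis by (simp add: cinner_self_eq_zero)
qed

lemma csubspaceD:
  assumes "csubspace S"
  shows "0 \<in> S" "x \<in> S \<Longrightarrow> y \<in> S \<Longrightarrow> x + y \<in> S" "x \<in> S \<Longrightarrow> c *\<^sub>C x \<in> S"
    "x \<in> S \<Longrightarrow> - x \<in> S" "x \<in> S \<Longrightarrow> y \<in> S \<Longrightarrow> x - y \<in> S"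
proof -
  show a: "0 \<in> S" "x \<in> S \<Longrightarrow> y \<in> S \<Longrightarrow> x + y \<in> S" "x \<in> S \<Longrightarrow> c *\<^sub>C x \<in> S" for x y c
    using assms by (auto simp: csubspace_def)
  show m: "x \<in> S \<Longrightarrow> - x \<in> S" for x using a(3)[of x "-1"] by (simp add: minus_eq_scaleC)
  show "x \<in> S \<Longrightarrow> y \<in> S \<Longrightarrow> x - y \<in> S" using a(2)[of x "-y"] m by simp
qed

text \<open>The representing vector is the limit of \<open>A u\<close> along a sequence of \<open>u\<close> minimizing
  \<open>\<parallel>A u\<parallel>\<^sup>2 - 2 Re (\<phi> u)\<close>; by the parallelogram law it is Cauchy.\<close>
lemma riesz_representation:
  fixes A :: "'a::complex_vector \<Rightarrow> 'b::chilbert_space"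
  assumes D: "csubspace D"
    and A_add: "\<And>x y. x \<in> D \<Longrightarrow> y \<in> D \<Longrightarrow> A (x + y) = A x + A y"
    and A_scale: "\<And>c x. x \<in> D \<Longrightarrow> A (c *\<^sub>C x) = c *\<^sub>C A x"
    and \<phi>_add: "\<And>x y. x \<in> D \<Longrightarrow> y \<in> D \<Longrightarrow> \<phi> (x + y) = \<phi> x + \<phi> y"
    and \<phi>_scale: "\<And>c x. x \<in> D \<Longrightarrow> \<phi> (c *\<^sub>C x) = c * \<phi> x"
    and bound: "\<And>x. x \<in> D \<Longrightarrow> cmod (\<phi> x) \<le> C * norm (A x)"
  shows "\<exists>y. \<forall>x\<in>D. \<phi> x = cinner (A x) y"
proof -
  \<comment> \<open>If \<open>\<phi> u = cinner (A u) y\<close>, then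
    \<open>J u = (norm (A u - y))\<^sup>2 - (norm y)\<^sup>2\<close>, so minimizing \<open>J\<close>
    moves \<open>A u\<close> towards the vector sought.\<close>
  define J where "J u = (norm (A u))\<^sup>2 - 2 * Re (\<phi> u)" for u
  have J_ge: "J u \<ge> - C\<^sup>2" if "u \<in> D" for u
  proof -
    have "Re (\<phi> u) \<le> C * norm (A u)"
      using bound[OF that] complex_Re_le_cmod[of "\<phi> u"] by linarith
    moreover have "(norm (A u) - C)\<^sup>2 \<ge> 0" by simp
    ultimately show ?thesis unfolding J_def by (simp add: power2_diff algebra_simps)
  qed
  define m where "m = Inf (J ` D)"
  have bdd: "bdd_below (J ` D)" using J_ge by (intro bdd_belowI[of _ "- C\<^sup>2"]) auto
  have ne: "J ` D \<noteq> {}" using csubspaceD(1)[OF D] by auto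
  have m_le: "m \<le> J u" if "u \<in> D" for u unfolding m_def using bdd that by (auto intro: cInf_lower)
  have "\<exists>u\<in>D. J u < m + 1 / Suc n" for n
    using cInf_less_iff[OF ne bdd, of "m + 1 / Suc n"] unfolding m_def by auto
  then obtain u where u: "\<And>n. u n \<in> D" "\<And>n. J (u n) < m + 1 / Suc n" by metis
  \<comment> \<open>The midpoint \<open>h\<close> competes in the infimum, and \<open>\<phi>\<close>
    cancels in \<open>2 * J v + 2 * J w - 4 * J h\<close>, which leaves the parallelogram
    law.\<close>
  have par: "(norm (A v - A w))\<^sup>2 \<le> 2 * (J v - m) + 2 * (J w - m)" if v: "v \<in> D" and w: "w \<in> D" for v w
  proof -
    define h where "h = (1/2) *\<^sub>C (v + w)"
    have h: "h \<in> D" using csubspaceD[OF D] v w by (simp add: h_def)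
    have Ah: "A h = (1/2) *\<^sub>C (A v + A w)"
      using csubspaceD[OF D] v w by (simp add: h_def A_scale A_add)
    have "\<phi> h = (\<phi> v + \<phi> w) / 2"
      using csubspaceD[OF D] v w by (simp add: h_def \<phi>_scale \<phi>_add)
    then have "Re (\<phi> h) = (Re (\<phi> v) + Re (\<phi> w)) / 2"
      by (metis Re_divide_numeral plus_complex.simps(1))
    moreover have "4 * (norm (A h))\<^sup>2 = (norm (A v + A w))\<^sup>2"
      by (simp add: Ah norm_scaleC power_mult_distrib power2_eq_square)
    ultimately show ?thesis
      using parallelogram_law[of "A v" "A w"] m_le[OF h] unfolding J_def by simp
  qed
  have "Cauchy (\<lambda>n. A (u n))"
  proof (rule CauchyI)
    fix e :: real assume e: "e > 0"
    obtain N where N: "4 * (1 / Suc N) < e\<^sup>2"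
      using reals_Archimedean[of "e\<^sup>2 / 4"] e by (auto simp: field_simps)
    show "\<exists>M. \<forall>m\<ge>M. \<forall>n\<ge>M. norm (A (u m) - A (u n)) < e"
    proof (intro exI allI impI)
      fix k l assume kl: "N \<le> k" "N \<le> l"
      have "1 / Suc k \<le> 1 / Suc N" "1 / Suc l \<le> 1 / Suc N"
        using kl by (auto simp: field_simps)
      then have "(norm (A (u k) - A (u l)))\<^sup>2 < e\<^sup>2"
        using par[OF u(1)[of k] u(1)[of l]] u(2)[of k] u(2)[of l] N
        by (smt (verit))
      then show "norm (A (u k) - A (u l)) < e"
        using e power2_less_imp_less[of _ e] by simp
    qed
  qed
  then obtain y where y: "(\<lambda>n. A (u n)) \<longlonglongrightarrow> y" using Cauchy_convergent_iff convergent_def by blast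
  have Jlim: "(\<lambda>n. J (u n)) \<longlonglongrightarrow> m"
  proof (rule tendsto_sandwich)
    show "\<forall>\<^sub>F n in sequentially. m \<le> J (u n)" using m_le u(1) by simp
    show "\<forall>\<^sub>F n in sequentially. J (u n) \<le> m + inverse (real (Suc n))"
      using u(2) by (simp add: less_imp_le inverse_eq_divide)
    show "(\<lambda>n. m + inverse (real (Suc n))) \<longlonglongrightarrow> m"
      using tendsto_add[OF tendsto_const LIMSEQ_inverse_real_of_nat] by simp
  qed simp
  \<comment> \<open>First variation at the minimum: \<open>u n + x\<close> is a competitor, and in
    the limit \<open>A (u n)\<close> becomes \<open>y\<close> while \<open>J (u n) - m\<close>
    disappears.\<close>
  have key: "(norm (A x))\<^sup>2 + 2 * Re (cinner y (A x)) - 2 * Re (\<phi> x) \<ge> 0" if x: "x \<in> D" for x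
  proof -
    have "0 \<le> J (u n) - m + ((norm (A x))\<^sup>2 + 2 * Re (cinner (A (u n)) (A x)) - 2 * Re (\<phi> x))" for n
      using m_le[of "u n + x"] csubspaceD(2)[OF D u(1) x, of n]
      by (simp add: J_def A_add \<phi>_add u(1) x norm_sq_add)
    moreover have "(\<lambda>n. J (u n) - m + ((norm (A x))\<^sup>2 + 2 * Re (cinner (A (u n)) (A x)) - 2 * Re (\<phi> x)))
       \<longlonglongrightarrow> m - m + ((norm (A x))\<^sup>2 + 2 * Re (cinner y (A x)) - 2 * Re (\<phi> x))"
      by (intro tendsto_intros Jlim tendsto_cinner_left y)
    ultimately show ?thesis using LIMSEQ_le_const by fastforce
  qed
  \<comment> \<open>Scaling \<open>x\<close> by \<open>r > 0\<close> in \<open>key\<close> and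
    dividing by \<open>r\<close> leaves a quadratic term of order \<open>r\<close>, which vanishes
    as \<open>r\<close> tends to 0. Passing to \<open>- x\<close> and to
    \<open>\<i> *\<^sub>C x\<close> below turns the one-sided real inequality into the complex
    identity.\<close>
  have zero: "Re (\<phi> x) \<le> Re (cinner (A x) y)" if x: "x \<in> D" for x
  proof -
    define d where "d = Re (\<phi> x) - Re (cinner y (A x))"
    have "r * (norm (A x))\<^sup>2 \<ge> 2 * d" if r: "r > 0" for r :: real
    proof -
      have "r * (r * (norm (A x))\<^sup>2 - 2 * d) \<ge> 0"
        using key[of "complex_of_real r *\<^sub>C x"] csubspaceD(3)[OF D x]
        by (simp add: A_scale \<phi>_scale x norm_scaleC cinner_simps power_mult_distrib d_def
             algebra_simps power2_eq_square)
      then show ?thesis using r by (simp add: zero_le_mult_iff)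
    qed
    moreover have "((\<lambda>r. r * (norm (A x))\<^sup>2) \<longlongrightarrow> 0 * (norm (A x))\<^sup>2) (at_right 0)"
      by (intro tendsto_intros)
    ultimately have "2 * d \<le> 0 * (norm (A x))\<^sup>2"
      by (intro tendsto_lowerbound[of "\<lambda>r. r * (norm (A x))\<^sup>2" _ "at_right (0::real)"])
        (auto simp: eventually_at_right_less intro!: eventually_mono[OF eventually_at_right_less])
    moreover have "Re (cinner y (A x)) = Re (cinner (A x) y)"
      by (metis cinner_conj_commute cnj.simps(1))
    ultimately show ?thesis by (simp add: d_def)
  qed
  have re: "Re (\<phi> x) = Re (cinner (A x) y)" if x: "x \<in> D" for x
    using zero[OF x] zero[of "(-1) *\<^sub>C x"] csubspaceD(3)[OF D x, of "-1"]
    by (simp add: \<phi>_scale A_scale x cinner_simps)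
  have "\<phi> x = cinner (A x) y" if x: "x \<in> D" for x
    using re[OF x] re[of "\<i> *\<^sub>C x"] csubspaceD(3)[OF D x, of "\<i>"]
    by (simp add: \<phi>_scale A_scale x cinner_simps complex_eq_iff)
  then show ?thesis by blast
qed

section \<open>Functionals on bounded Borel functions\<close>

definition bounded_borel :: "(real \<Rightarrow> complex) \<Rightarrow> bool" where
  "bounded_borel f \<longleftrightarrow> f \<in> borel_measurable borel \<and> (\<exists>K. \<forall>s. cmod (f s) \<le> K)"

lemma bounded_borelI: "f \<in> borel_measurable borel \<Longrightarrow> (\<And>s. cmod (f s) \<le> K) \<Longrightarrow> bounded_borel f"
  by (auto simp: bounded_borel_def)

lemma bounded_borel_measurable: "bounded_borel f \<Longrightarrow> f \<in> borel_measurable borel"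
  by (simp add: bounded_borel_def)

lemma bounded_borel_bound:
  assumes "bounded_borel f" obtains K where "K > 0" "\<And>s. cmod (f s) \<le> K"
proof -
  obtain K where K: "\<And>s. cmod (f s) \<le> K" using assms by (auto simp: bounded_borel_def)
  have "cmod (f s) \<le> \<bar>K\<bar> + 1" for s using K[of s] by linarith
  then show ?thesis using that[of "\<bar>K\<bar> + 1"] by auto
qed

lemma bounded_borel_const [intro, simp]: "bounded_borel (\<lambda>s. a)"
  by (rule bounded_borelI[where K = "cmod a"]) auto

lemma bounded_borel_add [intro]:
  assumes "bounded_borel f" "bounded_borel g" shows "bounded_borel (\<lambda>s. f s + g s)"
proof -
  obtain K L where KL: "\<And>s. cmod (f s) \<le> K" "\<And>s. cmod (g s) \<le> L"
    using assms by (auto simp: bounded_borel_def)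
  have [measurable]: "f \<in> borel_measurable borel" "g \<in> borel_measurable borel"
    using assms by (auto simp: bounded_borel_def)
  show ?thesis
    by (rule bounded_borelI[where K = "K + L"])
       (auto intro!: norm_triangle_mono KL)
qed

lemma bounded_borel_mult [intro]:
  assumes "bounded_borel f" "bounded_borel g" shows "bounded_borel (\<lambda>s. f s * g s)"
proof -
  obtain K L where KL: "K > 0" "L > 0" "\<And>s. cmod (f s) \<le> K" "\<And>s. cmod (g s) \<le> L"
    using bounded_borel_bound assms by metis
  have [measurable]: "f \<in> borel_measurable borel" "g \<in> borel_measurable borel"
    using assms by (auto simp: bounded_borel_def)
  show ?thesis
    by (rule bounded_borelI[where K = "K * L"])
       (use KL in \<open>auto simp: norm_mult less_imp_le intro!: mult_mono\<close>)
qed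

lemma bounded_borel_minus [intro]: "bounded_borel f \<Longrightarrow> bounded_borel (\<lambda>s. - f s)"
  using bounded_borel_mult[OF bounded_borel_const[of "-1"]] by simp

lemma bounded_borel_diff [intro]:
  "bounded_borel f \<Longrightarrow> bounded_borel g \<Longrightarrow> bounded_borel (\<lambda>s. f s - g s)"
  using bounded_borel_add[OF _ bounded_borel_minus] by simp

lemma bounded_borel_power [intro]: "bounded_borel f \<Longrightarrow> bounded_borel (\<lambda>s. f s ^ n)"
  by (induction n) auto

lemma bounded_borel_cnj [intro]: "bounded_borel f \<Longrightarrow> bounded_borel (\<lambda>s. cnj (f s))"
  unfolding bounded_borel_def
  by (simp add: borel_measurable_continuous_on[where f = cnj] continuous_on_cnj continuous_on_id)

lemma bounded_borel_sum [intro]: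
  "(\<And>i. i \<in> I \<Longrightarrow> bounded_borel (f i)) \<Longrightarrow> bounded_borel (\<lambda>s. \<Sum>i\<in>I. f i s)"
  by (induction I rule: infinite_finite_induct) auto

lemma bounded_borel_indicator [intro]: "B \<in> sets borel \<Longrightarrow> bounded_borel (indicator B)"
  by (rule bounded_borelI[where K = 1]) (auto simp: indicator_def)

text \<open>Integration against a complex Borel measure, described by its behaviour: linearity and
  continuity under bounded pointwise convergence. In this form sums, multiplication by a fixed
  bounded function and conjugation stay in the class, so both sides of an identity can be fed into
  \<open>sigma_functional_eqI\<close>.\<close>

definition sigma_functional :: "((real \<Rightarrow> complex) \<Rightarrow> complex) \<Rightarrow> bool" where
  "sigma_functional \<Lambda> \<longleftrightarrow>
     (\<forall>f g. bounded_borel f \<longrightarrow> bounded_borel g \<longrightarrow> \<Lambda> (\<lambda>s. f s + g s) = \<Lambda> f + \<Lambda> g) \<and>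
     (\<forall>a f. bounded_borel f \<longrightarrow> \<Lambda> (\<lambda>s. a * f s) = a * \<Lambda> f) \<and>
     (\<forall>F f K. (\<forall>n. F n \<in> borel_measurable borel) \<longrightarrow> (\<forall>n s. cmod (F n s) \<le> K) \<longrightarrow>
        (\<forall>s. (\<lambda>n. F n s) \<longlonglongrightarrow> f s) \<longrightarrow> (\<lambda>n. \<Lambda> (F n)) \<longlonglongrightarrow> \<Lambda> f)"

lemma sigma_functionalD:
  assumes "sigma_functional \<Lambda>"
  shows "bounded_borel f \<Longrightarrow> bounded_borel g \<Longrightarrow> \<Lambda> (\<lambda>s. f s + g s) = \<Lambda> f + \<Lambda> g"
    and "bounded_borel f \<Longrightarrow> \<Lambda> (\<lambda>s. a * f s) = a * \<Lambda> f"
    and "(\<And>n. F n \<in> borel_measurable borel) \<Longrightarrow> (\<And>n s. cmod (F n s) \<le> K) \<Longrightarrow>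
        (\<And>s. (\<lambda>n. F n s) \<longlonglongrightarrow> h s) \<Longrightarrow> (\<lambda>n. \<Lambda> (F n)) \<longlonglongrightarrow> \<Lambda> h"
  using assms unfolding sigma_functional_def by blast+

lemma sigma_functional_tendsto:
  assumes "sigma_functional \<Lambda>" "\<forall>n. F n \<in> borel_measurable borel" "\<forall>n s. cmod (F n s) \<le> K"
    "\<forall>s. (\<lambda>n. F n s) \<longlonglongrightarrow> f s"
  shows "(\<lambda>n. \<Lambda> (F n)) \<longlonglongrightarrow> \<Lambda> f"
  using assms unfolding sigma_functional_def by blast

lemma sigma_functional_sum:
  assumes \<Lambda>: "sigma_functional \<Lambda>" and "\<And>i. i \<in> I \<Longrightarrow> bounded_borel (F i)"
  shows "\<Lambda> (\<lambda>s. \<Sum>i\<in>I. a i * F i s) = (\<Sum>i\<in>I. a i * \<Lambda> (F i))"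
proof -
  have "\<Lambda> (\<lambda>s. 0) = 0" using sigma_functionalD(2)[OF \<Lambda> bounded_borel_const[of 1], of 0] by simp
  then show ?thesis using assms(2)
    by (induction I rule: infinite_finite_induct)
       (simp_all add: sigma_functionalD(1,2)[OF \<Lambda>] bounded_borel_sum bounded_borel_mult)
qed

lemma sigma_functional_integral:
  assumes "finite_measure M" "sets M = sets borel"
  shows "sigma_functional (\<lambda>f. \<integral>s. f s \<partial>M)"
proof -
  interpret finite_measure M by fact
  note [measurable_cong] = assms(2)
  have int: "integrable M f" if f: "bounded_borel f" for f
  proof -
    obtain K where "\<And>s. cmod (f s) \<le> K" using f by (auto simp: bounded_borel_def)
    moreover have "f \<in> borel_measurable M"
      using bounded_borel_measurable[OF f] by measurable
    ultimately show ?thesis by (intro integrable_const_bound[where B = K]) auto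
  qed
  show ?thesis unfolding sigma_functional_def
  proof (intro conjI allI impI)
    fix F :: "nat \<Rightarrow> real \<Rightarrow> complex" and f K
    assume F: "\<forall>n. F n \<in> borel_measurable borel" "\<forall>n s. cmod (F n s) \<le> K" "\<forall>s. (\<lambda>n. F n s) \<longlonglongrightarrow> f s"
    have [measurable]: "F n \<in> borel_measurable borel" for n using F by simp
    have [measurable]: "f \<in> borel_measurable borel"
      by (rule borel_measurable_LIMSEQ_metric[of F]) (use F in auto)
    show "(\<lambda>n. \<integral>s. F n s \<partial>M) \<longlonglongrightarrow> (\<integral>s. f s \<partial>M)"
      by (rule integral_dominated_convergence[where w = "\<lambda>_. K"]) (use F in auto)
  qed (auto simp: int)
qed

lemma sigma_functional_add:
  "sigma_functional \<Lambda> \<Longrightarrow> sigma_functional \<Lambda>' \<Longrightarrow> sigma_functional (\<lambda>f. \<Lambda> f + \<Lambda>' f)"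
  by (subst sigma_functional_def, intro conjI allI impI)
     (auto simp: sigma_functionalD(1,2) algebra_simps intro!: tendsto_add,
      (erule (1) sigma_functional_tendsto; blast)+)

lemma sigma_functional_cmult:
  "sigma_functional \<Lambda> \<Longrightarrow> sigma_functional (\<lambda>f. a * \<Lambda> f)"
  by (subst sigma_functional_def, intro conjI allI impI)
     (auto simp: sigma_functionalD(1,2) algebra_simps intro!: tendsto_mult,
      (erule (1) sigma_functional_tendsto; blast)+)

lemma sigma_functional_diff:
  "sigma_functional \<Lambda> \<Longrightarrow> sigma_functional \<Lambda>' \<Longrightarrow> sigma_functional (\<lambda>f. \<Lambda> f - \<Lambda>' f)"
  using sigma_functional_add[OF _ sigma_functional_cmult[where a = "-1"]] by simp

lemma sigma_functional_mult:
  assumes \<Lambda>: "sigma_functional \<Lambda>" and g: "bounded_borel g"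
  shows "sigma_functional (\<lambda>f. \<Lambda> (\<lambda>s. f s * g s))"
  unfolding sigma_functional_def
proof (intro conjI allI impI)
  fix F :: "nat \<Rightarrow> real \<Rightarrow> complex" and f K
  assume F: "\<forall>n. F n \<in> borel_measurable borel" "\<forall>n s. cmod (F n s) \<le> K" "\<forall>s. (\<lambda>n. F n s) \<longlonglongrightarrow> f s"
  obtain L where L: "L > 0" "\<And>s. cmod (g s) \<le> L" using bounded_borel_bound[OF g] by metis
  have [measurable]: "g \<in> borel_measurable borel" "\<And>n. F n \<in> borel_measurable borel"
    using g F by (auto simp: bounded_borel_def)
  have "0 \<le> K" using F(2) norm_ge_zero order_trans by metis
  then show "(\<lambda>n. \<Lambda> (\<lambda>s. F n s * g s)) \<longlonglongrightarrow> \<Lambda> (\<lambda>s. f s * g s)"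
    using F L by (intro sigma_functionalD(3)[OF \<Lambda>, where K = "K * L"])
      (auto simp: norm_mult intro!: mult_mono tendsto_mult)
qed (use g sigma_functionalD(1,2)[OF \<Lambda>] bounded_borel_mult in \<open>auto simp: algebra_simps\<close>)

lemma sigma_functional_cnj:
  assumes \<Lambda>: "sigma_functional \<Lambda>"
  shows "sigma_functional (\<lambda>f. cnj (\<Lambda> (\<lambda>s. cnj (f s))))"
  unfolding sigma_functional_def
proof (intro conjI allI impI)
  fix F :: "nat \<Rightarrow> real \<Rightarrow> complex" and f K
  assume F: "\<forall>n. F n \<in> borel_measurable borel" "\<forall>n s. cmod (F n s) \<le> K" "\<forall>s. (\<lambda>n. F n s) \<longlonglongrightarrow> f s"
  have "(\<lambda>s. cnj (F n s)) \<in> borel_measurable borel" for n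
    by (rule borel_measurable_continuous_on[where f = cnj]) (use F in \<open>auto intro!: continuous_intros\<close>)
  then show "(\<lambda>n. cnj (\<Lambda> (\<lambda>s. cnj (F n s)))) \<longlonglongrightarrow> cnj (\<Lambda> (\<lambda>s. cnj (f s)))"
    using F by (intro tendsto_cnj sigma_functionalD(3)[OF \<Lambda>, where K = K]) (auto intro!: tendsto_cnj)
qed (use sigma_functionalD(1,2)[OF \<Lambda>] bounded_borel_cnj in auto)

section \<open>The Cayley variable and uniqueness from its integer powers\<close>

definition cayley :: "real \<Rightarrow> complex" where
  "cayley s = (of_real s - \<i>) / (of_real s + \<i>)"

lemma Re_cayley: "Re (cayley s) = (s\<^sup>2 - 1) / (s\<^sup>2 + 1)"
  and Im_cayley: "Im (cayley s) = - 2 * s / (s\<^sup>2 + 1)"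
  by (auto simp: cayley_def Re_divide Im_divide power2_eq_square)

lemma square_plus_one_pos: "(s::real)\<^sup>2 + 1 > 0" "(s::real)\<^sup>2 + 1 \<noteq> 0"
proof -
  show "(s::real)\<^sup>2 + 1 > 0" using zero_le_power2[of s] by linarith
  then show "(s::real)\<^sup>2 + 1 \<noteq> 0" by simp
qed

lemma norm_cayley [simp]: "cmod (cayley s) = 1"
proof -
  have "cmod (of_real s - \<i>) = cmod (of_real s + \<i>)" by (simp add: cmod_def)
  moreover have "of_real s + \<i> \<noteq> 0" by (simp add: complex_eq_iff)
  ultimately show ?thesis by (simp add: cayley_def norm_divide)
qed

lemma cayley_nonzero [simp]: "cayley s \<noteq> 0"
  using norm_cayley[of s] by (metis norm_zero zero_neq_one)

lemma cnj_cayley: "cnj (cayley s) = inverse (cayley s)"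
  using complex_norm_square[of "cayley s"] by (simp add: field_simps)

lemma bounded_borel_cayley [intro]: "bounded_borel (\<lambda>s. cayley s powi n)"
proof (rule bounded_borelI[where K = 1])
  have "continuous_on UNIV cayley"
    unfolding cayley_def by (intro continuous_intros) (simp add: complex_eq_iff)
  then show "(\<lambda>s. cayley s powi n) \<in> borel_measurable borel"
    by (intro borel_measurable_continuous_onI continuous_on_power_int) auto
qed (simp add: norm_power_int)

lemma cnj_cayley_powi: "cnj (cayley s powi n) = cayley s powi (- n)"
  by (simp add: complex_cnj_power_int cnj_cayley power_int_inverse power_int_minus)

text \<open>The open interval \<open>(a, b)\<close> is the set where the trigonometric polynomial
  \<open>(s - a) (s - b) / (s\<^sup>2 + 1)\<close> in the Cayley variable is negative, so its indicator is a bounded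
  pointwise limit of polynomials in the Cayley variable and its inverse.\<close>
lemma sigma_functional_indicator_interval_eq_0:
  assumes \<Lambda>: "sigma_functional \<Lambda>" and zero: "\<And>n::int. \<Lambda> (\<lambda>s. cayley s powi n) = 0"
  shows "\<Lambda> (indicator {a<..<b}) = 0"
proof (cases "a < b")
  case True
  define h where "h s = (s - a) * (s - b) / (s\<^sup>2 + 1)" for s :: real
  \<comment> \<open>With \<open>c = cayley s\<close>, the quotients of 1, \<open>s\<close> and the
    square of \<open>s\<close> by the denominator of \<open>h\<close> are
    \<open>(1 - Re c) / 2\<close>, \<open>- Im c / 2\<close> and \<open>(1 + Re c) / 2\<close>.
    Writing \<open>h s\<close> as \<open>\<alpha> + 2 * Re (\<beta> * c)\<close> forces these
    coefficients.\<close>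
  define \<alpha> where "\<alpha> = complex_of_real (1 + (a * b - 1) / 2)"
  define \<beta> where "\<beta> = Complex (- (a * b - 1) / 4) (- (a + b) / 4)"
  have h_eq: "complex_of_real (h s) = \<alpha> + \<beta> * cayley s + cnj \<beta> * inverse (cayley s)" for s
  proof -
    have "1 + (a * b - 1) / 2 + 2 * (- (a * b - 1) / 4 * ((s\<^sup>2 - 1) / (s\<^sup>2 + 1))
        - - (a + b) / 4 * (- 2 * s / (s\<^sup>2 + 1))) = h s"
      unfolding h_def using square_plus_one_pos(2)[of s]
      by (simp add: divide_simps) (simp add: algebra_simps power2_eq_square)
    then show ?thesis
      by (simp add: cnj_cayley[symmetric] complex_eq_iff \<alpha>_def \<beta>_def Re_cayley Im_cayley)
  qed
  obtain K where K: "K > 0" "\<And>s. \<bar>h s\<bar> \<le> K"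
  proof -
    have "cmod (of_real (h s)) \<le> cmod \<alpha> + cmod \<beta> + cmod \<beta>" for s
      unfolding h_eq by (intro norm_triangle_mono) (auto simp: norm_mult norm_inverse)
    then have "\<bar>h s\<bar> \<le> cmod \<alpha> + cmod \<beta> + cmod \<beta> + 1" for s by (simp add: add_increasing2 order_trans)
    then show ?thesis using that[of "cmod \<alpha> + cmod \<beta> + cmod \<beta> + 1"]
      by (meson add_nonneg_pos add_nonneg_nonneg norm_ge_zero zero_less_one)
  qed
  have [measurable]: "h \<in> borel_measurable borel" unfolding h_def by measurable
  have bh: "bounded_borel (\<lambda>s. of_real (h s))"
    by (rule bounded_borelI[where K = K]) (use K in auto)
  \<comment> \<open>The extra power of \<open>cayley s\<close> makes the induction work: a factor
    \<open>h s\<close> shifts the exponent \<open>m\<close> by -1, 0 or 1.\<close>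
  have hpow0: "\<Lambda> (\<lambda>s. of_real (h s) ^ k * cayley s powi m) = 0" for k m
  proof (induction k arbitrary: m)
    case (Suc k)
    let ?g = "\<lambda>m s. complex_of_real (h s) ^ k * cayley s powi m"
    have bg: "bounded_borel (?g m)" for m using bh by auto
    have "of_real (h s) ^ Suc k * cayley s powi m
        = (\<alpha> * ?g m s + \<beta> * ?g (m + 1) s) + cnj \<beta> * ?g (m - 1) s" for s
      by (simp add: h_eq power_int_add power_int_diff field_simps)
    then have "(\<lambda>s. of_real (h s) ^ Suc k * cayley s powi m)
        = (\<lambda>s. (\<alpha> * ?g m s + \<beta> * ?g (m + 1) s) + cnj \<beta> * ?g (m - 1) s)" by blast
    then show ?case
      using Suc.IH bg by (simp only: sigma_functionalD(1,2)[OF \<Lambda>] bounded_borel_add bounded_borel_mult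
        bounded_borel_const) simp
  qed (simp add: zero)
  have hpow: "\<Lambda> (\<lambda>s. of_real (h s) ^ k) = 0" for k using hpow0[of k 0] by simp
  have poly: "\<Lambda> (\<lambda>s. of_real (\<Sum>i\<le>n. c i * h s ^ i)) = 0" for c :: "nat \<Rightarrow> real" and n :: nat
    using sigma_functional_sum[OF \<Lambda>, of "{..n}" "\<lambda>i s. of_real (h s) ^ i" "\<lambda>i. of_real (c i)"] hpow bh
    by (simp add: bounded_borel_power)
  \<comment> \<open>A continuous stand-in for the indicator of \<open>y < 0\<close>: it is 0 for
    \<open>y \<ge> 0\<close> and, for \<open>k > 0\<close>, it is 1 once
    \<open>y \<le> - 1 / k\<close>. Continuity lets Weierstrass replace it on \<open>{-K..K}\<close>
    by a polynomial with error below \<open>1 / (k + 1)\<close>; the bound 2 used later is 1 for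
    \<open>g\<close> plus at most 1 for this error.\<close>
  define g where "g k y = min 1 (max 0 (- (real k * y)))" for k and y :: real
  have "\<exists>p. (\<exists>c n. p = (\<lambda>x. \<Sum>i\<le>n. c i * x ^ i)) \<and> (\<forall>y\<in>{-K..K}. \<bar>g k y - p y\<bar> < inverse (real (Suc k)))" for k
  proof -
    have "continuous_on {-K..K} (g k)" unfolding g_def by (intro continuous_intros)
    then obtain p where "real_polynomial_function p" "\<And>x. x \<in> {-K..K} \<Longrightarrow> \<bar>g k x - p x\<bar> < inverse (real (Suc k))"
      using Stone_Weierstrass_real_polynomial_function[of "{-K..K}" "g k" "inverse (real (Suc k))"]
      by auto
    then show ?thesis unfolding real_polynomial_function_iff_sum by blast
  qed
  then obtain p where p: "\<And>k. \<exists>c n. p k = (\<lambda>x. \<Sum>i\<le>n. c i * x ^ i)"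
      "\<And>k y. y \<in> {-K..K} \<Longrightarrow> \<bar>g k y - p k y\<bar> < inverse (real (Suc k))" by metis
  have p0: "\<Lambda> (\<lambda>s. of_real (p k (h s))) = 0" for k using p(1)[of k] poly by auto
  have [measurable]: "p k \<in> borel_measurable borel" for k
    using p(1)[of k] by (auto intro!: borel_measurable_sum)
  have ph: "\<bar>g k (h s) - p k (h s)\<bar> < inverse (real (Suc k))" for k s
    using p(2)[of "h s" k] K(2)[of s] by (auto simp: abs_le_iff)
  have "(\<lambda>k. \<Lambda> (\<lambda>s. of_real (p k (h s)))) \<longlonglongrightarrow> \<Lambda> (indicator {a<..<b})"
  proof (rule sigma_functionalD(3)[OF \<Lambda>, where K = 2])
    fix k s
    have "\<bar>g k (h s)\<bar> \<le> 1" by (auto simp: g_def)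
    moreover have "inverse (real (Suc k)) \<le> 1" by (simp add: inverse_le_1_iff)
    ultimately have "\<bar>p k (h s)\<bar> \<le> 2" using ph[of k s] by linarith
    then show "cmod (of_real (p k (h s))) \<le> 2" by simp
  next
    fix s
    have neg: "h s < 0 \<longleftrightarrow> s \<in> {a<..<b}"
      unfolding h_def using square_plus_one_pos(1)[of s] True
      by (auto simp: divide_less_0_iff mult_less_0_iff)
    have "(\<lambda>k. g k (h s)) \<longlonglongrightarrow> indicator {a<..<b} s"
    proof (cases "h s < 0")
      case hs: True
      obtain k0 where k0: "real k0 * (- h s) > 1" using ex_less_of_nat_mult[of "- h s" 1] hs by auto
      have "g k (h s) = 1" if "k \<ge> k0" for k
      proof -
        have "real k * (- h s) \<ge> real k0 * (- h s)" using that hs by (intro mult_right_mono) auto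
        then have "- (real k * h s) \<ge> 1" using k0 by simp
        then show ?thesis by (auto simp: g_def)
      qed
      then have "\<forall>\<^sub>F k in sequentially. g k (h s) = 1" by (auto simp: eventually_sequentially)
      then show ?thesis using hs neg by (simp add: tendsto_eventually)
    next
      case False
      then have "g k (h s) = 0" for k by (auto simp: g_def)
      then show ?thesis using False neg by simp
    qed
    moreover have "(\<lambda>k. g k (h s) - p k (h s)) \<longlonglongrightarrow> 0"
      by (rule Lim_null_comparison[OF _ LIMSEQ_inverse_real_of_nat]) (auto intro!: always_eventually less_imp_le ph simp del: of_nat_Suc)
    ultimately have "(\<lambda>k. g k (h s) - (g k (h s) - p k (h s))) \<longlonglongrightarrow> indicator {a<..<b} s - 0"
      by (rule tendsto_diff)
    then have "(\<lambda>k. complex_of_real (p k (h s))) \<longlonglongrightarrow> of_real (indicator {a<..<b} s)"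
      by (intro tendsto_of_real) simp
    then show "(\<lambda>k. complex_of_real (p k (h s))) \<longlonglongrightarrow> indicator {a<..<b} s"
      by (auto simp: indicator_def split: if_splits)
  qed measurable
  then show ?thesis using p0 by (simp add: LIMSEQ_const_iff)
next
  case False
  then have "indicator {a<..<b} = (\<lambda>s. 0 * (0::complex))" by auto
  then show ?thesis using sigma_functionalD(2)[OF \<Lambda> bounded_borel_const[of 0], of 0] by simp
qed

text \<open>Open intervals are stable under intersection and generate the Borel sets. The sets
  \<open>B\<close> with \<open>\<Lambda> (indicator B) = 0\<close> are closed under complements,
  since exponent 0 makes \<open>\<Lambda>\<close> vanish at the constant 1, and under disjoint
  countable unions by bounded convergence. Uniformly bounded simple approximations then reach every
  bounded Borel function.\<close>

proposition sigma_functional_eq_0: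
  assumes \<Lambda>: "sigma_functional \<Lambda>" and zero: "\<And>n::int. \<Lambda> (\<lambda>s. cayley s powi n) = 0"
    and f: "bounded_borel f"
  shows "\<Lambda> f = 0"
proof -
  have one: "\<Lambda> (\<lambda>s. 1) = 0" using zero[of 0] by simp
  have z0: "\<Lambda> (\<lambda>s. 0) = 0" using sigma_functionalD(2)[OF \<Lambda> bounded_borel_const[of 1], of 0] by simp
  have ind: "\<Lambda> (indicator B) = 0" if "B \<in> sets borel" for B
  proof -
    let ?G = "range (\<lambda>(a, b). {a<..<b::real})"
    have G: "sets (borel :: real measure) = sigma_sets UNIV ?G"
      unfolding borel_eq_box[where 'a = real] box_real by simp
    have "Int_stable ?G"
      unfolding Int_stable_def by (auto simp: Int_greaterThanLessThan)
    moreover have "?G \<subseteq> Pow UNIV" by simp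
    ultimately show ?thesis using that[unfolded G]
    proof (induction B rule: sigma_sets_induct_disjoint)
      case (basic A)
      then show ?case using sigma_functional_indicator_interval_eq_0[OF \<Lambda> zero] by auto
    next
      case empty
      have "indicator {} = (\<lambda>s::real. 0::complex)" by auto
      then show ?case using z0 by simp
    next
      case (compl A)
      then have A: "A \<in> sets borel" using G by simp
      have "indicator (UNIV - A) = (\<lambda>s. 1 + (-1) * (indicator A s :: complex))"
        by (auto simp: indicator_def)
      moreover have "\<Lambda> (\<lambda>s. 1 + (-1) * indicator A s) = \<Lambda> (\<lambda>s. 1) + \<Lambda> (\<lambda>s. (-1) * indicator A s)"
        using A by (intro sigma_functionalD(1)[OF \<Lambda>]) auto
      ultimately show ?case
        using compl one sigma_functionalD(2)[OF \<Lambda> bounded_borel_indicator[OF A], of "-1"] by simp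
    next
      case (union A)
      then have A: "A i \<in> sets borel" for i using G by auto
      have "(\<lambda>n. \<Lambda> (\<lambda>s. \<Sum>i<n. indicator (A i) s)) \<longlonglongrightarrow> \<Lambda> (indicator (\<Union>i. A i))"
      proof (rule sigma_functionalD(3)[OF \<Lambda>, where K = 1])
        show "(\<lambda>s. \<Sum>i<n. indicator (A i) s :: complex) \<in> borel_measurable borel" for n
          using A by (intro borel_measurable_sum) auto
        \<comment> \<open>Disjointness keeps the partial sums bounded by 1, as bounded convergence
          demands.\<close>
        have eq: "(\<Sum>i<n. indicator (A i) s :: complex) = indicator (\<Union>i<n. A i) s" for n s
          using union by (intro indicator_UN_disjoint[symmetric]) (auto simp: disjoint_family_on_def)
        show "cmod (\<Sum>i<n. indicator (A i) s) \<le> 1" for n s unfolding eq by (simp add: indicator_def)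
        show "(\<lambda>n. \<Sum>i<n. indicator (A i) s :: complex) \<longlonglongrightarrow> indicator (\<Union>i. A i) s" for s
          unfolding eq by (rule LIMSEQ_indicator_UN)
      qed
      moreover have "\<Lambda> (\<lambda>s. \<Sum>i<n. indicator (A i) s) = 0" for n
        using sigma_functional_sum[OF \<Lambda>, of "{..<n}" "\<lambda>i. indicator (A i)" "\<lambda>_. 1"] A union
        by (simp add: bounded_borel_indicator)
      ultimately show ?case by (simp add: LIMSEQ_const_iff)
    qed
  qed
  obtain K where K: "\<And>s. cmod (f s) \<le> K" using f by (auto simp: bounded_borel_def)
  obtain F where F: "\<And>i. simple_function borel (F i)" "\<And>x. (\<lambda>i. F i x) \<longlonglongrightarrow> f x"
      "\<And>i x. dist (F i x) 0 \<le> 2 * dist (f x) 0"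
    using borel_measurable_implies_sequence_metric[OF bounded_borel_measurable[OF f], of 0] by auto
  have F0: "\<Lambda> (F i) = 0" for i
  proof -
    have fin: "finite (range (F i))" and meas: "F i -` {y} \<in> sets borel" for y
    proof -
      show "finite (range (F i))" using F(1)[of i] by (simp add: simple_function_def)
      show "F i -` {y} \<in> sets borel"
        using measurable_sets[OF borel_measurable_simple_function[OF F(1)[of i]], of "{y}"] by simp
    qed
    have "F i = (\<lambda>s. \<Sum>y\<in>range (F i). y * indicator (F i -` {y}) s)"
    proof
      fix s
      have "(\<Sum>y\<in>range (F i). y * indicator (F i -` {y}) s) = (\<Sum>y\<in>range (F i). if y = F i s then y else 0)"
        by (intro sum.cong) (auto simp: indicator_def)
      then show "F i s = (\<Sum>y\<in>range (F i). y * indicator (F i -` {y}) s)" using fin by simp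
    qed
    moreover have "\<Lambda> (\<lambda>s. \<Sum>y\<in>range (F i). y * indicator (F i -` {y}) s) = 0"
      using sigma_functional_sum[OF \<Lambda>, of "range (F i)" "\<lambda>y. indicator (F i -` {y})" "\<lambda>y. y"] meas
      by (simp add: bounded_borel_indicator ind)
    ultimately show ?thesis by simp
  qed
  have "(\<lambda>i. \<Lambda> (F i)) \<longlonglongrightarrow> \<Lambda> f"
    by (rule sigma_functionalD(3)[OF \<Lambda>, where K = "2 * K"])
       (use F K in \<open>auto intro: borel_measurable_simple_function order_trans[OF F(3)[simplified]]\<close>)
  then show ?thesis using F0 by (simp add: LIMSEQ_const_iff)
qed

corollary sigma_functional_eqI:
  assumes "sigma_functional \<Lambda>" "sigma_functional \<Lambda>'"
    and "\<And>n::int. \<Lambda> (\<lambda>s. cayley s powi n) = \<Lambda>' (\<lambda>s. cayley s powi n)"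
    and "bounded_borel f"
  shows "\<Lambda> f = \<Lambda>' f"
  using sigma_functional_eq_0[OF sigma_functional_diff[OF assms(1,2)] _ assms(4)] assms(3) by simp

section \<open>Scalar spectral measures of a unitary group\<close>

lemma has_bochner_integral_cis:
  fixes m :: int
  shows "has_bochner_integral lborel (\<lambda>\<theta>. indicator {0..2*pi} \<theta> *\<^sub>R cis (of_int m * \<theta>))
    (if m = 0 then of_real (2 * pi) else 0)"
proof (cases "m = 0")
  case True
  then show ?thesis
    using has_bochner_integral_FTC_Icc[of 0 "2*pi" "\<lambda>x. of_real x" "\<lambda>x. 1::complex"]
      bounded_linear.has_vector_derivative[OF bounded_linear_of_real has_vector_derivative_id]
    by auto
next
  case False
  let ?F = "\<lambda>\<theta>. cis (of_int m * \<theta>) / (\<i> * of_int m)"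
  have "((\<lambda>z. exp (\<i> * of_int m * z) / (\<i> * of_int m)) has_field_derivative exp (\<i> * of_int m * z)) (at z)" for z
    using False by (auto intro!: derivative_eq_intros)
  then have "(?F has_vector_derivative cis (of_int m * \<theta>)) (at \<theta> within {0..2*pi})" for \<theta>
    using has_vector_derivative_real_field[of "\<lambda>z. exp (\<i> * of_int m * z) / (\<i> * of_int m)"]
    by (simp add: cis_conv_exp mult.assoc)
  then have "has_bochner_integral lborel (\<lambda>\<theta>. indicator {0..2*pi} \<theta> *\<^sub>R cis (of_int m * \<theta>)) (?F (2*pi) - ?F 0)"
    by (intro has_bochner_integral_FTC_Icc) (auto intro!: continuous_intros)
  moreover have "cis (of_int m * (2 * pi)) = 1"
    using cis_multiple_2pi[of "of_int m"] by (simp add: mult_ac)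
  ultimately show ?thesis using False by simp
qed

text \<open>The number of pairs on the \<open>n\<close>-th off-diagonal of an \<open>N\<close> by
  \<open>N\<close> grid is the origin of the Fejer weight \<open>1 - n / N\<close>.\<close>

lemma sum_sum_delta_shift:
  fixes a :: complex
  assumes "n \<le> N"
  shows "(\<Sum>j<N. \<Sum>k<N. if j = k + n then a else 0) = of_nat (N - n) * a"
proof -
  have "(\<Sum>j<N. \<Sum>k<N. if j = k + n then a else 0) = (\<Sum>k<N. \<Sum>j<N. if j = k + n then a else 0)"
    by (rule sum.swap)
  also have "\<dots> = (\<Sum>k<N. if k + n < N then a else 0)"
    by (intro sum.cong) auto
  also have "\<dots> = (\<Sum>k | k < N \<and> k + n < N. a)"
    by (simp add: sum.If_cases Int_def lessThan_def)
  also have "{k. k < N \<and> k + n < N} = {..<N - n}" by auto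
  finally show ?thesis by simp
qed

text \<open>The integer powers of a unitary operator \<open>U\<close>. The last assumption is a
  convenient form of saying that \<open>1\<close> is not an eigenvalue of \<open>U\<close>; it keeps
  the measures on the circle away from the point that corresponds to infinity on the line.\<close>

locale unitary_group =
  fixes Up :: "int \<Rightarrow> 'a::chilbert_space \<Rightarrow> 'a"
  assumes Up_add: "Up n (x + y) = Up n x + Up n y"
    and Up_scaleC: "Up n (c *\<^sub>C x) = c *\<^sub>C Up n x"
    and Up_0: "Up 0 x = x"
    and Up_Up: "Up m (Up n x) = Up (m + n) x"
    and Up_adj: "cinner (Up n x) y = cinner x (Up (- n) y)"
    and dense: "closure (range (\<lambda>w. w - Up 1 w)) = UNIV"
begin

lemma Up_minus: "Up n (- x) = - Up n x"
  by (metis Up_scaleC minus_eq_scaleC)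

lemma Up_diff: "Up n (x - y) = Up n x - Up n y"
  using Up_add[of n x "- y"] by (simp add: Up_minus)

lemma cinner_Up_Up: "cinner (Up m x) (Up n y) = cinner (Up (m - n) x) y"
  using Up_adj[of "-n" "Up m x" y] by (simp add: Up_Up)

lemma norm_Up [simp]: "norm (Up n x) = norm x"
proof -
  have "cinner (Up n x) (Up n x) = cinner x x" by (simp add: cinner_Up_Up Up_0)
  then show ?thesis by (simp add: norm_eq_sqrt_cinner)
qed

text \<open>On one period this is the Fejer mean of the Fourier series with coefficients
  \<open>cinner (Up n x) x\<close>, written as a squared norm so that positivity is visible.\<close>

definition fejer_density :: "'a \<Rightarrow> nat \<Rightarrow> real \<Rightarrow> real" where
  "fejer_density x N \<theta> = indicator {0..2*pi} \<theta> *
     ((norm (\<Sum>k<N. cis (- (real k * \<theta>)) *\<^sub>C Up (int k) x))\<^sup>2 / (2 * pi * real N))"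

lemma fejer_density_nonneg: "fejer_density x N \<theta> \<ge> 0"
  by (simp add: fejer_density_def)

text \<open>Expanding the square gives a double sum of characters. Integrated against
  \<open>cis (real n * \<theta>)\<close>, only the pairs with \<open>j = k + n\<close> survive, and
  there are \<open>N - n\<close> of them.\<close>

lemma fejer_density_moment:
  assumes "n \<le> N" "N > 0"
  shows "has_bochner_integral lborel (\<lambda>\<theta>. fejer_density x N \<theta> *\<^sub>R cis (real n * \<theta>))
    (of_real (1 - real n / real N) * cinner (Up n x) x)"
proof -
  let ?a = "\<lambda>m. cinner (Up m x) x"
  let ?c = "complex_of_real (1 / (2 * pi * real N))"
  let ?S = "\<lambda>\<theta>. \<Sum>k<N. cis (- (real k * \<theta>)) *\<^sub>C Up (int k) x"
  have "complex_of_real ((norm (?S \<theta>))\<^sup>2)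
      = (\<Sum>j<N. \<Sum>k<N. cis (of_int (int k - int j) * \<theta>) * ?a (int j - int k))" for \<theta>
    by (simp add: cinner_self[symmetric] cinner_sum_left cinner_sum_right sum_distrib_left cinner_simps
        cinner_Up_Up cis_cnj cis_mult mult.assoc[symmetric] del: of_real_power)
       (simp add: algebra_simps, rule sum.swap)
  then have "fejer_density x N \<theta> *\<^sub>R cis (real n * \<theta>)
      = ?c * (\<Sum>j<N. \<Sum>k<N. of_real (indicator {0..2*pi} \<theta>) *
          (cis (real n * \<theta>) * cis (of_int (int k - int j) * \<theta>)) * ?a (int j - int k))" for \<theta>
    by (simp add: fejer_density_def scaleR_conv_of_real sum_distrib_left sum_distrib_right
        sum_divide_distrib mult_ac del: of_real_power)
  moreover have "cis (real n * \<theta>) * cis (of_int (int k - int j) * \<theta>) = cis (of_int (int n + int k - int j) * \<theta>)" for j k \<theta>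
    by (simp add: cis_mult algebra_simps)
  ultimately have eq: "fejer_density x N \<theta> *\<^sub>R cis (real n * \<theta>)
      = ?c * (\<Sum>j<N. \<Sum>k<N. (indicator {0..2*pi} \<theta> *\<^sub>R cis (of_int (int n + int k - int j) * \<theta>)) * ?a (int j - int k))" for \<theta>
    by (simp only: scaleR_conv_of_real)
  have "has_bochner_integral lborel (\<lambda>\<theta>. fejer_density x N \<theta> *\<^sub>R cis (real n * \<theta>))
    (?c * (\<Sum>j<N. \<Sum>k<N. (if int n + int k - int j = 0 then of_real (2 * pi) else 0) * ?a (int j - int k)))"
    unfolding eq
    by (intro has_bochner_integral_mult_right has_bochner_integral_sum has_bochner_integral_mult_left
        has_bochner_integral_cis)
  also have "(\<Sum>j<N. \<Sum>k<N. (if int n + int k - int j = 0 then of_real (2 * pi) else 0) * ?a (int j - int k))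
     = (\<Sum>j<N. \<Sum>k<N. if j = k + n then of_real (2 * pi) * ?a n else 0)"
    by (intro sum.cong) auto
  also have "\<dots> = of_nat (N - n) * (of_real (2 * pi) * ?a n)"
    using assms by (intro sum_sum_delta_shift)
  also have "?c * \<dots> = of_real (1 - real n / real N) * ?a n"
    using assms by (simp add: field_simps of_nat_diff)
  finally show ?thesis .
qed

text \<open>Herglotz: the moments of the Fejer densities converge to those of a weak limit,
  which exists by Helly's selection theorem.\<close>
lemma herglotz:
  assumes x: "norm x = 1"
  obtains M where "real_distribution M"
    "\<And>n::nat. (\<integral>\<theta>. cis (real n * \<theta>) \<partial>M) = cinner (Up n x) x"
proof -
  \<comment> \<open>\<open>Suc N\<close> avoids division by 0 at the first index. The total mass is
    the zeroth moment, which is 1 for a unit vector.\<close>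
  define M where "M N = density lborel (\<lambda>\<theta>. ennreal (fejer_density x (Suc N) \<theta>))" for N
  have int1: "has_bochner_integral lborel (fejer_density x (Suc N)) 1" for N
  proof -
    have "has_bochner_integral lborel (\<lambda>\<theta>. Re (fejer_density x (Suc N) \<theta> *\<^sub>R cis (real 0 * \<theta>)))
      (Re (of_real (1 - real 0 / real (Suc N)) * cinner (Up (int 0) x) x))"
      by (intro has_bochner_integral_bounded_linear[OF bounded_linear_Re] fejer_density_moment) auto
    then show ?thesis using x by (simp add: Up_0 cinner_self)
  qed
  have [measurable]: "fejer_density x (Suc N) \<in> borel_measurable borel" for N
    using borel_measurable_has_bochner_integral[OF int1] by simp
  have nn1: "(\<integral>\<^sup>+\<theta>. ennreal (fejer_density x (Suc N) \<theta>) \<partial>lborel) = 1" for N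
    using nn_integral_eq_integral[of lborel "fejer_density x (Suc N)"] int1[of N]
    by (simp add: has_bochner_integral_iff fejer_density_nonneg)
  have dist: "real_distribution (M N)" for N
    unfolding real_distribution_def real_distribution_axioms_def M_def
    by (auto intro!: prob_spaceI simp: emeasure_density nn1)
  \<comment> \<open>One bounded interval containing \<open>{0..2*pi}\<close> serves all
    \<open>N\<close> and gives tightness; 8 is large enough because \<open>pi < 4\<close>.\<close>
  have supp: "measure (M N) {-1<..8} = 1" for N
  proof -
    have "fejer_density x (Suc N) \<theta> = 0" if "\<theta> \<notin> {-1<..8}" for \<theta>
      using that pi_less_4 by (auto simp: fejer_density_def indicator_def)
    then have "ennreal (fejer_density x (Suc N) \<theta>) * indicator {-1<..8} \<theta> = ennreal (fejer_density x (Suc N) \<theta>)" for \<theta>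
      by (cases "\<theta> \<in> {-1<..8}") auto
    then have "emeasure (M N) {-1<..8} = 1"
      unfolding M_def by (subst emeasure_density) (auto simp: nn1)
    then show ?thesis by (simp add: measure_def)
  qed
  have "tight M"
    unfolding tight_def
  proof (intro conjI allI impI dist)
    fix e :: real assume "e > 0"
    then show "\<exists>a b. a < b \<and> (\<forall>n. 1 - e < measure (M n) {a<..b})"
      using supp by (intro exI[of _ "-1"] exI[of _ 8]) auto
  qed
  then obtain r L where rL: "strict_mono (r :: nat \<Rightarrow> nat)" "real_distribution L" "weak_conv_m (M \<circ> id \<circ> r) L"
    using tight_imp_convergent_subsubsequence[of M id] by (auto simp: strict_mono_def)
  have "(\<integral>\<theta>. cis (real n * \<theta>) \<partial>L) = cinner (Up n x) x" for n :: nat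
  proof -
    have "(\<lambda>k. \<integral>\<theta>. cis (real n * \<theta>) \<partial>((M \<circ> id \<circ> r) k)) \<longlonglongrightarrow> (\<integral>\<theta>. cis (real n * \<theta>) \<partial>L)"
    proof (rule weak_conv_imp_integral_bdd_continuous_conv[OF _ rL(2,3), where B = 1])
      have "continuous_on UNIV (\<lambda>\<theta>. cis (real n * \<theta>))" by (intro continuous_intros)
      then show "isCont (\<lambda>\<theta>. cis (real n * \<theta>)) \<theta>" for \<theta>
        by (simp add: continuous_on_eq_continuous_at)
    qed (auto simp: dist)
    moreover have "(\<lambda>k. \<integral>\<theta>. cis (real n * \<theta>) \<partial>((M \<circ> id \<circ> r) k)) \<longlonglongrightarrow> cinner (Up n x) x"
    proof -
      have "(\<integral>\<theta>. cis (real n * \<theta>) \<partial>(M N)) = of_real (1 - real n / real (Suc N)) * cinner (Up n x) x" if "N \<ge> n" for N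
      proof -
        have "(\<integral>\<theta>. cis (real n * \<theta>) \<partial>(M N)) = (\<integral>\<theta>. fejer_density x (Suc N) \<theta> *\<^sub>R cis (real n * \<theta>) \<partial>lborel)"
          unfolding M_def
          by (rule integral_density)
             (auto simp: fejer_density_nonneg intro!: borel_measurable_continuous_onI continuous_intros)
        then show ?thesis
          using fejer_density_moment[of n "Suc N" x] that by (simp add: has_bochner_integral_iff)
      qed
      moreover have "(\<lambda>N. of_real (1 - real n / real (Suc N)) * cinner (Up n x) x) \<longlonglongrightarrow> of_real (1 - 0) * cinner (Up n x) x"
        by (intro tendsto_intros LIMSEQ_Suc lim_const_over_n)
      ultimately have "(\<lambda>N. \<integral>\<theta>. cis (real n * \<theta>) \<partial>(M N)) \<longlonglongrightarrow> cinner (Up n x) x"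
        by (subst tendsto_cong[where g = "\<lambda>N. of_real (1 - real n / real (Suc N)) * cinner (Up n x) x"])
           (auto simp: eventually_sequentially)
      from LIMSEQ_subseq_LIMSEQ[OF this rL(1)] show ?thesis by (simp add: o_def)
    qed
    ultimately show ?thesis by (rule LIMSEQ_unique)
  qed
  then show ?thesis using that rL(2) by blast
qed

text \<open>Von Neumann's argument: on vectors \<open>w - Up 1 w\<close> the sums telescope to
  \<open>w - Up (int N) w\<close>, which stays bounded. Such vectors are dense, and the averages do
  not increase norms.\<close>

lemma mean_ergodic:
  "(\<lambda>N. cinner (\<Sum>n<N. Up (int n) x) y / of_nat N) \<longlonglongrightarrow> 0"
proof (rule LIMSEQ_I)
  fix e :: real assume e: "e > 0"
  \<comment> \<open>Half of \<open>e\<close> pays for the telescoped term, which is below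
    \<open>real N * d\<close> from \<open>N0\<close> on, and half for the distance from
    \<open>x\<close> to \<open>w - Up 1 w\<close>. Adding 1 to \<open>norm y\<close> keeps the
    denominator positive.\<close>
  define d where "d = e / (2 * (norm y + 1))"
  have y1: "norm y + 1 > 0" by (simp add: add_nonneg_pos)
  have d: "d > 0" using e y1 by (simp add: d_def)
  have "x \<in> closure (range (\<lambda>w. w - Up 1 w))" using dense by simp
  then obtain w where w: "dist (w - Up 1 w) x < d" using d by (auto simp: closure_approachable)
  obtain N0 where N0: "N0 > 0" "real N0 * d > 2 * norm w"
  proof -
    obtain N1 :: nat where "2 * norm w < real N1 * d" using ex_less_of_nat_mult[OF d] by blast
    moreover have "N1 > 0" using calculation by (cases N1) (auto simp: not_less)
    ultimately show ?thesis using that by blast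
  qed
  have bound: "norm (\<Sum>n<N. Up (int n) x) \<le> 2 * norm w + real N * d" for N :: nat
  proof -
    have tel: "(\<Sum>n<N. Up (int n) (w - Up 1 w)) = w - Up (int N) w"
      by (induction N) (auto simp: Up_0 Up_diff Up_Up add.commute)
    have "(\<Sum>n<N. Up (int n) x) = (w - Up (int N) w) + (\<Sum>n<N. Up (int n) (x - (w - Up 1 w)))"
      unfolding tel[symmetric] sum.distrib[symmetric] Up_add[symmetric] by simp
    also have "norm \<dots> \<le> (norm w + norm (Up (int N) w)) + (\<Sum>n<N. norm (Up (int n) (x - (w - Up 1 w))))"
      by (intro norm_triangle_mono norm_triangle_ineq4 norm_sum)
    also have "\<dots> \<le> (norm w + norm w) + (\<Sum>n<N. d)"
      using w by (intro add_mono sum_mono) (auto simp: dist_norm norm_minus_commute)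
    finally show ?thesis by simp
  qed
  show "\<exists>N0. \<forall>N\<ge>N0. norm (cinner (\<Sum>n<N. Up (int n) x) y / of_nat N - 0) < e"
  proof (intro exI allI impI)
    fix N assume N: "N \<ge> N0"
    have Np: "real N > 0" using N N0 by simp
    have "real N * d \<ge> real N0 * d" using N d by (intro mult_right_mono) auto
    then have "2 * norm w < real N * d" using N0 by linarith
    then have "norm (\<Sum>n<N. Up (int n) x) < real N * (2 * d)" using bound[of N] by simp
    then have "norm (\<Sum>n<N. Up (int n) x) * (norm y + 1) < real N * (2 * d) * (norm y + 1)"
      using y1 by (intro mult_strict_right_mono)
    also have "\<dots> = real N * (d * (2 * (norm y + 1)))" by (simp add: algebra_simps)
    also have "\<dots> = real N * e" unfolding d_def using y1 by simp
    finally have "norm (\<Sum>n<N. Up (int n) x) * (norm y + 1) < real N * e" .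
    moreover have "cmod (cinner (\<Sum>n<N. Up (int n) x) y) \<le> norm (\<Sum>n<N. Up (int n) x) * (norm y + 1)"
      by (rule order_trans[OF norm_cinner_le]) (simp add: mult_left_mono)
    ultimately show "norm (cinner (\<Sum>n<N. Up (int n) x) y / of_nat N - 0) < e"
      using Np by (simp add: norm_divide field_simps)
  qed
qed

end

text \<open>Integrated against a measure on the circle, these means compute the mass at the point
  \<open>1\<close>; the integrals themselves are ergodic averages.\<close>

lemma cesaro_cis_tendsto_indicator:
  "(\<lambda>N. (\<Sum>n<N. cis (real n * \<theta>)) / of_nat N) \<longlonglongrightarrow> indicator {\<theta>. cis \<theta> = 1} \<theta>"
proof -
  have pow: "cis (real n * \<theta>) = cis \<theta> ^ n" for n by (simp add: Complex.DeMoivre)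
  show ?thesis
  proof (cases "cis \<theta> = 1")
    case True
    \<comment> \<open>At \<open>N = 0\<close> the quotient is \<open>0 / 0 = 0\<close>, so the
      constant value 1 appears only after the shift to \<open>Suc N\<close>.\<close>
    have "(\<lambda>N. of_nat (Suc N) / of_nat (Suc N) :: complex) \<longlonglongrightarrow> 1"
      by (simp del: of_nat_Suc)
    then show ?thesis using True unfolding pow
      by (subst filterlim_sequentially_Suc[symmetric]) (simp add: indicator_def del: of_nat_Suc sum.lessThan_Suc)
  next
    case False
    have "cmod ((\<Sum>n<N. cis \<theta> ^ n) / of_nat N) \<le> (2 / cmod (cis \<theta> - 1)) / real N" for N
    proof -
      have "cmod (\<Sum>n<N. cis \<theta> ^ n) = cmod (cis \<theta> ^ N - 1) / cmod (cis \<theta> - 1)"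
        using geometric_sum[OF False, of N] by (simp add: norm_divide)
      also have "\<dots> \<le> (cmod (cis \<theta> ^ N) + cmod 1) / cmod (cis \<theta> - 1)"
        by (intro divide_right_mono norm_triangle_ineq4) auto
      finally have "cmod (\<Sum>n<N. cis \<theta> ^ n) \<le> 2 / cmod (cis \<theta> - 1)" by (simp add: norm_power)
      from divide_right_mono[OF this, of "real N"] show ?thesis by (simp add: norm_divide)
    qed
    then have "(\<lambda>N. (\<Sum>n<N. cis \<theta> ^ n) / of_nat N) \<longlonglongrightarrow> 0"
      by (intro Lim_null_comparison[OF _ lim_const_over_n[of "2 / cmod (cis \<theta> - 1)"]]) auto
    then show ?thesis using False by (simp add: pow)
  qed
qed

text \<open>The inverse of \<open>cayley\<close> in the angle variable, that is
  \<open>- cot (\<theta> / 2)\<close>. The quotient is already real; \<open>Re\<close> only adjusts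
  the type. Where \<open>cis \<theta> = 1\<close>, division by 0 makes the value 0, and the
  inversion fails.\<close>

definition circle_to_line :: "real \<Rightarrow> real" where
  "circle_to_line \<theta> = Re (\<i> * (1 + cis \<theta>) / (1 - cis \<theta>))"

lemma cayley_circle_to_line:
  assumes "cis \<theta> \<noteq> 1"
  shows "cayley (circle_to_line \<theta>) = cis \<theta>"
proof -
  let ?w = "\<i> * (1 + cis \<theta>) / (1 - cis \<theta>)"
  have zz: "cis \<theta> * cis (- \<theta>) = 1" by (simp add: cis_mult)
  have n1: "1 - cis \<theta> \<noteq> 0" using assms by simp
  have n2: "1 - cis (- \<theta>) \<noteq> 0" using assms zz by auto
  have "cnj ?w = - \<i> * (1 + cis (- \<theta>)) / (1 - cis (- \<theta>))" by (simp add: cis_cnj)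
  also have "\<dots> = ?w"
    using n1 n2 zz by (simp add: field_simps)
  finally have "?w \<in> \<real>" by (simp only: Reals_cnj_iff)
  then have w: "of_real (circle_to_line \<theta>) = ?w" by (simp only: circle_to_line_def of_real_Re)
  have "?w - \<i> = \<i> * 2 * cis \<theta> / (1 - cis \<theta>)" "?w + \<i> = \<i> * 2 / (1 - cis \<theta>)"
    using n1 by (simp_all add: field_simps)
  then show ?thesis unfolding cayley_def w using n1 by simp
qed

context unitary_group
begin

text \<open>The Herglotz measure is pushed from the circle to the line. Since
  \<open>circle_to_line\<close> inverts \<open>cayley\<close> only off the point \<open>1\<close>,
  that point has to be shown to carry no mass.\<close>

lemma scalar_measure_unit:
  assumes x: "norm x = 1"
  obtains M where "prob_space M" "sets M = sets borel"
    "\<And>n::int. (\<integral>s. cayley s powi n \<partial>M) = cinner (Up n x) x"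
proof -
  obtain L where L: "real_distribution L" "\<And>n::nat. (\<integral>\<theta>. cis (real n * \<theta>) \<partial>L) = cinner (Up n x) x"
    using herglotz[OF x] by blast
  interpret real_distribution L by fact
  have cis_meas [measurable]: "(\<lambda>\<theta>. cis (r * \<theta>)) \<in> borel_measurable borel" for r
    by (intro borel_measurable_continuous_onI continuous_intros)
  have cis_meas1 [measurable]: "cis \<in> borel_measurable borel" using cis_meas[of 1] by simp
  have int: "integrable L (\<lambda>\<theta>. cis (r * \<theta>))" for r
    by (intro integrable_const_bound[where B = 1]) auto
  have Z [measurable]: "{\<theta>. cis \<theta> = 1} \<in> sets borel" by measurable
  \<comment> \<open>The mass is the limit of the integrals of the Cesaro means. By the moment
    formula these are \<open>cinner (\<Sum>n<N. Up (int n) x) x / of_nat N\<close>, which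
    \<open>mean_ergodic\<close> sends to 0.\<close>
  have null: "measure L {\<theta>. cis \<theta> = 1} = 0"
  proof -
    have "(\<lambda>N. \<integral>\<theta>. (\<Sum>n<N. cis (real n * \<theta>)) / of_nat N \<partial>L) \<longlonglongrightarrow> (\<integral>\<theta>. indicator {\<theta>. cis \<theta> = 1} \<theta> \<partial>L)"
    proof (rule integral_dominated_convergence[where w = "\<lambda>_. 1"])
      have "cmod (\<Sum>n<N. cis (real n * \<theta>)) \<le> (\<Sum>n<N. 1)" for N \<theta>
        by (rule order_trans[OF norm_sum]) simp
      then show "AE \<theta> in L. cmod ((\<Sum>n<N. cis (real n * \<theta>)) / of_nat N) \<le> 1" for N
        by (auto simp: norm_divide divide_le_eq_1)
    qed (use cesaro_cis_tendsto_indicator in auto)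
    moreover have "(\<integral>\<theta>. (\<Sum>n<N. cis (real n * \<theta>)) / of_nat N \<partial>L) = cinner (\<Sum>n<N. Up (int n) x) x / of_nat N" for N
      by (simp add: int L cinner_sum_left)
    ultimately have "(\<integral>\<theta>. indicator {\<theta>. cis \<theta> = 1} \<theta> \<partial>L) = (0::complex)"
      using LIMSEQ_unique[OF _ mean_ergodic[of x x]] by (simp only:)
    moreover have "(\<integral>\<theta>. (indicator {\<theta>. cis \<theta> = 1} \<theta> :: complex) \<partial>L) = of_real (measure L {\<theta>. cis \<theta> = 1})"
      using integral_complex_of_real[of L "indicator {\<theta>. cis \<theta> = 1}"]
      by (simp add: of_real_indicator)
    ultimately show ?thesis by simp
  qed
  have ae: "AE \<theta> in L. cis \<theta> \<noteq> 1"
    by (rule AE_I[where N = "{\<theta>. cis \<theta> = 1}"]) (auto simp: emeasure_eq_measure null)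
  have [measurable]: "circle_to_line \<in> borel_measurable borel"
    unfolding circle_to_line_def by measurable
  define M where "M = distr L borel circle_to_line"
  have "(\<integral>s. cayley s powi n \<partial>M) = cinner (Up n x) x" for n :: int
  proof -
    have "(\<integral>s. cayley s powi n \<partial>M) = (\<integral>\<theta>. cayley (circle_to_line \<theta>) powi n \<partial>L)"
      unfolding M_def using bounded_borel_measurable[OF bounded_borel_cayley]
      by (intro integral_distr) auto
    also have "\<dots> = (\<integral>\<theta>. cis (of_int n * \<theta>) \<partial>L)"
    proof (rule integral_cong_AE)
      show "AE \<theta> in L. cayley (circle_to_line \<theta>) powi n = cis (of_int n * \<theta>)"
        using ae by eventually_elim (simp add: cayley_circle_to_line cis_power_int)
      show "(\<lambda>\<theta>. cayley (circle_to_line \<theta>) powi n) \<in> borel_measurable L"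
        using measurable_compose[OF _ bounded_borel_measurable[OF bounded_borel_cayley[of n]], of circle_to_line L]
        by simp
    qed simp
    also have "\<dots> = cinner (Up n x) x"
    proof (cases n rule: int_cases2)
      case (nonneg m)
      then show ?thesis using L(2)[of m] by simp
    next
      case (nonpos m)
      \<comment> \<open>Herglotz supplies the moments with nonnegative index; the others are their
        conjugates.\<close>
      have "(\<integral>\<theta>. cis (of_int n * \<theta>) \<partial>L) = (\<integral>\<theta>. cnj (cis (real m * \<theta>)) \<partial>L)"
        using nonpos by (simp add: cis_cnj)
      also have "\<dots> = cnj (cinner (Up (int m) x) x)" by (simp add: L)
      also have "\<dots> = cinner x (Up (int m) x)" by (metis cinner_conj_commute)
      finally show ?thesis using Up_adj[of n x x] nonpos by simp
    qed
    finally show ?thesis .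
  qed
  moreover have "prob_space M" unfolding M_def by (rule prob_space_distr) simp
  moreover have "sets M = sets borel" by (simp add: M_def)
  ultimately show ?thesis using that by blast
qed

lemma scalar_measure_exists:
  "\<exists>M. finite_measure M \<and> sets M = sets borel \<and>
     (\<forall>n::int. (\<integral>s. cayley s powi n \<partial>M) = cinner (Up n x) x)"
proof (cases "x = 0")
  case True
  have "Up n 0 = 0" for n using Up_add[of n 0 0] by simp
  then show ?thesis using True
    by (intro exI[of _ "null_measure borel"]) (auto intro!: finite_measureI simp: integral_null_measure)
next
  case False
  define u where "u = complex_of_real (1 / norm x) *\<^sub>C x"
  have xu: "x = complex_of_real (norm x) *\<^sub>C u"
    using False by (simp add: u_def scaleC_scaleC scaleC_one flip: of_real_mult)
  have "norm u = 1" using False by (simp add: u_def norm_scaleC norm_divide)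
  then obtain M where M: "prob_space M" "sets M = sets borel"
    "\<And>n::int. (\<integral>s. cayley s powi n \<partial>M) = cinner (Up n u) u"
    using scalar_measure_unit by metis
  interpret prob_space M by fact
  note [measurable_cong] = M(2)
  define N where "N = density M (\<lambda>_. ennreal ((norm x)\<^sup>2))"
  have "emeasure N (space N) = ennreal ((norm x)\<^sup>2)"
    unfolding N_def by (simp add: emeasure_density emeasure_space_1)
  then have "finite_measure N" by (intro finite_measureI) simp
  moreover have "sets N = sets borel" by (simp add: N_def M)
  moreover have "(\<integral>s. cayley s powi n \<partial>N) = cinner (Up n x) x" for n
  proof -
    have [measurable]: "(\<lambda>s. cayley s powi n) \<in> borel_measurable borel"
      by (rule bounded_borel_measurable[OF bounded_borel_cayley])
    have "(\<integral>s. cayley s powi n \<partial>N) = (\<integral>s. (norm x)\<^sup>2 *\<^sub>R (cayley s powi n) \<partial>M)"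
      unfolding N_def by (intro integral_density) auto
    also have "\<dots> = of_real ((norm x)\<^sup>2) * cinner (Up n u) u"
      by (simp add: M scaleR_conv_of_real)
    also have "\<dots> = cinner (Up n x) x"
      using arg_cong[OF xu, of "\<lambda>v. cinner (Up n v) v"] by (simp add: Up_scaleC cinner_simps power2_eq_square)
    finally show ?thesis .
  qed
  ultimately show ?thesis by blast
qed

end

section \<open>Functional calculus\<close>

context unitary_group
begin

text \<open>By \<open>sigma_functional_eqI\<close> the moments leave no freedom in this choice,
  which is what makes measures of different vectors comparable.\<close>

definition scalar_measure :: "'a \<Rightarrow> real measure" where
  "scalar_measure x = (SOME M. finite_measure M \<and> sets M = sets borel \<and>
     (\<forall>n::int. (\<integral>s. cayley s powi n \<partial>M) = cinner (Up n x) x))"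

lemma scalar_measure:
  shows finite_scalar_measure: "finite_measure (scalar_measure x)"
    and sets_scalar_measure [measurable_cong, simp]: "sets (scalar_measure x) = sets borel"
    and moment_scalar_measure: "(\<integral>s. cayley s powi n \<partial>scalar_measure x) = cinner (Up n x) x"
  using someI_ex[OF scalar_measure_exists[of x]] unfolding scalar_measure_def by blast+

lemma space_scalar_measure [simp]: "space (scalar_measure x) = UNIV"
  using sets_eq_imp_space_eq[OF sets_scalar_measure[of x]] by simp

lemma integrable_scalar_measure: "bounded_borel f \<Longrightarrow> integrable (scalar_measure x) f"
proof -
  interpret finite_measure "scalar_measure x" by (rule finite_scalar_measure)
  assume f: "bounded_borel f"
  obtain K where "\<And>s. cmod (f s) \<le> K" using f by (auto simp: bounded_borel_def)
  moreover have "f \<in> borel_measurable (scalar_measure x)"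
    using bounded_borel_measurable[OF f] by measurable
  ultimately show ?thesis by (intro integrable_const_bound[where B = K]) auto
qed

lemma measure_scalar_measure_UNIV: "measure (scalar_measure x) UNIV = (norm x)\<^sup>2"
proof -
  interpret finite_measure "scalar_measure x" by (rule finite_scalar_measure)
  have "complex_of_real (measure (scalar_measure x) UNIV) = of_real ((norm x)\<^sup>2)"
    using moment_scalar_measure[where n = 0, of x]
    by (simp add: Up_0 cinner_self scaleR_conv_of_real)
  then show ?thesis by (simp only: of_real_eq_iff)
qed

lemmas sigma_functional_scalar =
  sigma_functional_integral[OF finite_scalar_measure sets_scalar_measure]

lemma norm_integral_scalar_measure_le:
  assumes f: "bounded_borel f" and K: "\<And>s. cmod (f s) \<le> K"
  shows "cmod (\<integral>s. f s \<partial>scalar_measure x) \<le> K * (norm x)\<^sup>2"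
proof -
  interpret finite_measure "scalar_measure x" by (rule finite_scalar_measure)
  have "cmod (\<integral>s. f s \<partial>scalar_measure x) \<le> (\<integral>s. cmod (f s) \<partial>scalar_measure x)" by simp
  also have "\<dots> \<le> (\<integral>s. K \<partial>scalar_measure x)"
    using integrable_scalar_measure[OF f] K by (intro integral_mono) auto
  finally show ?thesis by (simp add: measure_scalar_measure_UNIV mult.commute)
qed

text \<open>Polarization of \<open>x \<mapsto> \<integral>s. f s \<partial>scalar_measure x\<close>.
  As the measures are chosen vector by vector, sesquilinearity is not built in; it is transferred
  from \<open>cinner (Up n x) y\<close>, the value at the powers of \<open>cayley\<close>, by
  uniqueness.\<close>

definition spectral_form :: "(real \<Rightarrow> complex) \<Rightarrow> 'a \<Rightarrow> 'a \<Rightarrow> complex" where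
  "spectral_form f x y =
     (1/4) * (\<integral>s. f s \<partial>scalar_measure (x + y)) + (-1/4) * (\<integral>s. f s \<partial>scalar_measure (x - y))
     + (\<i>/4) * (\<integral>s. f s \<partial>scalar_measure (x + \<i> *\<^sub>C y))
     + (-\<i>/4) * (\<integral>s. f s \<partial>scalar_measure (x - \<i> *\<^sub>C y))"

lemma sigma_functional_spectral_form: "sigma_functional (\<lambda>f. spectral_form f x y)"
  unfolding spectral_form_def
  by (intro sigma_functional_add sigma_functional_cmult sigma_functional_scalar)

lemma spectral_form_cayley: "spectral_form (\<lambda>s. cayley s powi n) x y = cinner (Up n x) y"
  unfolding spectral_form_def
  by (simp add: moment_scalar_measure Up_add Up_diff Up_scaleC cinner_simps field_simps)

lemma spectral_form_add_left:
  "bounded_borel f \<Longrightarrow> spectral_form f (x + x') y = spectral_form f x y + spectral_form f x' y"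
  by (rule sigma_functional_eqI[of "\<lambda>f. spectral_form f (x + x') y"
        "\<lambda>f. spectral_form f x y + spectral_form f x' y"])
     (auto intro: sigma_functional_spectral_form sigma_functional_add simp: spectral_form_cayley Up_add cinner_simps)

lemma spectral_form_scale_left:
  "bounded_borel f \<Longrightarrow> spectral_form f (c *\<^sub>C x) y = c * spectral_form f x y"
  by (rule sigma_functional_eqI[of "\<lambda>f. spectral_form f (c *\<^sub>C x) y" "\<lambda>f. c * spectral_form f x y"])
     (auto intro: sigma_functional_spectral_form sigma_functional_cmult simp: spectral_form_cayley Up_scaleC cinner_simps)

text \<open>Hermitian symmetry; it carries linearity in the left argument over to conjugate
  linearity in the right one.\<close>

lemma cnj_spectral_form:
  "bounded_borel f \<Longrightarrow> cnj (spectral_form (\<lambda>s. cnj (f s)) x y) = spectral_form f y x"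
proof (rule sigma_functional_eqI[of "\<lambda>f. cnj (spectral_form (\<lambda>s. cnj (f s)) x y)"])
  show "cnj (spectral_form (\<lambda>s. cnj (cayley s powi n)) x y) = spectral_form (\<lambda>s. cayley s powi n) y x" for n
    unfolding cnj_cayley_powi spectral_form_cayley Up_adj[of n y x]
    by (rule cinner_conj_commute[symmetric])
qed (auto intro: sigma_functional_spectral_form sigma_functional_cnj)

lemma spectral_form_add_right:
  assumes f: "bounded_borel f"
  shows "spectral_form f x (y + y') = spectral_form f x y + spectral_form f x y'"
  using cnj_spectral_form[OF f] spectral_form_add_left[OF bounded_borel_cnj[OF f]]
  by (metis complex_cnj_add)

lemma spectral_form_scale_right:
  assumes f: "bounded_borel f"
  shows "spectral_form f x (c *\<^sub>C y) = cnj c * spectral_form f x y"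
  using cnj_spectral_form[OF f] spectral_form_scale_left[OF bounded_borel_cnj[OF f]]
  by (metis complex_cnj_mult)

lemma spectral_form_self:
  "bounded_borel f \<Longrightarrow> spectral_form f x x = (\<integral>s. f s \<partial>scalar_measure x)"
  by (rule sigma_functional_eqI[of "\<lambda>f. spectral_form f x x" "\<lambda>f. \<integral>s. f s \<partial>scalar_measure x"])
     (auto intro: sigma_functional_spectral_form sigma_functional_scalar
       simp: spectral_form_cayley moment_scalar_measure)

text \<open>For a unit vector in the left slot, two parallelogram laws add up the four polarization
  terms. Scaling is done in the left argument only, which explains the factor
  \<open>1 + (norm y)\<^sup>2\<close>; for fixed \<open>y\<close> this is the bound that Riesz
  representation asks for.\<close>

lemma norm_spectral_form_le:
  assumes f: "bounded_borel f" and K: "\<And>s. cmod (f s) \<le> K"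
  shows "cmod (spectral_form f x y) \<le> K * (1 + (norm y)\<^sup>2) * norm x"
proof (cases "x = 0")
  case True
  then show ?thesis using spectral_form_scale_left[OF f, of 0 x y] by simp
next
  case False
  have unit: "cmod (spectral_form f u y) \<le> K * (1 + (norm y)\<^sup>2)" if u: "norm u = 1" for u
  proof -
    let ?n = "\<lambda>z. (norm z)\<^sup>2"
    have "cmod (spectral_form f u y) \<le> (1/4) * (K * ?n (u + y)) + (1/4) * (K * ?n (u - y))
        + (1/4) * (K * ?n (u + \<i> *\<^sub>C y)) + (1/4) * (K * ?n (u - \<i> *\<^sub>C y))"
      unfolding spectral_form_def
      by (intro norm_triangle_mono; simp add: norm_mult norm_integral_scalar_measure_le[OF f K])
    also have "\<dots> = K / 4 * ((?n (u + y) + ?n (u - y)) + (?n (u + \<i> *\<^sub>C y) + ?n (u - \<i> *\<^sub>C y)))"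
      by (simp add: algebra_simps)
    also have "\<dots> = K * (1 + ?n y)"
      unfolding parallelogram_law using u by (simp add: norm_scaleC algebra_simps)
    finally show ?thesis .
  qed
  define u where "u = complex_of_real (1 / norm x) *\<^sub>C x"
  have xu: "x = complex_of_real (norm x) *\<^sub>C u"
    using False by (simp add: u_def scaleC_scaleC scaleC_one flip: of_real_mult)
  have "norm u = 1" using False by (simp add: u_def norm_scaleC norm_divide)
  moreover have "spectral_form f x y = of_real (norm x) * spectral_form f u y"
    using spectral_form_scale_left[OF f, of "of_real (norm x)" u y] xu by simp
  ultimately show ?thesis
    using mult_left_mono[OF unit[of u], of "norm x"] by (simp add: norm_mult mult_ac)
qed

text \<open>The first argument of the inner product is the linear one, so the operator representing
  \<open>spectral_form f\<close> in its second argument is \<open>f(A)\<^sup>*\<close>.\<close>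
definition adj_calc :: "(real \<Rightarrow> complex) \<Rightarrow> 'a \<Rightarrow> 'a" where
  "adj_calc f y = (SOME w. \<forall>x. spectral_form f x y = cinner x w)"

lemma cinner_adj_calc:
  assumes f: "bounded_borel f"
  shows "cinner x (adj_calc f y) = spectral_form f x y"
proof -
  obtain K where K: "\<And>s. cmod (f s) \<le> K" using f by (auto simp: bounded_borel_def)
  have "\<exists>w. \<forall>x\<in>UNIV. spectral_form f x y = cinner (id x) w"
    by (rule riesz_representation[where C = "K * (1 + (norm y)\<^sup>2)"])
       (auto simp: csubspace_def spectral_form_add_left[OF f] spectral_form_scale_left[OF f]
          norm_spectral_form_le[OF f K])
  then have "\<exists>w. \<forall>x. spectral_form f x y = cinner x w" by simp
  from someI_ex[OF this, folded adj_calc_def] show ?thesis by simp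
qed

lemma spectral_form_mult_cayley:
  "bounded_borel f \<Longrightarrow> spectral_form (\<lambda>s. f s * cayley s powi n) x y = spectral_form f (Up n x) y"
proof (rule sigma_functional_eqI[of "\<lambda>f. spectral_form (\<lambda>s. f s * cayley s powi n) x y" "\<lambda>f. spectral_form f (Up n x) y"])
  show "spectral_form (\<lambda>s. cayley s powi m * cayley s powi n) x y = spectral_form (\<lambda>s. cayley s powi m) (Up n x) y" for m
    by (simp add: spectral_form_cayley Up_Up flip: power_int_add)
qed (auto intro!: sigma_functional_spectral_form sigma_functional_mult)

text \<open>Multiplicativity takes uniqueness twice: \<open>spectral_form_mult_cayley\<close> varies
  \<open>f\<close> against a fixed power of \<open>cayley\<close>, and here \<open>g\<close> varies
  against a fixed \<open>f\<close>, with that lemma as the case of powers.\<close>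

lemma spectral_form_mult:
  assumes f: "bounded_borel f" and g: "bounded_borel g"
  shows "spectral_form (\<lambda>s. g s * f s) x y = spectral_form g x (adj_calc f y)"
proof (rule sigma_functional_eqI[of "\<lambda>g. spectral_form (\<lambda>s. g s * f s) x y" "\<lambda>g. spectral_form g x (adj_calc f y)"])
  fix n :: int
  have "(\<lambda>s. cayley s powi n * f s) = (\<lambda>s. f s * cayley s powi n)" by (simp add: mult.commute)
  then show "spectral_form (\<lambda>s. cayley s powi n * f s) x y = spectral_form (\<lambda>s. cayley s powi n) x (adj_calc f y)"
    by (simp add: spectral_form_mult_cayley[OF f] spectral_form_cayley cinner_adj_calc[OF f])
qed (auto intro!: sigma_functional_spectral_form sigma_functional_mult f g)

lemma adj_calc_adj_calc:
  assumes "bounded_borel f" "bounded_borel g"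
  shows "adj_calc g (adj_calc f y) = adj_calc (\<lambda>s. g s * f s) y"
  by (rule cinner_ext_right)
     (simp add: cinner_adj_calc assms bounded_borel_mult spectral_form_mult)

lemma adj_calc_add_right:
  assumes "bounded_borel f" shows "adj_calc f (x + y) = adj_calc f x + adj_calc f y"
  by (rule cinner_ext_right) (simp add: cinner_adj_calc assms spectral_form_add_right cinner_simps)

lemma adj_calc_scale_right:
  assumes "bounded_borel f" shows "adj_calc f (c *\<^sub>C x) = c *\<^sub>C adj_calc f x"
  by (rule cinner_ext_right) (simp add: cinner_adj_calc assms spectral_form_scale_right cinner_simps)

lemma adj_calc_add:
  assumes "bounded_borel f" "bounded_borel g"
  shows "adj_calc (\<lambda>s. f s + g s) x = adj_calc f x + adj_calc g x"
  by (rule cinner_ext_right)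
     (simp add: cinner_adj_calc assms bounded_borel_add cinner_simps
        sigma_functionalD(1)[OF sigma_functional_spectral_form])

lemma adj_calc_diff:
  assumes "bounded_borel f" "bounded_borel g"
  shows "adj_calc (\<lambda>s. f s - g s) x = adj_calc f x - adj_calc g x"
  using adj_calc_add[OF bounded_borel_diff[OF assms] assms(2), of x] by simp

text \<open>The sign of the exponent reflects that \<open>adj_calc\<close> produces
  adjoints.\<close>

lemma adj_calc_cayley: "adj_calc (\<lambda>s. cayley s powi n) x = Up (- n) x"
  by (rule cinner_ext_right) (simp add: cinner_adj_calc bounded_borel_cayley spectral_form_cayley Up_adj)

lemma adj_calc_1: "adj_calc (\<lambda>s. 1) x = x"
  using adj_calc_cayley[of 0 x] by (simp add: Up_0)

lemma adj_calc_0: "adj_calc (\<lambda>s. 0) x = 0"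
  using adj_calc_diff[of "\<lambda>s. 1" "\<lambda>s. 1" x] by simp

lemma cinner_adj_calc_left:
  assumes f: "bounded_borel f"
  shows "cinner (adj_calc f x) y = cinner x (adj_calc (\<lambda>s. cnj (f s)) y)"
proof -
  have "cinner (adj_calc f x) y = cnj (spectral_form f y x)"
    by (metis cinner_adj_calc[OF f] cinner_conj_commute)
  also have "\<dots> = spectral_form (\<lambda>s. cnj (f s)) x y"
    using cnj_spectral_form[OF bounded_borel_cnj[OF f], of y x] by simp
  finally show ?thesis by (simp add: cinner_adj_calc bounded_borel_cnj f)
qed

text \<open>The map \<open>f \<mapsto> adj_calc f x\<close> is isometric for the square-integral
  norm of \<open>scalar_measure x\<close>. Strong limits and Cauchy estimates in the Hilbert space
  thereby become statements about scalar integrals.\<close>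

lemma norm_adj_calc_sq:
  assumes f: "bounded_borel f"
  shows "of_real ((norm (adj_calc f x))\<^sup>2) = (\<integral>s. complex_of_real ((cmod (f s))\<^sup>2) \<partial>scalar_measure x)"
proof -
  have "of_real ((norm (adj_calc f x))\<^sup>2) = cinner x (adj_calc (\<lambda>s. cnj (f s) * f s) x)"
    by (simp only: cinner_self[symmetric] cinner_adj_calc_left[OF f]
        adj_calc_adj_calc[OF f bounded_borel_cnj[OF f]])
  also have "\<dots> = (\<integral>s. cnj (f s) * f s \<partial>scalar_measure x)"
    using f by (simp add: cinner_adj_calc bounded_borel_mult bounded_borel_cnj spectral_form_self)
  finally show ?thesis by (simp add: complex_norm_square mult.commute del: of_real_power)
qed

text \<open>The isometry applied to \<open>F n - f\<close> reduces strong convergence to bounded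
  convergence for one scalar measure.\<close>

lemma adj_calc_tendsto:
  assumes F: "\<And>n. F n \<in> borel_measurable borel" "\<And>n s. cmod (F n s) \<le> K"
    and lim: "\<And>s. (\<lambda>n. F n s) \<longlonglongrightarrow> f s"
  shows "(\<lambda>n. adj_calc (F n) x) \<longlonglongrightarrow> adj_calc f x"
proof -
  have bF: "bounded_borel (F n)" for n using F by (intro bounded_borelI)
  have "cmod (f s) \<le> K" for s
    by (rule Lim_norm_ubound[OF _ lim[of s]]) (use F in auto)
  moreover have fm: "f \<in> borel_measurable borel"
    by (rule borel_measurable_LIMSEQ_metric[of F]) (use F lim in auto)
  ultimately have bf: "bounded_borel f" and fK: "\<And>s. cmod (f s) \<le> K" by (auto intro: bounded_borelI)
  let ?H = "\<lambda>n s. complex_of_real ((cmod (F n s - f s))\<^sup>2)"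
  have "(\<lambda>n. \<integral>s. ?H n s \<partial>scalar_measure x) \<longlonglongrightarrow> (\<integral>s. 0 \<partial>scalar_measure x)"
  proof (rule sigma_functionalD(3)[OF sigma_functional_scalar, where K = "(2 * K)\<^sup>2"])
    show "?H n \<in> borel_measurable borel" for n
      using F(1)[of n] fm by measurable
    show "cmod (?H n s) \<le> (2 * K)\<^sup>2" for n s
    proof -
      have "cmod (F n s - f s) \<le> 2 * K"
        using norm_triangle_ineq4[of "F n s" "f s"] F(2)[of n s] fK[of s] by linarith
      from power_mono[OF this, of 2] show ?thesis by (simp add: norm_power)
    qed
    show "(\<lambda>n. ?H n s) \<longlonglongrightarrow> 0" for s
    proof -
      have "(\<lambda>n. F n s - f s) \<longlonglongrightarrow> 0" using lim[of s] by (simp add: LIM_zero)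
      then have "(\<lambda>n. (cmod (F n s - f s))\<^sup>2) \<longlonglongrightarrow> 0\<^sup>2"
        by (intro tendsto_power tendsto_norm_zero)
      then have "(\<lambda>n. ?H n s) \<longlonglongrightarrow> of_real (0\<^sup>2)" by (rule tendsto_of_real)
      then show ?thesis by simp
    qed
  qed
  moreover have "(\<integral>s. ?H n s \<partial>scalar_measure x) = of_real ((norm (adj_calc (F n) x - adj_calc f x))\<^sup>2)" for n
    using norm_adj_calc_sq[OF bounded_borel_diff[OF bF bf], of n x] by (simp only: adj_calc_diff[OF bF bf])
  ultimately have "(\<lambda>n. complex_of_real ((norm (adj_calc (F n) x - adj_calc f x))\<^sup>2)) \<longlonglongrightarrow> complex_of_real 0"
    by simp
  then have "(\<lambda>n. (norm (adj_calc (F n) x - adj_calc f x))\<^sup>2) \<longlonglongrightarrow> 0"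
    by (simp only: tendsto_of_real_iff)
  then have "(\<lambda>n. norm (adj_calc (F n) x - adj_calc f x)) \<longlonglongrightarrow> 0"
    using tendsto_real_sqrt[of _ 0] by fastforce
  then show ?thesis using LIM_zero_cancel tendsto_norm_zero_iff by blast
qed

section \<open>Spectral projections and their scalar measures\<close>

definition spec_proj :: "real set \<Rightarrow> 'a \<Rightarrow> 'a" where
  "spec_proj B = adj_calc (indicator B)"

text \<open>An indicator is idempotent and real valued, so its operator is idempotent and equal to
  its adjoint.\<close>

lemma orth_proj_spec_proj:
  assumes B: "B \<in> sets borel" shows "orth_proj (spec_proj B)"
proof -
  note b = bounded_borel_indicator[OF B]
  have "(\<lambda>s. indicator B s * indicator B s) = (indicator B :: real \<Rightarrow> complex)"
    and "(\<lambda>s. cnj (indicator B s)) = indicator B" by (auto simp: indicator_def)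
  then show ?thesis
    unfolding orth_proj_def spec_proj_def
    by (simp add: adj_calc_add_right[OF b] adj_calc_scale_right[OF b] adj_calc_adj_calc[OF b b]
        cinner_adj_calc_left[OF b])
qed

lemma spec_proj_Int:
  assumes "B \<in> sets borel" "C \<in> sets borel"
  shows "spec_proj (B \<inter> C) = spec_proj B \<circ> spec_proj C"
  using assms by (auto simp: spec_proj_def adj_calc_adj_calc bounded_borel_indicator fun_eq_iff
      simp flip: indicator_inter_arith intro!: arg_cong2[where f = adj_calc])

lemma spec_proj_UNIV: "spec_proj UNIV = id"
proof -
  have "indicator UNIV = (\<lambda>s::real. 1::complex)" by auto
  then show ?thesis by (auto simp: spec_proj_def adj_calc_1)
qed

lemma spec_proj_sums:
  assumes F: "range F \<subseteq> sets borel" and disj: "disjoint_family F"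
  shows "(\<lambda>n. \<Sum>i<n. spec_proj (F i) x) \<longlonglongrightarrow> spec_proj (\<Union>i. F i) x"
proof -
  have Fi: "F i \<in> sets borel" for i using F by auto
  have eq: "(\<Sum>i<n. indicator (F i) s :: complex) = indicator (\<Union>i<n. F i) s" for n s
    using disj by (intro indicator_UN_disjoint[symmetric]) (auto simp: disjoint_family_on_def)
  have sum: "(\<Sum>i<n. spec_proj (F i) x) = adj_calc (\<lambda>s. \<Sum>i<n. indicator (F i) s) x" for n
    using Fi by (induction n)
      (simp_all add: adj_calc_0 spec_proj_def adj_calc_add bounded_borel_sum bounded_borel_indicator)
  show ?thesis
    unfolding sum unfolding spec_proj_def eq
  proof (rule adj_calc_tendsto[where K = 1])
    show "(indicator (\<Union>i<n. F i) :: real \<Rightarrow> complex) \<in> borel_measurable borel" for n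
      using Fi by (intro borel_measurable_indicator) auto
    show "cmod (indicator (\<Union>i<n. F i) s) \<le> 1" for n s by (simp add: indicator_def)
  qed (rule LIMSEQ_indicator_UN)
qed

lemma norm_spec_proj_sq:
  assumes B: "B \<in> sets borel" shows "(norm (spec_proj B x))\<^sup>2 = measure (scalar_measure x) B"
proof -
  interpret finite_measure "scalar_measure x" by (rule finite_scalar_measure)
  have "complex_of_real ((norm (spec_proj B x))\<^sup>2) = (\<integral>s. complex_of_real (indicator B s) \<partial>scalar_measure x)"
    unfolding spec_proj_def norm_adj_calc_sq[OF bounded_borel_indicator[OF B]]
    by (intro Bochner_Integration.integral_cong) (auto simp: indicator_def)
  also have "\<dots> = of_real (measure (scalar_measure x) B)"
    by (subst integral_complex_of_real) (use B in simp)
  finally show ?thesis by (simp only: of_real_eq_iff)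
qed

lemma spectral_scalar_spec_proj: "spectral_scalar spec_proj x = scalar_measure x"
proof -
  interpret finite_measure "scalar_measure x" by (rule finite_scalar_measure)
  have "scalar_measure x = measure_of UNIV (sets borel) (emeasure (scalar_measure x))"
    using measure_of_of_measure[of "scalar_measure x"] by simp
  also have "\<dots> = spectral_scalar spec_proj x"
    unfolding spectral_scalar_def
    by (rule measure_of_eq) (auto simp: norm_spec_proj_sq emeasure_eq_measure
        sets.sigma_sets_eq[of borel, simplified])
  finally show ?thesis by simp
qed

section \<open>The range of \<open>1 - U\<close> described by second moments\<close>

lemma cmod_1_minus_cayley_sq: "(cmod (1 - cayley s))\<^sup>2 = 4 / (s\<^sup>2 + 1)"
proof -
  have "of_real s + \<i> \<noteq> 0" by (simp add: complex_eq_iff)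
  then have "1 - cayley s = 2 * \<i> / (of_real s + \<i>)" by (simp add: cayley_def field_simps)
  then have "(cmod (1 - cayley s))\<^sup>2 = 4 / (cmod (of_real s + \<i>))\<^sup>2"
    by (simp add: norm_divide norm_mult power_divide)
  then show ?thesis by (simp add: cmod_power2)
qed

text \<open>Applying \<open>1 - U\<close> to a vector multiplies its measure by the squared modulus
  of \<open>1 - cayley s\<close>. The resulting density decays like the inverse square of
  \<open>s\<close>, just enough for a finite second moment.\<close>

lemma scalar_measure_diff_Up:
  "scalar_measure (w - Up 1 w) = density (scalar_measure w) (\<lambda>s. ennreal (4 / (s\<^sup>2 + 1)))"
proof (rule measure_eqI)
  show "sets (scalar_measure (w - Up 1 w)) = sets (density (scalar_measure w) (\<lambda>s. ennreal (4 / (s\<^sup>2 + 1))))"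
    by simp
  fix B assume "B \<in> sets (scalar_measure (w - Up 1 w))"
  then have B [measurable]: "B \<in> sets borel" by simp
  interpret finite_measure "scalar_measure w" by (rule finite_scalar_measure)
  interpret w': finite_measure "scalar_measure (w - Up 1 w)" by (rule finite_scalar_measure)
  let ?q = "\<lambda>s. complex_of_real ((cmod (1 - cayley s))\<^sup>2)"
  \<comment> \<open>As a Laurent polynomial in \<open>cayley s\<close>, the density can be
    integrated through the moments.\<close>
  have q: "?q s = 2 + (-1) * cayley s powi 1 + (-1) * cayley s powi (-1)" for s
    by (simp add: complex_norm_square algebra_simps cnj_cayley power_int_minus del: of_real_power)
  have bq: "bounded_borel ?q"
    unfolding q by (intro bounded_borel_add bounded_borel_mult bounded_borel_const bounded_borel_cayley)
  have "(\<integral>s. indicator B s \<partial>scalar_measure (w - Up 1 w)) = (\<integral>s. indicator B s * ?q s \<partial>scalar_measure w)"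
  proof (rule sigma_functional_eqI[of "\<lambda>f. \<integral>s. f s \<partial>scalar_measure (w - Up 1 w)" "\<lambda>f. \<integral>s. f s * ?q s \<partial>scalar_measure w"])
    fix n :: int
    have "cayley s powi n * ?q s = 2 * cayley s powi n - cayley s powi (n + 1) - cayley s powi (n - 1)" for s
      unfolding q by (simp add: power_int_add power_int_diff power_int_minus field_simps)
    then have "(\<integral>s. cayley s powi n * ?q s \<partial>scalar_measure w)
       = 2 * cinner (Up n w) w - cinner (Up (n + 1) w) w - cinner (Up (n - 1) w) w"
      by (simp add: integrable_scalar_measure bounded_borel_cayley moment_scalar_measure)
    also have "\<dots> = cinner (Up n (w - Up 1 w)) (w - Up 1 w)"
      by (simp add: Up_diff Up_Up cinner_simps cinner_Up_Up)
    finally show "(\<integral>s. cayley s powi n \<partial>scalar_measure (w - Up 1 w)) = (\<integral>s. cayley s powi n * ?q s \<partial>scalar_measure w)"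
      by (simp add: moment_scalar_measure)
  qed (auto intro!: sigma_functional_scalar sigma_functional_mult bq bounded_borel_indicator simp del: of_real_power)
  moreover have "(\<integral>s. indicator B s \<partial>scalar_measure (w - Up 1 w)) = complex_of_real (measure (scalar_measure (w - Up 1 w)) B)"
    using integral_complex_of_real[of "scalar_measure (w - Up 1 w)" "indicator B"]
    by (simp add: of_real_indicator)
  moreover have "(\<integral>s. indicator B s * ?q s \<partial>scalar_measure w)
      = complex_of_real (\<integral>s. 4 / (s\<^sup>2 + 1) * indicator B s \<partial>scalar_measure w)"
    by (subst integral_complex_of_real[symmetric])
       (auto intro!: Bochner_Integration.integral_cong simp: cmod_1_minus_cayley_sq indicator_def simp del: of_real_power)
  ultimately have "measure (scalar_measure (w - Up 1 w)) B = (\<integral>s. 4 / (s\<^sup>2 + 1) * indicator B s \<partial>scalar_measure w)"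
    by (simp only: of_real_eq_iff)
  moreover have int: "integrable (scalar_measure w) (\<lambda>s. 4 / (s\<^sup>2 + 1) * indicator B s)"
    by (rule integrable_const_bound[where B = 4])
       (auto simp: indicator_def divide_le_eq square_plus_one_pos)
  moreover have "(\<integral>\<^sup>+s. ennreal (4 / (s\<^sup>2 + 1) * indicator B s) \<partial>scalar_measure w)
      = (\<integral>\<^sup>+s. ennreal (4 / (s\<^sup>2 + 1)) * indicator B s \<partial>scalar_measure w)"
    by (intro nn_integral_cong) (auto simp: indicator_def)
  ultimately show "emeasure (scalar_measure (w - Up 1 w)) B = emeasure (density (scalar_measure w) (\<lambda>s. ennreal (4 / (s\<^sup>2 + 1)))) B"
    using nn_integral_eq_integral[OF int]
    by (simp add: w'.emeasure_eq_measure emeasure_density)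
qed

lemma scalar_measure_diff_Up_second_moment:
  "(\<integral>\<^sup>+s. ennreal (s\<^sup>2) \<partial>scalar_measure (w - Up 1 w)) < \<infinity>"
proof -
  interpret finite_measure "scalar_measure w" by (rule finite_scalar_measure)
  have "(\<integral>\<^sup>+s. ennreal (s\<^sup>2) \<partial>scalar_measure (w - Up 1 w)) = (\<integral>\<^sup>+s. ennreal (4 / (s\<^sup>2 + 1)) * ennreal (s\<^sup>2) \<partial>scalar_measure w)"
    unfolding scalar_measure_diff_Up by (intro nn_integral_density) auto
  also have "\<dots> \<le> (\<integral>\<^sup>+s. ennreal 4 \<partial>scalar_measure w)"
  proof (intro nn_integral_mono)
    fix s :: real
    have "4 / (s\<^sup>2 + 1) * s\<^sup>2 \<le> 4" using square_plus_one_pos[of s] by (simp add: divide_simps)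
    then show "ennreal (4 / (s\<^sup>2 + 1)) * ennreal (s\<^sup>2) \<le> ennreal 4"
      by (simp add: ennreal_mult''[symmetric] ennreal_leI del: ennreal_numeral)
  qed
  also have "\<dots> < \<infinity>" by (simp add: emeasure_eq_measure ennreal_mult_less_top)
  finally show ?thesis .
qed

text \<open>Multiplied by the density, \<open>s\<close> becomes
  \<open>\<i> * (cayley s - inverse (cayley s))\<close>, again a Laurent polynomial. The right-hand
  side will be \<open>cinner (A x) x\<close> for \<open>x = w - Up 1 w\<close>.\<close>

lemma integral_scalar_measure_diff_Up:
  "complex_of_real (\<integral>s. s \<partial>scalar_measure (w - Up 1 w)) = cinner (\<i> *\<^sub>C (w + Up 1 w)) (w - Up 1 w)"
proof -
  have "(\<integral>s. s \<partial>scalar_measure (w - Up 1 w)) = (\<integral>s. (4 / (s\<^sup>2 + 1)) *\<^sub>R s \<partial>scalar_measure w)"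
    unfolding scalar_measure_diff_Up by (rule integral_density) auto
  then have "complex_of_real (\<integral>s. s \<partial>scalar_measure (w - Up 1 w)) = (\<integral>s. of_real (4 / (s\<^sup>2 + 1) * s) \<partial>scalar_measure w)"
    by (simp only: integral_complex_of_real real_scaleR_def)
  also have "\<dots> = (\<integral>s. \<i> * cayley s powi 1 - \<i> * cayley s powi (-1) \<partial>scalar_measure w)"
    by (intro Bochner_Integration.integral_cong refl)
       (simp add: power_int_minus cnj_cayley[symmetric] complex_eq_iff Re_cayley Im_cayley)
  also have "\<dots> = \<i> * cinner (Up 1 w) w - \<i> * cinner (Up (-1) w) w"
    by (simp only: Bochner_Integration.integral_diff integrable_scalar_measure bounded_borel_cayley
        integral_mult_right_zero integrable_mult_right moment_scalar_measure)
  also have "\<dots> = cinner (\<i> *\<^sub>C (w + Up 1 w)) (w - Up 1 w)"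
    using Up_adj[of "-1" w w] by (simp add: cinner_simps cinner_Up_Up Up_0 algebra_simps)
  finally show ?thesis .
qed

text \<open>The preimage under \<open>1 - U\<close> should come from an unbounded function. Its
  truncations to \<open>J n\<close> lie in the bounded calculus, and the second moment makes the
  resulting vectors Cauchy.\<close>

lemma ex_diff_Up_if_second_moment:
  assumes fin: "(\<integral>\<^sup>+s. ennreal (s\<^sup>2) \<partial>scalar_measure x) < \<infinity>"
  shows "\<exists>w. x = w - Up 1 w"
proof -
  interpret finite_measure "scalar_measure x" by (rule finite_scalar_measure)
  define J where "J n = {- real n..real n}" for n :: nat
  \<comment> \<open>Because of the adjoint, \<open>1 - Up 1\<close> corresponds to
    \<open>1 - cayley s powi (-1)\<close>, whose reciprocal is
    \<open>(1 + \<i> * of_real s) / 2\<close>.\<close>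
  define f where "f n s = indicator (J n) s * ((1 + \<i> * of_real s) / 2)" for n s
  have J [measurable]: "J n \<in> sets borel" for n by (simp add: J_def)
  have bf: "bounded_borel (f n)" for n
  proof (rule bounded_borelI[where K = "(1 + real n) / 2"])
    show "f n \<in> borel_measurable borel" unfolding f_def by measurable
    fix s
    have "cmod (1 + \<i> * of_real s) \<le> 1 + \<bar>s\<bar>"
      using norm_triangle_ineq[of 1 "\<i> * of_real s"] by (simp add: norm_mult)
    then show "cmod (f n s) \<le> (1 + real n) / 2"
      by (auto simp: f_def norm_mult norm_divide indicator_def J_def)
  qed
  define w where "w n = adj_calc (f n) x" for n
  \<comment> \<open>The squared modulus of that reciprocal, integrated over the complement of
    \<open>J n\<close>. For \<open>n \<le> m\<close> the functions \<open>f m\<close> and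
    \<open>f n\<close> agree on \<open>J n\<close>, so this tail bounds the squared distance of
    \<open>w m\<close> and \<open>w n\<close>.\<close>
  define Q where "Q n = (\<integral>s. (1 - indicator (J n) s) * ((1 + s\<^sup>2) / 4) \<partial>scalar_measure x)" for n
  have int_sq: "integrable (scalar_measure x) (\<lambda>s. s\<^sup>2)"
    using fin by (intro integrableI_bounded) auto
  have int_q: "integrable (scalar_measure x) (\<lambda>s. (1 + s\<^sup>2) / 4)"
    using int_sq by simp
  have int_Q: "integrable (scalar_measure x) (\<lambda>s. (1 - indicator (J n) s) * ((1 + s\<^sup>2) / 4))" for n
    by (rule Bochner_Integration.integrable_bound[OF int_q]) (auto simp: indicator_def)
  have "Q \<longlonglongrightarrow> (\<integral>s. 0 \<partial>scalar_measure x)"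
    unfolding Q_def
  proof (rule integral_dominated_convergence[OF _ _ int_q])
    show "AE s in scalar_measure x. (\<lambda>n. (1 - indicator (J n) s) * ((1 + s\<^sup>2) / 4)) \<longlonglongrightarrow> 0"
    proof (intro AE_I2 tendsto_eventually)
      fix s :: real
      obtain n0 :: nat where "\<bar>s\<bar> \<le> real n0" using real_arch_simple by blast
      then show "\<forall>\<^sub>F n in sequentially. (1 - indicator (J n) s) * ((1 + s\<^sup>2) / 4) = 0"
        by (intro eventually_sequentiallyI[of n0]) (auto simp: J_def indicator_def)
    qed
  qed (auto simp: indicator_def)
  then have Q0: "Q \<longlonglongrightarrow> 0" by simp
  have w_diff: "(norm (w m - w n))\<^sup>2 \<le> Q n" if nm: "n \<le> m" for m n
  proof -
    have "complex_of_real ((norm (w m - w n))\<^sup>2) = (\<integral>s. complex_of_real ((cmod (f m s - f n s))\<^sup>2) \<partial>scalar_measure x)"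
      using norm_adj_calc_sq[OF bounded_borel_diff[OF bf bf], of m n x]
      by (simp only: w_def adj_calc_diff[OF bf bf])
    then have "(norm (w m - w n))\<^sup>2 = (\<integral>s. (cmod (f m s - f n s))\<^sup>2 \<partial>scalar_measure x)"
      by (simp only: integral_complex_of_real of_real_eq_iff)
    also have "\<dots> \<le> Q n"
      unfolding Q_def
    proof (rule integral_mono_AE'[OF int_Q], intro AE_I2)
      fix s
      have "(cmod (1 + \<i> * of_real s))\<^sup>2 = 1 + s\<^sup>2" by (simp add: cmod_power2)
      then have "(cmod ((1 + \<i> * of_real s) / 2))\<^sup>2 = (1 + s\<^sup>2) / 4" by (simp add: norm_divide power_divide)
      then show "(cmod (f m s - f n s))\<^sup>2 \<le> (1 - indicator (J n) s) * ((1 + s\<^sup>2) / 4)"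
        using nm by (auto simp: f_def indicator_def J_def)
    qed (auto simp: indicator_def)
    finally show ?thesis .
  qed
  have "Cauchy w"
  proof (rule CauchyI')
    fix e :: real assume e: "e > 0"
    then obtain N where N: "\<And>n. n \<ge> N \<Longrightarrow> \<bar>Q n\<bar> < e\<^sup>2"
      using LIMSEQ_D[OF Q0, of "e\<^sup>2"] by auto
    show "\<exists>M. \<forall>m\<ge>M. \<forall>n>m. dist (w m) (w n) < e"
    proof (intro exI allI impI)
      fix m n assume "N \<le> m" "m < n"
      then have "(norm (w m - w n))\<^sup>2 < e\<^sup>2"
        using w_diff[of m n] N[of m] by (simp add: norm_minus_commute)
      then show "dist (w m) (w n) < e" using e power2_less_imp_less[of _ e] by (simp add: dist_norm)
    qed
  qed
  then obtain w0 where w0: "w \<longlonglongrightarrow> w0" using Cauchy_convergent_iff convergent_def by blast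
  have "(\<lambda>n. w n - Up 1 (w n)) \<longlonglongrightarrow> w0 - Up 1 w0"
  proof (intro tendsto_diff w0)
    have "(\<lambda>n. norm (w n - w0)) \<longlonglongrightarrow> 0" using w0 by (simp add: LIM_zero tendsto_norm_zero)
    then have "(\<lambda>n. norm (Up 1 (w n) - Up 1 w0)) \<longlonglongrightarrow> 0" by (simp flip: Up_diff)
    then show "(\<lambda>n. Up 1 (w n)) \<longlonglongrightarrow> Up 1 w0"
      using LIM_zero_cancel tendsto_norm_zero_iff by blast
  qed
  moreover have "w n - Up 1 (w n) = adj_calc (indicator (J n)) x" for n
  proof -
    have "w n - Up 1 (w n) = adj_calc (\<lambda>s. 1) (w n) - adj_calc (\<lambda>s. cayley s powi (-1)) (w n)"
      by (simp only: adj_calc_cayley adj_calc_1) simp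
    also have "\<dots> = adj_calc (\<lambda>s. 1 - cayley s powi (-1)) (w n)"
      by (intro adj_calc_diff[symmetric] bounded_borel_const bounded_borel_cayley)
    also have "\<dots> = adj_calc (\<lambda>s. (1 - cayley s powi (-1)) * f n s) x"
      unfolding w_def by (intro adj_calc_adj_calc bf bounded_borel_diff bounded_borel_const bounded_borel_cayley)
    also have "(\<lambda>s. (1 - cayley s powi (-1)) * f n s) = indicator (J n)"
    proof
      fix s
      have nz: "of_real s - \<i> \<noteq> 0" "of_real s + \<i> \<noteq> 0" by (auto simp: complex_eq_iff)
      have "(1 - cayley s powi (-1)) * ((1 + \<i> * of_real s) / 2) = 1"
        using nz by (simp add: power_int_minus cayley_def field_simps)
      then have "(1 - cayley s powi (-1)) * f n s = indicator (J n) s * 1"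
        unfolding f_def by (simp only: mult.left_commute)
      then show "(1 - cayley s powi (-1)) * f n s = indicator (J n) s" by simp
    qed
    finally show ?thesis .
  qed
  moreover have "(\<lambda>n. adj_calc (indicator (J n)) x) \<longlonglongrightarrow> adj_calc (\<lambda>s. 1) x"
  proof (rule adj_calc_tendsto[where K = 1])
    fix s :: real
    obtain n0 :: nat where "\<bar>s\<bar> \<le> real n0" using real_arch_simple by blast
    then show "(\<lambda>n. indicator (J n) s) \<longlonglongrightarrow> (1::complex)"
      by (intro tendsto_eventually eventually_sequentiallyI[of n0]) (auto simp: J_def indicator_def)
  qed (auto simp: indicator_def)
  ultimately have "w0 - Up 1 w0 = x"
    using LIMSEQ_unique by (simp add: adj_calc_1)
  then show ?thesis by blast
qed

end

section \<open>The spectral theorem\<close>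

lemma self_adjointD:
  assumes "self_adjoint D A"
  shows "csubspace D" "closure D = UNIV"
    "x \<in> D \<Longrightarrow> y \<in> D \<Longrightarrow> A (x + y) = A x + A y"
    "x \<in> D \<Longrightarrow> A (c *\<^sub>C x) = c *\<^sub>C A x"
    "x \<in> D \<Longrightarrow> y \<in> D \<Longrightarrow> cinner (A x) y = cinner x (A y)"
    "(\<And>x. x \<in> D \<Longrightarrow> cinner (A x) y = cinner x z) \<Longrightarrow> y \<in> D \<and> z = A y"
  using assms unfolding self_adjoint_def by blast+

lemma self_adjoint_minus:
  assumes "self_adjoint D A" "x \<in> D" shows "A (- x) = - A x"
  using self_adjointD(4)[OF assms, of "-1"] by (simp add: scaleC_minus_left scaleC_one)

lemma self_adjoint_diff:
  assumes "self_adjoint D A" "x \<in> D" "y \<in> D" shows "A (x - y) = A x - A y"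
  using self_adjointD(3)[OF assms(1,2), of "- y"] csubspaceD(4)[OF self_adjointD(1)[OF assms(1)] assms(3)]
  by (simp add: self_adjoint_minus[OF assms(1,3)])

text \<open>Surjectivity is the point. The lower bound makes \<open>x \<mapsto> cinner x z\<close>
  bounded in terms of \<open>norm (A x)\<close>; Riesz gives \<open>y\<close> with
  \<open>cinner (A x) y = cinner x z\<close>, and maximality of the graph of \<open>A\<close> reads
  this as \<open>A y = z\<close>.\<close>

lemma self_adjoint_bounded_below_imp_resolvent:
  assumes A: "self_adjoint D A" and bd: "\<And>x. x \<in> D \<Longrightarrow> norm x \<le> C * norm (A x)"
  shows "zero_in_resolvent D A"
proof -
  have "inj_on A D"
  proof (rule inj_onI)
    fix x y assume xy: "x \<in> D" "y \<in> D" "A x = A y"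
    then have "norm (x - y) \<le> C * norm (A (x - y))"
      by (intro bd csubspaceD(5)[OF self_adjointD(1)[OF A]])
    then show "x = y" using xy by (simp add: self_adjoint_diff[OF A])
  qed
  moreover have "z \<in> A ` D" for z
  proof -
    have "\<exists>y. \<forall>x\<in>D. cinner x z = cinner (A x) y"
    proof (rule riesz_representation[where C = "C * norm z"])
      fix x assume x: "x \<in> D"
      have "cmod (cinner x z) \<le> norm x * norm z" by (rule norm_cinner_le)
      also have "\<dots> \<le> (C * norm (A x)) * norm z" using bd[OF x] by (intro mult_right_mono) auto
      finally show "cmod (cinner x z) \<le> C * norm z * norm (A x)" by (simp add: mult_ac)
    qed (auto simp: self_adjointD[OF A] cinner_simps)
    then obtain y where "\<And>x. x \<in> D \<Longrightarrow> cinner (A x) y = cinner x z" by metis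
    then show ?thesis using self_adjointD(6)[OF A] by blast
  qed
  ultimately show ?thesis unfolding zero_in_resolvent_def bij_betw_def using bd by auto
qed

lemma self_adjoint_norm_shift:
  assumes A: "self_adjoint D A" and x: "x \<in> D" and r: "r\<^sup>2 = (1::real)"
  shows "(norm (A x + (of_real r * \<i>) *\<^sub>C x))\<^sup>2 = (norm (A x))\<^sup>2 + (norm x)\<^sup>2"
proof -
  have "cinner (A x) x = cnj (cinner (A x) x)"
    using self_adjointD(5)[OF A x x] cinner_conj_commute by metis
  then have "Im (cinner (A x) x) = 0" by (metis complex_cnj_cancel_iff cnj.simps(2) neg_equal_zero)
  moreover have "(cmod (of_real r * \<i>))\<^sup>2 = 1" using r by (simp add: norm_mult)
  ultimately show ?thesis
    by (simp add: norm_sq_add norm_scaleC power_mult_distrib cinner_simps r)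
qed

text \<open>The bound \<open>le\<close> gives uniqueness directly. Existence uses Riesz for the
  shift of opposite sign, since the adjoint of \<open>A - r * \<i>\<close> is
  \<open>A + r * \<i>\<close>.\<close>

lemma self_adjoint_shift_bij:
  assumes A: "self_adjoint D A" and r: "r = 1 \<or> r = (-1::real)"
  shows "\<exists>!x. x \<in> D \<and> A x + (of_real r * \<i>) *\<^sub>C x = z"
proof -
  note D = csubspaceD[OF self_adjointD(1)[OF A]]
  have r2: "r\<^sup>2 = 1" "(-r)\<^sup>2 = 1" using r by auto
  have le: "norm x \<le> norm (A x + (of_real p * \<i>) *\<^sub>C x)" if "x \<in> D" "p\<^sup>2 = 1" for x p
  proof (rule power2_le_imp_le)
    show "(norm x)\<^sup>2 \<le> (norm (A x + (of_real p * \<i>) *\<^sub>C x))\<^sup>2"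
      unfolding self_adjoint_norm_shift[OF A that] by simp
  qed simp
  have "\<exists>y. \<forall>x\<in>D. cinner x z = cinner (A x + (of_real (-r) * \<i>) *\<^sub>C x) y"
  proof (rule riesz_representation[where C = "norm z"])
    fix x assume x: "x \<in> D"
    have "cmod (cinner x z) \<le> norm x * norm z" by (rule norm_cinner_le)
    also have "\<dots> \<le> norm (A x + (of_real (-r) * \<i>) *\<^sub>C x) * norm z"
      using le[OF x r2(2)] by (intro mult_right_mono) auto
    finally show "cmod (cinner x z) \<le> norm z * norm (A x + (of_real (-r) * \<i>) *\<^sub>C x)" by (simp add: mult_ac)
  qed (auto simp: self_adjointD[OF A] cinner_simps scaleC_add_right scaleC_scaleC mult_ac)
  then obtain y where y: "\<And>x. x \<in> D \<Longrightarrow> cinner x z = cinner (A x + (of_real (-r) * \<i>) *\<^sub>C x) y" by blast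
  have "cinner (A x) y = cinner x (z - (of_real r * \<i>) *\<^sub>C y)" if "x \<in> D" for x
    using y[OF that] by (simp add: cinner_simps)
  then have "y \<in> D \<and> z - (of_real r * \<i>) *\<^sub>C y = A y" by (rule self_adjointD(6)[OF A])
  then have ex: "y \<in> D" "A y + (of_real r * \<i>) *\<^sub>C y = z" by (auto simp: algebra_simps)
  moreover have "x = y" if "x \<in> D" "A x + (of_real r * \<i>) *\<^sub>C x = z" for x
  proof -
    have "A (x - y) + (of_real r * \<i>) *\<^sub>C (x - y) = 0"
      using that ex by (simp add: self_adjoint_diff[OF A] scaleC_diff_right algebra_simps)
    then show ?thesis using le[OF D(5)[OF that(1) ex(1)] r2(1)] by simp
  qed
  ultimately show ?thesis by blast
qed

locale isometry_pair =
  fixes U V :: "'a::chilbert_space \<Rightarrow> 'a"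
  assumes U_add: "U (x + y) = U x + U y" and U_scaleC: "U (c *\<^sub>C x) = c *\<^sub>C U x"
    and U_V: "U (V x) = x" and V_U: "V (U x) = x"
    and U_iso: "cinner (U x) (U y) = cinner x y"
begin

lemma V_add: "V (x + y) = V x + V y"
  by (metis U_V V_U U_add)

lemma V_scaleC: "V (c *\<^sub>C x) = c *\<^sub>C V x"
  by (metis U_V V_U U_scaleC)

lemma U_adj: "cinner (U x) y = cinner x (V y)"
  by (metis U_V U_iso)

lemma V_adj: "cinner (V x) y = cinner x (U y)"
  by (metis U_V U_iso)

definition int_power :: "int \<Rightarrow> 'a \<Rightarrow> 'a" where
  "int_power n = (if n \<ge> 0 then U ^^ nat n else V ^^ nat (- n))"

lemma int_power_of_nat: "int_power (int n) = U ^^ n"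
  and int_power_minus_of_nat: "int_power (- int n) = V ^^ n"
  by (auto simp: int_power_def)

lemma int_power_plus_1: "int_power (n + 1) x = U (int_power n x)"
proof (cases n rule: int_cases)
  case (nonneg k)
  then have "n + 1 = int (Suc k)" by simp
  then show ?thesis unfolding nonneg by (simp only: int_power_of_nat) simp
next
  case (neg k)
  then have "n + 1 = - int k" by simp
  then show ?thesis unfolding neg by (simp only: int_power_minus_of_nat) (simp add: U_V)
qed

lemma int_power_add: "int_power m (int_power n x) = int_power (m + n) x"
proof (induction m rule: int_induct[where k = 0])
  case base
  then show ?case by (simp add: int_power_def)
next
  case (step1 i)
  then show ?case using int_power_plus_1[of i "int_power n x"] int_power_plus_1[of "i + n" x]
    by (simp add: add_ac)
next
  case (step2 i)
  have "U (int_power (i - 1) (int_power n x)) = U (int_power (i - 1 + n) x)"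
    using step2 int_power_plus_1[of "i - 1" "int_power n x"] int_power_plus_1[of "i - 1 + n" x]
    by (simp add: algebra_simps)
  then show ?case by (metis V_U)
qed

lemma unitary_group_int_power:
  assumes dense: "closure (range (\<lambda>w. w - U w)) = UNIV"
  shows "unitary_group int_power"
proof
  show "int_power n (x + y) = int_power n x + int_power n y" for n x y
  proof (cases n rule: int_cases2)
    case (nonneg k)
    show ?thesis unfolding nonneg int_power_of_nat by (induction k) (auto simp: U_add)
  next
    case (nonpos k)
    show ?thesis unfolding nonpos int_power_minus_of_nat by (induction k) (auto simp: V_add)
  qed
  show "int_power n (c *\<^sub>C x) = c *\<^sub>C int_power n x" for n c x
  proof (cases n rule: int_cases2)
    case (nonneg k)
    show ?thesis unfolding nonneg int_power_of_nat by (induction k) (auto simp: U_scaleC)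
  next
    case (nonpos k)
    show ?thesis unfolding nonpos int_power_minus_of_nat by (induction k) (auto simp: V_scaleC)
  qed
  show "int_power 0 x = x" for x by (simp add: int_power_def)
  show "int_power m (int_power n x) = int_power (m + n) x" for m n x by (rule int_power_add)
  have UV: "cinner ((U ^^ k) x) y = cinner x ((V ^^ k) y)" for k x y
    by (induction k arbitrary: y) (simp_all add: U_adj, simp only: funpow_swap1)
  have VU: "cinner ((V ^^ k) x) y = cinner x ((U ^^ k) y)" for k x y
    by (induction k arbitrary: y) (simp_all add: V_adj, simp only: funpow_swap1)
  show "cinner (int_power n x) y = cinner x (int_power (- n) y)" for n x y
  proof (cases n rule: int_cases2)
    case (nonneg k)
    show ?thesis unfolding nonneg int_power_of_nat int_power_minus_of_nat by (rule UV)
  next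
    case (nonpos k)
    show ?thesis unfolding nonpos minus_minus int_power_of_nat int_power_minus_of_nat by (rule VU)
  qed
  have "int_power 1 = U" by (simp add: int_power_def)
  then show "closure (range (\<lambda>w. w - int_power 1 w)) = UNIV" using dense by simp
qed

end

text \<open>The spectral theorem, via the Cayley transform \<open>U = (A - \<i>) (A + \<i>)\<inverse>\<close>: the domain of \<open>A\<close> is the
  range of \<open>1 - U\<close>, and \<open>A (1 - U) = \<i> (1 + U)\<close>.\<close>
theorem spectral_measure_exists:
  assumes A: "self_adjoint D A"
  shows "\<exists>E. spectral_measure D A E"
proof -
  note D = csubspaceD[OF self_adjointD(1)[OF A]]
  \<comment> \<open>\<open>P\<close> and \<open>Q\<close> are the resolvents of \<open>A\<close> at
    \<open>- \<i>\<close> and \<open>\<i>\<close>; \<open>U\<close> and its inverse \<open>V\<close>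
    are built from them.\<close>
  define P where "P z = (THE x. x \<in> D \<and> A x + \<i> *\<^sub>C x = z)" for z
  define Q where "Q z = (THE x. x \<in> D \<and> A x - \<i> *\<^sub>C x = z)" for z
  have ex: "\<exists>!x. x \<in> D \<and> A x + \<i> *\<^sub>C x = z" "\<exists>!x. x \<in> D \<and> A x - \<i> *\<^sub>C x = z" for z
    using self_adjoint_shift_bij[OF A, of 1 z] self_adjoint_shift_bij[OF A, of "-1" z]
    by (auto simp: scaleC_minus_left)
  have P: "P z \<in> D" "A (P z) + \<i> *\<^sub>C P z = z" for z
    using theI'[OF ex(1)[of z]] unfolding P_def by auto
  have Q: "Q z \<in> D" "A (Q z) - \<i> *\<^sub>C Q z = z" for z
    using theI'[OF ex(2)[of z]] unfolding Q_def by auto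
  have P_eq: "P (A x + \<i> *\<^sub>C x) = x" if "x \<in> D" for x
    unfolding P_def using that ex(1) by (intro the1_equality) auto
  have Q_eq: "Q (A x - \<i> *\<^sub>C x) = x" if "x \<in> D" for x
    unfolding Q_def using that ex(2) by (intro the1_equality) auto
  define U where "U z = A (P z) - \<i> *\<^sub>C P z" for z
  define V where "V z = A (Q z) + \<i> *\<^sub>C Q z" for z
  have P_add: "P (x + y) = P x + P y" for x y
  proof -
    have "A (P x + P y) + \<i> *\<^sub>C (P x + P y) = x + y"
      using P(2)[of x] P(2)[of y] by (simp add: self_adjointD(3)[OF A] P scaleC_add_right algebra_simps)
    then show ?thesis using P_eq[of "P x + P y"] by (simp add: D P)
  qed
  have P_scale: "P (c *\<^sub>C x) = c *\<^sub>C P x" for c x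
  proof -
    have "A (c *\<^sub>C P x) + \<i> *\<^sub>C (c *\<^sub>C P x) = c *\<^sub>C (A (P x) + \<i> *\<^sub>C P x)"
      by (simp add: self_adjointD(4)[OF A] P(1) scaleC_add_right scaleC_scaleC mult.commute)
    then show ?thesis using P_eq[of "c *\<^sub>C P x"] P(2)[of x] by (simp add: D P(1))
  qed
  interpret isometry_pair U V
  proof
    show "U (x + y) = U x + U y" for x y
      by (simp add: U_def P_add self_adjointD(3)[OF A] P scaleC_add_right)
    show "U (c *\<^sub>C x) = c *\<^sub>C U x" for c x
      by (simp add: U_def P_scale self_adjointD(4)[OF A] P scaleC_diff_right scaleC_scaleC mult.commute)
    show "U (V x) = x" for x by (simp add: U_def V_def P_eq Q)
    show "V (U x) = x" for x by (simp add: U_def V_def Q_eq P)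
    show "cinner (U x) (U y) = cinner x y" for x y
    proof -
      have "cinner (U x) (U y) = cinner (A (P x) + \<i> *\<^sub>C P x) (A (P y) + \<i> *\<^sub>C P y)"
        unfolding U_def using self_adjointD(5)[OF A P(1)[of x] P(1)[of y]] by (simp add: cinner_simps algebra_simps)
      then show ?thesis by (simp add: P)
    qed
  qed
  \<comment> \<open>Since \<open>A (P z) = z - \<i> *\<^sub>C P z\<close>, the operator
    \<open>1 - U\<close> is \<open>2 * \<i>\<close> times the resolvent \<open>P\<close>, which is
    why its range is \<open>D\<close>.\<close>
  have U_eq: "U z = z - (2 * \<i>) *\<^sub>C P z" for z
    using P(2)[of z] scaleC_add_left[of \<i> \<i> "P z"] unfolding U_def mult_2 by (simp add: algebra_simps)
  have range: "range (\<lambda>w. w - U w) = D"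
  proof
    show "range (\<lambda>w. w - U w) \<subseteq> D" by (auto simp: U_eq D P)
    show "D \<subseteq> range (\<lambda>w. w - U w)"
    proof
      fix x assume x: "x \<in> D"
      define w where "w = (1 / (2 * \<i>)) *\<^sub>C (A x + \<i> *\<^sub>C x)"
      have "w - U w = x" using x by (simp add: U_eq w_def P_scale P_eq scaleC_scaleC scaleC_one)
      then show "x \<in> range (\<lambda>w. w - U w)" by (metis rangeI)
    qed
  qed
  interpret unitary_group int_power
    by (rule unitary_group_int_power) (simp add: range self_adjointD(2)[OF A])
  have U1: "int_power 1 = U" by (simp add: int_power_def)
  have "spectral_measure D A spec_proj"
    unfolding spectral_measure_def spectral_scalar_spec_proj
  proof (intro conjI ballI allI impI)
    show "D = {x. (\<integral>\<^sup>+\<mu>. ennreal (\<mu>\<^sup>2) \<partial>scalar_measure x) < \<infinity>}"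
      using scalar_measure_diff_Up_second_moment ex_diff_Up_if_second_moment
      unfolding U1 range[symmetric] by blast
    fix x assume "x \<in> D"
    then obtain w where w: "x = w - U w" unfolding range[symmetric] by blast
    have "A x = \<i> *\<^sub>C (w + U w)"
    proof -
      have "A x = (2 * \<i>) *\<^sub>C A (P w)"
        unfolding w U_eq using self_adjointD(4)[OF A P(1)] by simp
      also have "2 *\<^sub>C A (P w) = w + U w"
        using P(2)[of w] scaleC_add_left[of 1 1 "A (P w)"] unfolding U_def by (simp add: scaleC_one algebra_simps)
      then have "(2 * \<i>) *\<^sub>C A (P w) = \<i> *\<^sub>C (w + U w)" by (metis mult.commute scaleC_scaleC)
      finally show ?thesis .
    qed
    then show "cinner (A x) x = complex_of_real (\<integral>\<mu>. \<mu> \<partial>scalar_measure x)"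
      using integral_scalar_measure_diff_Up[of w] by (simp add: w U1)
  qed (use orth_proj_spec_proj spec_proj_UNIV spec_proj_Int spec_proj_sums in auto)
  then show ?thesis by blast
qed

section \<open>Quadratic forms of self-adjoint operators\<close>

text \<open>Additivity of the integral in the measure, phrased through values on sets so that it
  applies when a spectral measure of a vector splits into two restricted ones.\<close>

lemma nn_integral_emeasure_add:
  assumes sets: "sets M = sets N" "sets M' = sets N"
    and eq: "\<And>B. B \<in> sets N \<Longrightarrow> emeasure N B = emeasure M B + emeasure M' B"
    and f: "f \<in> borel_measurable N"
  shows "(\<integral>\<^sup>+x. f x \<partial>N) = (\<integral>\<^sup>+x. f x \<partial>M) + (\<integral>\<^sup>+x. f x \<partial>M')"
proof -
  note sp = sets_eq_imp_space_eq[OF sets(1)] sets_eq_imp_space_eq[OF sets(2)]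
  note [measurable_cong] = sets
  show ?thesis using f
  proof (induction rule: borel_measurable_induct)
    case (cong f g)
    then show ?case using sp nn_integral_cong[of M f g] nn_integral_cong[of M' f g] nn_integral_cong[of N f g] by simp
  next
    case (set A)
    then show ?case by (simp add: sets eq)
  next
    case (mult u c)
    then show ?case by (simp add: nn_integral_cmult distrib_left)
  next
    case (add u v)
    then show ?case by (simp add: nn_integral_add add_ac)
  next
    case (seq U)
    have inc: "incseq (\<lambda>i. \<integral>\<^sup>+x. U i x \<partial>M)" "incseq (\<lambda>i. \<integral>\<^sup>+x. U i x \<partial>M')"
      using seq by (auto simp: incseq_def le_fun_def intro!: nn_integral_mono)
    have m: "\<And>i. U i \<in> borel_measurable M" "\<And>i. U i \<in> borel_measurable M'" using seq by measurable
    have "(\<integral>\<^sup>+x. (SUP i. U i x) \<partial>N) = (SUP i. (\<integral>\<^sup>+x. U i x \<partial>M) + (\<integral>\<^sup>+x. U i x \<partial>M'))"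
      using seq by (simp add: nn_integral_monotone_convergence_SUP)
    also have "\<dots> = (SUP i. \<integral>\<^sup>+x. U i x \<partial>M) + (SUP i. \<integral>\<^sup>+x. U i x \<partial>M')"
      by (rule ennreal_SUP_add[OF inc])
    finally show ?case using seq m by (simp add: nn_integral_monotone_convergence_SUP image_comp)
  qed
qed

lemma integral_emeasure_add:
  fixes f :: "'a \<Rightarrow> real"
  assumes sets: "sets M = sets N" "sets M' = sets N"
    and eq: "\<And>B. B \<in> sets N \<Longrightarrow> emeasure N B = emeasure M B + emeasure M' B"
    and f: "integrable M f" "integrable M' f"
  shows "(\<integral>x. f x \<partial>N) = (\<integral>x. f x \<partial>M) + (\<integral>x. f x \<partial>M')"
proof -
  note [measurable_cong] = sets
  have fN [measurable]: "f \<in> borel_measurable N"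
    using borel_measurable_integrable[OF f(1)] by measurable
  note nn = nn_integral_emeasure_add[OF sets eq]
  have fin: "(\<integral>\<^sup>+x. ennreal (norm (f x)) \<partial>M) < \<infinity>" "(\<integral>\<^sup>+x. ennreal (norm (f x)) \<partial>M') < \<infinity>"
    using f by (auto simp: integrable_iff_bounded)
  then have N: "integrable N f"
    by (intro integrableI_bounded) (auto simp: nn)
  have fin': "(\<integral>\<^sup>+x. ennreal (f x) \<partial>K) < \<top>" "(\<integral>\<^sup>+x. ennreal (- f x) \<partial>K) < \<top>"
    if "(\<integral>\<^sup>+x. ennreal (norm (f x)) \<partial>K) < \<infinity>" for K
    using that by (auto intro!: le_less_trans[OF nn_integral_mono that[simplified]] ennreal_leI)
  have "enn2real (\<integral>\<^sup>+x. ennreal (f x) \<partial>N) = enn2real (\<integral>\<^sup>+x. ennreal (f x) \<partial>M) + enn2real (\<integral>\<^sup>+x. ennreal (f x) \<partial>M')"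
    using fin'[OF fin(1)] fin'[OF fin(2)] by (simp add: nn enn2real_plus)
  moreover have "enn2real (\<integral>\<^sup>+x. ennreal (- f x) \<partial>N) = enn2real (\<integral>\<^sup>+x. ennreal (- f x) \<partial>M) + enn2real (\<integral>\<^sup>+x. ennreal (- f x) \<partial>M')"
    using fin'[OF fin(1)] fin'[OF fin(2)] by (simp add: nn enn2real_plus)
  ultimately show ?thesis using N f by (simp add: real_lebesgue_integral_def)
qed

lemma nn_integral_emeasure_subadd:
  assumes sets: "sets M = sets N" "sets M' = sets N"
    and le: "\<And>B. B \<in> sets N \<Longrightarrow> emeasure N B \<le> c * emeasure M B + c * emeasure M' B"
    and f: "f \<in> borel_measurable N"
  shows "(\<integral>\<^sup>+x. f x \<partial>N) \<le> c * (\<integral>\<^sup>+x. f x \<partial>M) + c * (\<integral>\<^sup>+x. f x \<partial>M')"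
proof -
  note sp = sets_eq_imp_space_eq[OF sets(1)] sets_eq_imp_space_eq[OF sets(2)]
  note [measurable_cong] = sets
  show ?thesis using f
  proof (induction rule: borel_measurable_induct)
    case (cong f g)
    then show ?case using sp nn_integral_cong[of M f g] nn_integral_cong[of M' f g] nn_integral_cong[of N f g] by simp
  next
    case (set A)
    then show ?case by (simp add: sets le)
  next
    case (mult u k)
    then have "k * (\<integral>\<^sup>+x. u x \<partial>N) \<le> k * (c * (\<integral>\<^sup>+x. u x \<partial>M) + c * (\<integral>\<^sup>+x. u x \<partial>M'))"
      by (intro mult_left_mono) auto
    then show ?case using mult by (simp add: nn_integral_cmult distrib_left mult_ac)
  next
    case (add u v)
    then show ?case using add_mono[OF add.IH]
      by (simp add: nn_integral_add distrib_left add_ac)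
  next
    case (seq U)
    have "(\<integral>\<^sup>+x. (SUP i. U i x) \<partial>N) = (SUP i. \<integral>\<^sup>+x. U i x \<partial>N)"
      using seq by (intro nn_integral_monotone_convergence_SUP) auto
    also have "\<dots> \<le> c * (\<integral>\<^sup>+x. (SUP i. U i x) \<partial>M) + c * (\<integral>\<^sup>+x. (SUP i. U i x) \<partial>M')"
    proof (rule SUP_least)
      fix i
      have "(\<integral>\<^sup>+x. U i x \<partial>N) \<le> c * (\<integral>\<^sup>+x. U i x \<partial>M) + c * (\<integral>\<^sup>+x. U i x \<partial>M')" by (rule seq)
      also have "\<dots> \<le> c * (\<integral>\<^sup>+x. (SUP i. U i x) \<partial>M) + c * (\<integral>\<^sup>+x. (SUP i. U i x) \<partial>M')"
        by (intro add_mono mult_left_mono nn_integral_mono) (auto intro: SUP_upper)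
      finally show "(\<integral>\<^sup>+x. U i x \<partial>N) \<le> c * (\<integral>\<^sup>+x. (SUP i. U i x) \<partial>M) + c * (\<integral>\<^sup>+x. (SUP i. U i x) \<partial>M')" .
    qed
    finally show ?case by (simp add: image_comp)
  qed
qed

text \<open>An arbitrary spectral measure \<open>E\<close> is fixed here, so that the results apply
  to the one selected by \<open>spec_meas\<close>.\<close>

locale spectral_op =
  fixes D :: "'a::chilbert_space set" and A :: "'a \<Rightarrow> 'a" and E :: "real set \<Rightarrow> 'a \<Rightarrow> 'a"
  assumes self_adj: "self_adjoint D A" and spectral: "spectral_measure D A E"
begin

abbreviation "\<nu> \<equiv> spectral_scalar E"

lemma
  assumes "B \<in> sets borel"
  shows E_add: "E B (x + y) = E B x + E B y"
    and E_scaleC: "E B (c *\<^sub>C x) = c *\<^sub>C E B x"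
    and E_sym: "cinner (E B x) y = cinner x (E B y)"
    and E_E: "C \<in> sets borel \<Longrightarrow> E B (E C x) = E (B \<inter> C) x"
  using spectral assms unfolding spectral_measure_def orth_proj_def by simp_all

lemma E_UNIV: "E UNIV x = x"
  using spectral unfolding spectral_measure_def by simp

lemma E_tendsto:
  "range F \<subseteq> sets borel \<Longrightarrow> disjoint_family F \<Longrightarrow> (\<lambda>n. \<Sum>i<n. E (F i) x) \<longlonglongrightarrow> E (\<Union>i. F i) x"
  using spectral unfolding spectral_measure_def by simp

lemma cinner_E_E:
  assumes "B \<in> sets borel" "C \<in> sets borel"
  shows "cinner (E B x) (E C y) = cinner x (E (B \<inter> C) y)"
  by (simp add: E_sym E_E assms)

lemma norm_E_sq: "B \<in> sets borel \<Longrightarrow> (norm (E B x))\<^sup>2 = Re (cinner x (E B x))"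
  by (simp add: norm_sq_eq_cinner cinner_E_E)

text \<open>Countable additivity for the constant empty family makes the multiples \<open>n\<close>
  times \<open>E {} x\<close> converge, hence their increments \<open>E {} x\<close> tend to
  0.\<close>

lemma E_empty: "E {} x = 0"
proof -
  have "(\<lambda>n. \<Sum>i<n. E {} x) \<longlonglongrightarrow> E {} x"
    using E_tendsto[of "\<lambda>_. {}"] by (simp add: disjoint_family_on_def)
  then have "(\<lambda>n. (\<Sum>i<Suc n. E {} x) - (\<Sum>i<n. E {} x)) \<longlonglongrightarrow> E {} x - E {} x"
    by (intro tendsto_diff LIMSEQ_Suc)
  then show ?thesis by (simp add: LIMSEQ_const_iff algebra_simps)
qed

lemma E_Compl:
  assumes C: "C \<in> sets borel" shows "E C x + E (- C) x = x"
proof -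
  have "range (binaryset C (- C)) \<subseteq> sets borel" using C by (auto simp: range_binaryset_eq)
  moreover have "disjoint_family (binaryset C (- C))"
    by (auto simp: disjoint_family_on_def binaryset_def)
  ultimately have "(\<lambda>n. \<Sum>i<n. E (binaryset C (- C) i) x) \<longlonglongrightarrow> E (\<Union>i. binaryset C (- C) i) x"
    by (rule E_tendsto)
  moreover have "(\<lambda>n. \<Sum>i<n. E (binaryset C (- C) i) x) \<longlonglongrightarrow> E C x + E (- C) x"
    by (rule LIMSEQ_binaryset[where f = "\<lambda>B. E B x"]) (rule E_empty)
  ultimately show ?thesis
    using LIMSEQ_unique by (fastforce simp: UN_binaryset_eq E_UNIV)
qed

lemma sets_\<nu> [measurable_cong, simp]: "sets (\<nu> x) = sets borel"
  unfolding spectral_scalar_def using sets.sigma_sets_eq[of borel] by simp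

lemma space_\<nu> [simp]: "space (\<nu> x) = UNIV"
  using sets_eq_imp_space_eq[OF sets_\<nu>] by simp

text \<open>A measure built by \<open>measure_of\<close> returns the given set function only once
  this is known to be countably additive. The identity \<open>norm_E_sq\<close> makes the squared
  norm linear in the projection, so strong additivity of \<open>E\<close> suffices.\<close>

lemma emeasure_\<nu>:
  assumes B: "B \<in> sets borel" shows "emeasure (\<nu> x) B = ennreal ((norm (E B x))\<^sup>2)"
proof (rule emeasure_measure_of[OF spectral_scalar_def])
  show "positive (sets (\<nu> x)) (\<lambda>B. ennreal ((norm (E B x))\<^sup>2))"
    by (simp add: positive_def E_empty)
  show "countably_additive (sets (\<nu> x)) (\<lambda>B. ennreal ((norm (E B x))\<^sup>2))"
    unfolding countably_additive_def
  proof (intro allI impI)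
    fix F :: "nat \<Rightarrow> real set"
    assume F: "range F \<subseteq> sets (\<nu> x)" "disjoint_family F" "(\<Union>i. F i) \<in> sets (\<nu> x)"
    have Fi: "F i \<in> sets borel" for i using F by auto
    have "(\<lambda>n. Re (cinner x (\<Sum>i<n. E (F i) x))) \<longlonglongrightarrow> Re (cinner x (E (\<Union>i. F i) x))"
      using F by (intro tendsto_Re tendsto_cinner_right E_tendsto) auto
    then have "(\<lambda>i. (norm (E (F i) x))\<^sup>2) sums (norm (E (\<Union>i. F i) x))\<^sup>2"
      using Fi F(3) unfolding sums_def by (simp add: norm_E_sq cinner_sum_right)
    then show "(\<Sum>i. ennreal ((norm (E (F i) x))\<^sup>2)) = ennreal ((norm (E (\<Union>i. F i) x))\<^sup>2)"
      by (intro suminf_ennreal_eq) auto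
  qed
qed (use B in auto)

lemma finite_\<nu>: "finite_measure (\<nu> x)"
  by (rule finite_measureI) (simp add: emeasure_\<nu>)

lemma measure_\<nu>: "B \<in> sets borel \<Longrightarrow> measure (\<nu> x) B = (norm (E B x))\<^sup>2"
  by (simp add: measure_def emeasure_\<nu>)

lemma \<nu>_scaleC: "\<nu> (c *\<^sub>C x) = density (\<nu> x) (\<lambda>_. ennreal ((cmod c)\<^sup>2))"
  by (rule measure_eqI)
     (auto simp: emeasure_\<nu> E_scaleC norm_scaleC power_mult_distrib emeasure_density_const ennreal_mult)

lemma emeasure_\<nu>_add_le:
  assumes B: "B \<in> sets borel"
  shows "emeasure (\<nu> (x + y)) B \<le> 2 * emeasure (\<nu> x) B + 2 * emeasure (\<nu> y) B"
proof -
  have "(norm (E B (x + y)))\<^sup>2 \<le> 2 * (norm (E B x))\<^sup>2 + 2 * (norm (E B y))\<^sup>2"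
    using parallelogram_law[of "E B x" "E B y"] zero_le_power2[of "norm (E B x - E B y)"]
    unfolding E_add[OF B] by linarith
  then have "ennreal ((norm (E B (x + y)))\<^sup>2) \<le> ennreal (2 * (norm (E B x))\<^sup>2 + 2 * (norm (E B y))\<^sup>2)"
    by (rule ennreal_leI)
  then show ?thesis by (simp add: emeasure_\<nu> B ennreal_plus ennreal_mult)
qed

text \<open>The two summands live on disjoint spectral sets, so within every \<open>B\<close> they
  are orthogonal and no cross term appears.\<close>

lemma emeasure_\<nu>_split:
  assumes C: "C \<in> sets borel" and B: "B \<in> sets borel"
  shows "emeasure (\<nu> (E C u + E (- C) v)) B
    = emeasure (density (\<nu> u) (indicator C)) B + emeasure (density (\<nu> v) (indicator (- C))) B"
proof -
  have C': "- C \<in> sets borel" using C by auto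
  have eq: "E B (E C u + E (- C) v) = E (B \<inter> C) u + E (B \<inter> - C) v"
    by (simp add: E_add E_E B C C')
  have "(B \<inter> C) \<inter> (B \<inter> - C) = {}" by auto
  then have "cinner (E (B \<inter> C) u) (E (B \<inter> - C) v) = 0"
    using cinner_E_E[of "B \<inter> C" "B \<inter> - C" u v] B C C' by (simp add: E_empty)
  then have "(norm (E B (E C u + E (- C) v)))\<^sup>2 = (norm (E (B \<inter> C) u))\<^sup>2 + (norm (E (B \<inter> - C) v))\<^sup>2"
    unfolding eq norm_sq_add by simp
  moreover have "emeasure (density (\<nu> u) (indicator C)) B = emeasure (\<nu> u) (B \<inter> C)"
    "emeasure (density (\<nu> v) (indicator (- C))) B = emeasure (\<nu> v) (B \<inter> - C)"
    using B C C' by (simp_all add: emeasure_restricted Int_commute)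
  ultimately show ?thesis using B C C' by (simp add: emeasure_\<nu> ennreal_plus)
qed

section \<open>The quadratic form of a fixed spectral measure\<close>

definition quad :: "'a \<Rightarrow> real" where "quad x = (\<integral>s. s \<partial>\<nu> x)"

definition quad_dom :: "'a set" where "quad_dom = {x. (\<integral>\<^sup>+s. ennreal \<bar>s\<bar> \<partial>\<nu> x) < \<infinity>}"

lemma dom_iff: "x \<in> D \<longleftrightarrow> (\<integral>\<^sup>+s. ennreal (s\<^sup>2) \<partial>\<nu> x) < \<infinity>"
  using spectral unfolding spectral_measure_def by blast

lemma quad_eq_cinner: "x \<in> D \<Longrightarrow> complex_of_real (quad x) = cinner (A x) x"
  using spectral unfolding spectral_measure_def quad_def by simp

lemma quad_dom_integrable: "x \<in> quad_dom \<longleftrightarrow> integrable (\<nu> x) (\<lambda>s. s)"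
  by (simp add: quad_dom_def integrable_iff_bounded)

lemma quad_scaleC: "quad (c *\<^sub>C x) = (cmod c)\<^sup>2 * quad x"
  unfolding quad_def \<nu>_scaleC by (subst integral_density) auto

lemma quad_dom_scaleC: "x \<in> quad_dom \<Longrightarrow> c *\<^sub>C x \<in> quad_dom"
  by (simp add: quad_dom_def \<nu>_scaleC nn_integral_density nn_integral_cmult ennreal_mult_less_top)

lemma quad_dom_add:
  assumes "x \<in> quad_dom" "y \<in> quad_dom" shows "x + y \<in> quad_dom"
proof -
  have "(\<integral>\<^sup>+s. ennreal \<bar>s\<bar> \<partial>\<nu> (x + y)) \<le> 2 * (\<integral>\<^sup>+s. ennreal \<bar>s\<bar> \<partial>\<nu> x) + 2 * (\<integral>\<^sup>+s. ennreal \<bar>s\<bar> \<partial>\<nu> y)"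
    by (rule nn_integral_emeasure_subadd) (auto intro: emeasure_\<nu>_add_le)
  also have "\<dots> < \<infinity>" using assms by (simp add: quad_dom_def ennreal_mult_less_top)
  finally show ?thesis by (simp add: quad_dom_def)
qed

lemma dom_subset_quad_dom: "D \<subseteq> quad_dom"
proof
  fix x assume "x \<in> D"
  then have fin: "(\<integral>\<^sup>+s. ennreal (s\<^sup>2) \<partial>\<nu> x) < \<infinity>" by (simp add: dom_iff)
  interpret finite_measure "\<nu> x" by (rule finite_\<nu>)
  have "(\<integral>\<^sup>+s. ennreal \<bar>s\<bar> \<partial>\<nu> x) \<le> (\<integral>\<^sup>+s. 1 + ennreal (s\<^sup>2) \<partial>\<nu> x)"
  proof (intro nn_integral_mono)
    fix s :: real
    have "\<bar>s\<bar> \<le> 1 + s\<^sup>2"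
      using sum_squares_bound[of "\<bar>s\<bar>" 1] zero_le_power2[of s] by simp
    then show "ennreal \<bar>s\<bar> \<le> 1 + ennreal (s\<^sup>2)"
      by (metis ennreal_1 ennreal_leI ennreal_plus zero_le_one zero_le_power2)
  qed
  also have "\<dots> = emeasure (\<nu> x) UNIV + (\<integral>\<^sup>+s. ennreal (s\<^sup>2) \<partial>\<nu> x)"
    by (simp add: nn_integral_add)
  also have "\<dots> < \<infinity>" using fin by (simp add: emeasure_eq_measure)
  finally show "x \<in> quad_dom" by (simp add: quad_dom_def)
qed

lemma quad_split:
  assumes C [measurable]: "C \<in> sets borel" and u: "u \<in> quad_dom" and v: "v \<in> quad_dom"
  shows "quad (E C u + E (- C) v) = (\<integral>s. indicator C s * s \<partial>\<nu> u) + (\<integral>s. indicator (- C) s * s \<partial>\<nu> v)"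
proof -
  have ind: "(indicator B :: real \<Rightarrow> ennreal) = (\<lambda>s. ennreal (indicator B s))" for B
    by (auto simp: indicator_def)
  have int: "integrable (density (\<nu> w) (indicator B)) (\<lambda>s. s)"
    if w: "w \<in> quad_dom" and B [measurable]: "B \<in> sets borel" for w B
  proof -
    have "integrable (\<nu> w) (\<lambda>s. indicator B s *\<^sub>R s)"
      using w unfolding quad_dom_integrable by (intro integrable_mult_indicator) auto
    then show ?thesis unfolding ind by (subst integrable_density) auto
  qed
  have den: "(\<integral>s. s \<partial>density (\<nu> w) (indicator B)) = (\<integral>s. indicator B s * s \<partial>\<nu> w)"
    if B [measurable]: "B \<in> sets borel" for w B
    unfolding ind by (subst integral_density) auto
  have C': "- C \<in> sets borel" using C by auto
  have "quad (E C u + E (- C) v) = (\<integral>s. s \<partial>density (\<nu> u) (indicator C)) + (\<integral>s. s \<partial>density (\<nu> v) (indicator (- C)))"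
    unfolding quad_def
  proof (rule integral_emeasure_add)
    show "emeasure (\<nu> (E C u + E (- C) v)) B
        = emeasure (density (\<nu> u) (indicator C)) B + emeasure (density (\<nu> v) (indicator (- C))) B"
      if "B \<in> sets (\<nu> (E C u + E (- C) v))" for B
      using emeasure_\<nu>_split[OF C] that by simp
  qed (simp_all add: int u v C C')
  then show ?thesis by (simp only: den C C')
qed

section \<open>Truncation to bounded parts of the spectrum\<close>

definition window :: "nat \<Rightarrow> real set" where "window n = {- real n..real n}"

lemma window_borel [measurable]: "window n \<in> sets borel"
  by (simp add: window_def)

lemma eventually_window: "\<forall>\<^sub>F n in sequentially. s \<in> window n"
proof -
  obtain n0 :: nat where "\<bar>s\<bar> \<le> real n0" using real_arch_simple by blast
  then show ?thesis by (intro eventually_sequentiallyI[of n0]) (auto simp: window_def)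
qed

text \<open>Truncation restricts the measure to \<open>window n\<close>, where the square of
  \<open>s\<close> is at most that of \<open>n\<close>. The splitting lemma is used with the zero
  vector in the second slot.\<close>

lemma E_window_dom: "E (window n) u \<in> D"
proof -
  interpret finite_measure "\<nu> u" by (rule finite_\<nu>)
  have E0: "E B 0 = 0" if "B \<in> sets borel" for B using E_scaleC[OF that, of 0 0] by simp
  have "(\<integral>\<^sup>+s. ennreal (s\<^sup>2) \<partial>\<nu> (E (window n) u + E (- window n) 0))
     = (\<integral>\<^sup>+s. ennreal (s\<^sup>2) \<partial>density (\<nu> u) (indicator (window n)))
     + (\<integral>\<^sup>+s. ennreal (s\<^sup>2) \<partial>density (\<nu> 0) (indicator (- window n)))"
    by (rule nn_integral_emeasure_add) (auto simp: emeasure_\<nu>_split)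
  also have "\<dots> = (\<integral>\<^sup>+s. indicator (window n) s * ennreal (s\<^sup>2) \<partial>\<nu> u)
     + (\<integral>\<^sup>+s. indicator (- window n) s * ennreal (s\<^sup>2) \<partial>\<nu> 0)"
    by (simp add: nn_integral_density)
  also have "(\<integral>\<^sup>+s. indicator (- window n) s * ennreal (s\<^sup>2) \<partial>\<nu> 0) = 0"
  proof -
    have "emeasure (\<nu> 0) UNIV = 0" by (simp add: emeasure_\<nu> E0)
    then have "AE s in \<nu> 0. False" by (intro AE_I[where N = UNIV]) auto
    then show ?thesis by (subst nn_integral_0_iff_AE) (auto elim: eventually_mono)
  qed
  also have "(\<integral>\<^sup>+s. indicator (window n) s * ennreal (s\<^sup>2) \<partial>\<nu> u) + 0 \<le> (\<integral>\<^sup>+s. ennreal ((real n)\<^sup>2) \<partial>\<nu> u)"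
  proof (simp only: add_0_right, intro nn_integral_mono)
    fix s show "indicator (window n) s * ennreal (s\<^sup>2) \<le> ennreal ((real n)\<^sup>2)"
      by (cases "s \<in> window n") (auto simp: window_def abs_le_square_iff[symmetric] intro!: ennreal_leI)
  qed
  also have "\<dots> < \<infinity>" by (simp add: emeasure_eq_measure ennreal_mult_less_top)
  finally show ?thesis by (simp add: dom_iff E0)
qed

lemma tendsto_integral_window:
  assumes f: "integrable (\<nu> x) (f :: real \<Rightarrow> real)"
  shows "(\<lambda>n. \<integral>s. indicator (window n) s * f s \<partial>\<nu> x) \<longlonglongrightarrow> (\<integral>s. f s \<partial>\<nu> x)"
    and "(\<lambda>n. \<integral>s. indicator (- window n) s * f s \<partial>\<nu> x) \<longlonglongrightarrow> 0"
proof -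
  have [measurable]: "f \<in> borel_measurable borel" using borel_measurable_integrable[OF f] by simp
  show "(\<lambda>n. \<integral>s. indicator (window n) s * f s \<partial>\<nu> x) \<longlonglongrightarrow> (\<integral>s. f s \<partial>\<nu> x)"
  proof (rule integral_dominated_convergence[OF _ _ integrable_norm[OF f]])
    show "AE s in \<nu> x. (\<lambda>n. indicator (window n) s * f s) \<longlonglongrightarrow> f s"
    proof (intro AE_I2 tendsto_eventually)
      show "\<forall>\<^sub>F n in sequentially. indicator (window n) s * f s = f s" for s
        by (rule eventually_mono[OF eventually_window[of s]]) simp
    qed
  qed (auto simp: indicator_def)
  have "(\<lambda>n. \<integral>s. indicator (- window n) s * f s \<partial>\<nu> x) \<longlonglongrightarrow> (\<integral>s. 0 \<partial>\<nu> x)"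
  proof (rule integral_dominated_convergence[OF _ _ integrable_norm[OF f]])
    show "AE s in \<nu> x. (\<lambda>n. indicator (- window n) s * f s) \<longlonglongrightarrow> 0"
    proof (intro AE_I2 tendsto_eventually)
      show "\<forall>\<^sub>F n in sequentially. indicator (- window n) s * f s = 0" for s
        by (rule eventually_mono[OF eventually_window[of s]]) simp
    qed
  qed (auto simp: indicator_def)
  then show "(\<lambda>n. \<integral>s. indicator (- window n) s * f s \<partial>\<nu> x) \<longlonglongrightarrow> 0" by simp
qed

lemma E_window_tendsto: "(\<lambda>n. E (window n) x) \<longlonglongrightarrow> x"
proof -
  interpret finite_measure "\<nu> x" by (rule finite_\<nu>)
  have "(norm (E (window n) x - x))\<^sup>2 = (\<integral>s. indicator (- window n) s * 1 \<partial>\<nu> x)" for n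
  proof -
    have "E (window n) x - x = - E (- window n) x" using E_Compl[OF window_borel, of n x] by (simp add: algebra_simps)
    then show ?thesis using measure_\<nu>[of "- window n" x] by (simp add: borel_comp)
  qed
  then have "(\<lambda>n. (norm (E (window n) x - x))\<^sup>2) \<longlonglongrightarrow> 0"
    using tendsto_integral_window(2)[of x "\<lambda>_. 1"] by simp
  then have "(\<lambda>n. norm (E (window n) x - x)) \<longlonglongrightarrow> 0"
    using tendsto_real_sqrt[of _ 0] by fastforce
  then show ?thesis using LIM_zero_cancel tendsto_norm_zero_iff by blast
qed

text \<open>For \<open>x\<close> in \<open>D\<close> the expansion is algebra from
  \<open>quad_eq_cinner\<close> and symmetry of \<open>A\<close>. As \<open>quad\<close> is a
  separate integral for each vector, the general case comes from the truncations \<open>X n\<close>,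
  which lie in \<open>D\<close>.\<close>

lemma quad_add:
  assumes x: "x \<in> quad_dom" and y: "y \<in> D"
  shows "quad (x + y) = quad x + 2 * Re (cinner x (A y)) + Re (cinner (A y) y)"
proof -
  note D = csubspaceD[OF self_adjointD(1)[OF self_adj]]
  have yQ: "y \<in> quad_dom" and xyQ: "x + y \<in> quad_dom" using x y dom_subset_quad_dom quad_dom_add by auto
  have zQ: "0 \<in> quad_dom" using D(1) dom_subset_quad_dom by auto
  define X where "X n = E (window n) x" for n
  have XD: "X n \<in> D" for n by (simp add: X_def E_window_dom)
  have quadD: "quad u = Re (cinner (A u) u)" if "u \<in> D" for u
    using quad_eq_cinner[OF that] by (metis Re_complex_of_real)
  have "quad (X n + y) = quad (X n) + 2 * Re (cinner (X n) (A y)) + Re (cinner (A y) y)" for n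
  proof -
    have "cinner (A (X n)) y = cinner (X n) (A y)" by (rule self_adjointD(5)[OF self_adj XD y])
    moreover have "Re (cinner (A y) (X n)) = Re (cinner (X n) (A y))"
      by (metis cinner_conj_commute cnj.simps(1))
    ultimately show ?thesis
      using XD y by (simp add: quadD D self_adjointD(3)[OF self_adj] cinner_simps)
  qed
  moreover have "(\<lambda>n. quad (X n)) \<longlonglongrightarrow> quad x"
  proof -
    have E0: "E B 0 = 0" if "B \<in> sets borel" for B using E_scaleC[OF that, of 0 0] by simp
    have "quad (X n) = (\<integral>s. indicator (window n) s * s \<partial>\<nu> x) + (\<integral>s. indicator (- window n) s * s \<partial>\<nu> 0)" for n
      using quad_split[OF window_borel x zQ, of n] by (simp add: X_def E0)
    moreover have "(\<lambda>n. (\<integral>s. indicator (window n) s * s \<partial>\<nu> x) + (\<integral>s. indicator (- window n) s * s \<partial>\<nu> 0)) \<longlonglongrightarrow> quad x + 0"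
      unfolding quad_def using x zQ by (intro tendsto_add tendsto_integral_window) (auto simp: quad_dom_integrable)
    ultimately show ?thesis by simp
  qed
  moreover have "(\<lambda>n. quad (X n + y)) \<longlonglongrightarrow> quad (x + y)"
  proof -
    \<comment> \<open>Splitting \<open>y\<close> along the window exhibits \<open>X n + y\<close> as
      a truncation of \<open>x + y\<close> plus a tail of \<open>y\<close>;
      \<open>quad_split\<close> handles exactly this shape.\<close>
    have "X n + y = E (window n) (x + y) + E (- window n) y" for n
      using E_Compl[OF window_borel, of n y] by (simp add: X_def E_add algebra_simps)
    then have "quad (X n + y) = (\<integral>s. indicator (window n) s * s \<partial>\<nu> (x + y)) + (\<integral>s. indicator (- window n) s * s \<partial>\<nu> y)" for n
      using quad_split[OF window_borel xyQ yQ, of n] by simp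
    moreover have "(\<lambda>n. (\<integral>s. indicator (window n) s * s \<partial>\<nu> (x + y)) + (\<integral>s. indicator (- window n) s * s \<partial>\<nu> y)) \<longlonglongrightarrow> quad (x + y) + 0"
      unfolding quad_def using xyQ yQ by (intro tendsto_add tendsto_integral_window) (auto simp: quad_dom_integrable)
    ultimately show ?thesis by simp
  qed
  moreover have "(\<lambda>n. Re (cinner (X n) (A y))) \<longlonglongrightarrow> Re (cinner x (A y))"
    unfolding X_def by (intro tendsto_Re tendsto_cinner_left E_window_tendsto)
  ultimately have "(\<lambda>n. quad (X n) + 2 * Re (cinner (X n) (A y)) + Re (cinner (A y) y)) \<longlonglongrightarrow> quad (x + y)"
    "(\<lambda>n. quad (X n) + 2 * Re (cinner (X n) (A y)) + Re (cinner (A y) y))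
       \<longlonglongrightarrow> quad x + 2 * Re (cinner x (A y)) + Re (cinner (A y) y)"
    by (auto intro!: tendsto_intros)
  then show ?thesis by (rule LIMSEQ_unique)
qed

end

lemma spectral_op_spec_meas:
  assumes "self_adjoint D A" shows "spectral_op D A (spec_meas D A)"
  using someI_ex[OF spectral_measure_exists[OF assms]] assms
  by (simp add: spectral_op_def spec_meas_def)

lemma
  assumes A: "self_adjoint D A"
  shows dom_subset_form_dom: "D \<subseteq> form_dom D A"
    and csubspace_form_dom: "csubspace (form_dom D A)"
    and form_scaleC: "form D A (c *\<^sub>C x) = (cmod c)\<^sup>2 * form D A x"
    and form_add: "x \<in> form_dom D A \<Longrightarrow> y \<in> D \<Longrightarrow>
      form D A (x + y) = form D A x + 2 * Re (cinner x (A y)) + Re (cinner (A y) y)"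
proof -
  interpret spectral_op D A "spec_meas D A" by (rule spectral_op_spec_meas[OF A])
  have eq: "form_dom D A = quad_dom" "form D A = quad"
    by (auto simp: form_dom_def quad_dom_def form_def quad_def fun_eq_iff)
  show "D \<subseteq> form_dom D A" unfolding eq by (rule dom_subset_quad_dom)
  show "csubspace (form_dom D A)"
    unfolding eq csubspace_def
    using quad_dom_add quad_dom_scaleC dom_subset_quad_dom csubspaceD(1)[OF self_adjointD(1)[OF A]] by auto
  show "form D A (c *\<^sub>C x) = (cmod c)\<^sup>2 * form D A x" unfolding eq by (rule quad_scaleC)
  show "x \<in> form_dom D A \<Longrightarrow> y \<in> D \<Longrightarrow>
      form D A (x + y) = form D A x + 2 * Re (cinner x (A y)) + Re (cinner (A y) y)"
    unfolding eq by (rule quad_add)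
qed

section \<open>The Virozub--Matsaev condition\<close>

text \<open>If \<open>f\<close> reaches \<open>- \<epsilon>\<close>, take the last point where it is
  at or below this level: beyond it the derivative is negative, so the end value cannot be higher.
  Otherwise the slope bound holds on the whole interval.\<close>

lemma decrease_on_negative_strip:
  fixes f f' :: "real \<Rightarrow> real"
  assumes ab: "a < b" and d: "\<delta> > 0"
    and deriv: "\<And>x. x \<in> {a..b} \<Longrightarrow> (f has_real_derivative f' x) (at x within {a..b})"
    and strip: "\<And>x. x \<in> {a..b} \<Longrightarrow> - \<epsilon> \<le> f x \<Longrightarrow> f' x \<le> - \<delta>"
  shows "f b \<le> - \<epsilon> \<or> f b \<le> f a - \<delta> * (b - a)"
proof -
  have mvt: "f b \<le> f s - \<delta> * (b - s)" if s: "s \<in> {a..<b}" and above: "\<And>x. x \<in> {s<..<b} \<Longrightarrow> - \<epsilon> \<le> f x" for s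
  proof -
    have "(f has_derivative (\<lambda>h. f' x * h)) (at x within {s..b})" if "x \<in> {s..b}" for x
      using deriv[of x] s that unfolding has_field_derivative_def
      by (auto intro: has_derivative_subset)
    then obtain x where x: "x \<in> {s<..<b}" "f b - f s = f' x * (b - s)"
      using mvt_simple[of s b f "\<lambda>x h. f' x * h"] s by auto
    have "f' x * (b - s) \<le> - \<delta> * (b - s)"
      using strip[of x] above[OF x(1)] x(1) s by (intro mult_right_mono) auto
    then show ?thesis using x by simp
  qed
  show ?thesis
  proof (cases "\<exists>s\<in>{a..b}. f s \<le> - \<epsilon>")
    case True
    define S where "S = {a..b} \<inter> f -` {..- \<epsilon>}"
    have "continuous_on {a..b} f" using deriv by (rule DERIV_continuous_on)
    then have "closed S" unfolding S_def by (intro continuous_closed_preimage) auto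
    then have "compact S" by (simp add: S_def compact_eq_bounded_closed bounded_Int)
    moreover have "S \<noteq> {}" using True by (auto simp: S_def)
    ultimately obtain s where s: "s \<in> S" "\<And>x. x \<in> S \<Longrightarrow> x \<le> s" using compact_attains_sup by metis
    show ?thesis
    proof (cases "s = b")
      case False
      then have sb: "s \<in> {a..<b}" using s(1) by (auto simp: S_def)
      have "- \<epsilon> \<le> f x" if "x \<in> {s<..<b}" for x
        using s(2)[of x] that sb by (force simp: S_def)
      from mvt[OF sb this] have "f b \<le> f s" using sb d by (smt (verit) atLeastLessThan_iff mult_pos_pos)
      then show ?thesis using s(1) by (auto simp: S_def)
    qed (use s in \<open>auto simp: S_def\<close>)
  next
    case False
    then have "- \<epsilon> \<le> f x" if "x \<in> {a<..<b}" for x using that by (auto simp: not_le less_imp_le)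
    then show ?thesis using mvt[of a] ab by simp
  qed
qed

lemma self_adjoint_approximate_kernel:
  assumes A: "self_adjoint D A" and not: "\<not> zero_in_resolvent D A" and e: "\<eta> > 0"
  obtains x where "x \<in> D" "norm x = 1" "norm (A x) < \<eta>"
proof -
  have "\<exists>z\<in>D. \<not> norm z \<le> (1 / \<eta>) * norm (A z)"
    using self_adjoint_bounded_below_imp_resolvent[OF A] not by blast
  then obtain z where z: "z \<in> D" "norm (A z) < \<eta> * norm z" using e by (auto simp: field_simps not_le)
  then have nz: "norm z > 0" by (cases "z = 0") (auto simp: not_less)
  define c where "c = complex_of_real (1 / norm z)"
  have c: "cmod c = 1 / norm z" by (simp add: c_def norm_divide)
  show ?thesis
  proof
    show "c *\<^sub>C z \<in> D" using csubspaceD(3)[OF self_adjointD(1)[OF A]] z by simp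
    show "norm (c *\<^sub>C z) = 1" using nz by (simp add: norm_scaleC c)
    show "norm (A (c *\<^sub>C z)) < \<eta>"
      using nz z by (simp add: self_adjointD(4)[OF A] norm_scaleC c field_simps)
  qed
qed

lemma csubspace_plus_line:
  assumes M: "csubspace M" shows "csubspace {x + c *\<^sub>C v |x c. x \<in> M}"
  unfolding csubspace_def
proof (intro conjI ballI allI)
  let ?L = "{x + c *\<^sub>C v |x c. x \<in> M}"
  note D = csubspaceD[OF M]
  have "0 + 0 *\<^sub>C v \<in> ?L" using D(1) by blast
  then show "0 \<in> ?L" by simp
  fix u assume "u \<in> ?L"
  then obtain x c where u: "u = x + c *\<^sub>C v" "x \<in> M" by blast
  { fix w assume "w \<in> ?L"
    then obtain y d where w: "w = y + d *\<^sub>C v" "y \<in> M" by blast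
    have "u + w = (x + y) + (c + d) *\<^sub>C v" using u w by (simp add: scaleC_add_left algebra_simps)
    then show "u + w \<in> ?L" using D(2) u w by blast }
  fix k
  have "k *\<^sub>C u = k *\<^sub>C x + (k * c) *\<^sub>C v" using u by (simp add: scaleC_add_right scaleC_scaleC)
  then show "k *\<^sub>C u \<in> ?L" using D(3) u by blast
qed

text \<open>The line adds an error of at most \<open>\<eta>\<close> times
  \<open>(norm x)\<^sup>2 + 2 * (cmod c)\<^sup>2\<close>. As \<open>v\<close> may be nearly parallel
  to \<open>x\<close>, \<open>cmod c\<close> is controlled through \<open>norm u + norm x\<close>,
  which makes the error \<open>\<eta>\<close> times
  \<open>5 * (norm x)\<^sup>2 + 4 * (norm u)\<^sup>2\<close>. The lower bound on \<open>x\<close>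
  absorbs the 5; the 4 remains.\<close>

lemma form_lower_bound_plus_approximate_kernel:
  assumes A: "self_adjoint D A" and x: "x \<in> form_dom D A" and v: "v \<in> D" "norm v = 1"
    and Av: "norm (A v) \<le> \<eta>" and lower: "form D A x \<ge> a * (norm x)\<^sup>2" and \<eta>: "0 \<le> \<eta>" "5 * \<eta> \<le> a"
  shows "form D A (x + c *\<^sub>C v) \<ge> - 4 * \<eta> * (norm (x + c *\<^sub>C v))\<^sup>2"
proof -
  define u where "u = x + c *\<^sub>C v"
  have y: "c *\<^sub>C v \<in> D" using csubspaceD(3)[OF self_adjointD(1)[OF A] v(1)] .
  have Ay: "norm (A (c *\<^sub>C v)) \<le> \<eta> * cmod c"
    using mult_left_mono[OF Av, of "cmod c"] by (simp add: self_adjointD(4)[OF A v(1)] norm_scaleC mult.commute)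
  have ny: "norm (c *\<^sub>C v) = cmod c" by (simp add: norm_scaleC v)
  have "\<bar>Re (cinner x (A (c *\<^sub>C v)))\<bar> \<le> norm x * (\<eta> * cmod c)"
    using abs_Re_le_cmod norm_cinner_le mult_left_mono[OF Ay norm_ge_zero[of x]] order_trans by meson
  moreover have "\<bar>Re (cinner (A (c *\<^sub>C v)) (c *\<^sub>C v))\<bar> \<le> \<eta> * cmod c * cmod c"
    using abs_Re_le_cmod norm_cinner_le[of "A (c *\<^sub>C v)" "c *\<^sub>C v"] mult_right_mono[OF Ay norm_ge_zero[of "c *\<^sub>C v"]]
      order_trans unfolding ny by meson
  ultimately have "form D A u \<ge> a * (norm x)\<^sup>2 - 2 * (norm x * (\<eta> * cmod c)) - \<eta> * cmod c * cmod c"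
    using lower form_add[OF A x y] unfolding u_def by linarith
  moreover have "\<eta> * (2 * norm x * cmod c) \<le> \<eta> * ((norm x)\<^sup>2 + (cmod c)\<^sup>2)"
    using sum_squares_bound[of "norm x" "cmod c"] \<eta> by (intro mult_left_mono) auto
  moreover have "\<eta> * (cmod c)\<^sup>2 \<le> \<eta> * (2 * (norm u)\<^sup>2 + 2 * (norm x)\<^sup>2)"
  proof (intro mult_left_mono \<eta>)
    have "cmod c \<le> norm u + norm x"
      using norm_triangle_ineq4[of u x] by (simp add: u_def ny)
    then have "(cmod c)\<^sup>2 \<le> (norm u + norm x)\<^sup>2" by (intro power_mono) auto
    also have "\<dots> \<le> 2 * (norm u)\<^sup>2 + 2 * (norm x)\<^sup>2"
      using sum_squares_bound[of "norm u" "norm x"] by (simp add: power2_sum)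
    finally show "(cmod c)\<^sup>2 \<le> 2 * (norm u)\<^sup>2 + 2 * (norm x)\<^sup>2" .
  qed
  moreover have "5 * \<eta> * (norm x)\<^sup>2 \<le> a * (norm x)\<^sup>2" using \<eta> by (intro mult_right_mono) auto
  ultimately have "form D A u \<ge> - 4 * \<eta> * (norm u)\<^sup>2"
    by (simp add: algebra_simps power2_eq_square)
  then show ?thesis by (simp add: u_def)
qed

theorem theorem2p2:
  fixes \<Delta> :: "real set"
    and Tdom :: "real \<Rightarrow> 'a::chilbert_space set"
    and T :: "real \<Rightarrow> 'a \<Rightarrow> 'a"
    and \<D> :: "'a set"
    and t :: "real \<Rightarrow> 'a \<Rightarrow> real"
    and \<mu>1 \<mu>2 a :: real
    and M :: "'a set"
  defines "t \<equiv> \<lambda>l x. form (Tdom l) (T l) x"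
  assumes interval: "is_interval \<Delta>"
    and A1: "\<forall>l\<in>\<Delta>. self_adjoint (Tdom l) (T l)"
    and A2: "\<forall>l\<in>\<Delta>. form_dom (Tdom l) (T l) = \<D>"
    and A3: "\<forall>x\<in>\<D> - {0}. continuous_on \<Delta> (\<lambda>l. t l x) \<and>
               (\<forall>l0\<in>\<Delta>. t l0 x = 0 \<longrightarrow>
                  (\<forall>l\<in>\<Delta>. (l < l0 \<longrightarrow> t l x > 0) \<and> (l > l0 \<longrightarrow> t l x < 0)))"
    and VM_diff: "\<forall>u\<in>\<D>. \<forall>l\<in>\<Delta>. (\<lambda>s. t s u) differentiable (at l within \<Delta>)"
    and VM: "\<forall>I. compact I \<and> is_interval I \<and> I \<subseteq> \<Delta> \<longrightarrow>
               (\<exists>\<epsilon>>0. \<exists>\<delta>>0. \<forall>x\<in>\<D>. norm x = 1 \<longrightarrow>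
                  (\<forall>l\<in>I. \<forall>d. \<bar>t l x\<bar> \<le> \<epsilon> \<longrightarrow>
                     ((\<lambda>s. t s x) has_real_derivative d) (at l within \<Delta>) \<longrightarrow> d \<le> - \<delta>))"
    and mu1: "\<mu>1 \<in> \<Delta>" and mu2: "\<mu>2 \<in> \<Delta>" and mu12: "\<mu>1 < \<mu>2"
    and M: "M \<in> max_nonneg_subspaces \<D> (t \<mu>1)"
    and a_pos: "a > 0"
    and M_unif: "\<forall>x\<in>M. t \<mu>2 x \<ge> a * (norm x)\<^sup>2"
  shows "zero_in_resolvent (Tdom \<mu>2) (T \<mu>2)"
proof (rule ccontr)
  assume not: "\<not> zero_in_resolvent (Tdom \<mu>2) (T \<mu>2)"
  have sub: "{\<mu>1..\<mu>2} \<subseteq> \<Delta>"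
    using mem_is_interval_1_I[OF interval mu1 mu2] by auto
  have "compact {\<mu>1..\<mu>2} \<and> is_interval {\<mu>1..\<mu>2} \<and> {\<mu>1..\<mu>2} \<subseteq> \<Delta>"
    using sub by (simp add: is_interval_cc)
  from VM[THEN spec, THEN mp, OF this]
  obtain \<epsilon> \<delta> where e: "\<epsilon> > 0" and d: "\<delta> > 0" and vm: "\<And>x l d. x \<in> \<D> \<Longrightarrow> norm x = 1 \<Longrightarrow> l \<in> {\<mu>1..\<mu>2} \<Longrightarrow>
      \<bar>t l x\<bar> \<le> \<epsilon> \<Longrightarrow> ((\<lambda>s. t s x) has_real_derivative d) (at l within \<Delta>) \<Longrightarrow> d \<le> - \<delta>"
    by blast
  \<comment> \<open>The guaranteed depth at \<open>\<mu>2\<close>: the smaller of the two outcomes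
    of \<open>decrease_on_negative_strip\<close> for a negative starting value.\<close>
  define m where "m = min \<epsilon> (\<delta> * (\<mu>2 - \<mu>1))"
  have m: "m > 0" using e d mu12 by (simp add: m_def)
  have sa: "self_adjoint (Tdom \<mu>1) (T \<mu>1)" "self_adjoint (Tdom \<mu>2) (T \<mu>2)" using A1 mu1 mu2 by auto
  have dom: "form_dom (Tdom \<mu>1) (T \<mu>1) = \<D>" "form_dom (Tdom \<mu>2) (T \<mu>2) = \<D>" using A2 mu1 mu2 by auto
  note \<D> = csubspaceD[OF csubspace_form_dom[OF sa(1), unfolded dom]]
  have drop: "t \<mu>2 v \<le> - m" if v: "v \<in> \<D>" "norm v = 1" and neg: "t \<mu>1 v < 0" for v
  proof -
    have v0: "v \<in> \<D> - {0}" using v by auto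
    \<comment> \<open>A sign change would produce a zero \<open>l0 > \<mu>1\<close>, and (A3) at
      \<open>l0\<close> would make the value at \<open>\<mu>1\<close> positive.\<close>
    have neg_all: "t l v < 0" if l: "l \<in> {\<mu>1..\<mu>2}" for l
    proof (rule ccontr)
      assume "\<not> t l v < 0"
      moreover have "continuous_on {\<mu>1..l} (\<lambda>l. t l v)"
      proof (rule continuous_on_subset)
        show "continuous_on \<Delta> (\<lambda>l. t l v)" using A3 v0 by blast
        show "{\<mu>1..l} \<subseteq> \<Delta>" using l sub by auto
      qed
      ultimately obtain l0 where l0: "\<mu>1 \<le> l0" "l0 \<le> l" "t l0 v = 0"
        using IVT'[of "\<lambda>l. t l v" \<mu>1 0 l] neg l by auto
      have "l0 \<in> \<Delta>" "\<mu>1 < l0" using l0 l sub neg by (auto simp: less_le)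
      then have "t \<mu>1 v > 0" using A3 v0 l0 mu1 by blast
      then show False using neg by simp
    qed
    obtain f' where f': "\<And>l. l \<in> \<Delta> \<Longrightarrow> ((\<lambda>s. t s v) has_real_derivative f' l) (at l within \<Delta>)"
      using VM_diff v(1) unfolding real_differentiable_def by metis
    have "t \<mu>2 v \<le> - \<epsilon> \<or> t \<mu>2 v \<le> t \<mu>1 v - \<delta> * (\<mu>2 - \<mu>1)"
    proof (rule decrease_on_negative_strip[OF mu12 d])
      fix l assume l: "l \<in> {\<mu>1..\<mu>2}"
      show "((\<lambda>s. t s v) has_real_derivative f' l) (at l within {\<mu>1..\<mu>2})"
        using DERIV_subset[OF f' sub] l sub by auto
      \<comment> \<open>Negativity supplies the upper half of
        \<open>\<bar>t l v\<bar> \<le> \<epsilon>\<close>.\<close>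
      show "- \<epsilon> \<le> t l v \<Longrightarrow> f' l \<le> - \<delta>"
        using vm[OF v l _ f'] neg_all[OF l] l sub by auto
    qed
    then show ?thesis using neg by (auto simp: m_def)
  qed
  \<comment> \<open>\<open>a / 5\<close> meets the hypothesis of the perturbation lemma, and
    \<open>m / 8\<close> leaves a loss \<open>4 * \<eta>\<close> of at most \<open>m / 2\<close>,
    strictly below the forced drop.\<close>
  define \<eta> where "\<eta> = min (a / 5) (m / 8)"
  have \<eta>: "\<eta> > 0" "5 * \<eta> \<le> a" "4 * \<eta> < m" using a_pos m by (auto simp: \<eta>_def)
  obtain x0 where x0: "x0 \<in> Tdom \<mu>2" "norm x0 = 1" "norm (T \<mu>2 x0) < \<eta>"
    using self_adjoint_approximate_kernel[OF sa(2) not \<eta>(1)] by blast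
  have x0D: "x0 \<in> \<D>" using x0(1) dom_subset_form_dom[OF sa(2)] dom by auto
  have Msub: "csubspace M" "M \<subseteq> \<D>"
    and Mmax: "\<And>L. csubspace L \<Longrightarrow> L \<subseteq> \<D> \<Longrightarrow> (\<forall>x\<in>L. t \<mu>1 x \<ge> 0) \<Longrightarrow> M \<subseteq> L \<Longrightarrow> L = M"
    using M unfolding max_nonneg_subspaces_def by auto
  define L where "L = {x + c *\<^sub>C x0 |x c. x \<in> M}"
  have LD: "L \<subseteq> \<D>" unfolding L_def using Msub x0D \<D> by auto
  have lower: "t \<mu>2 u \<ge> - 4 * \<eta> * (norm u)\<^sup>2" if uL: "u \<in> L" for u
  proof -
    obtain x c where u: "u = x + c *\<^sub>C x0" "x \<in> M" using uL by (auto simp: L_def)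
    show ?thesis
      unfolding t_def u(1)
      by (rule form_lower_bound_plus_approximate_kernel[OF sa(2) _ x0(1,2) _ _ _ \<eta>(2)])
         (use u Msub dom x0 \<eta> M_unif in \<open>auto simp: t_def\<close>)
  qed
  have scale: "t l (c *\<^sub>C u) = (cmod c)\<^sup>2 * t l u" if "l \<in> \<Delta>" for l c u
    unfolding t_def using form_scaleC A1 that by blast
  have csL: "csubspace L" unfolding L_def by (rule csubspace_plus_line[OF Msub(1)])
  have "t \<mu>1 u \<ge> 0" if u: "u \<in> L" for u
  proof (cases "u = 0")
    case True
    then show ?thesis using scale[OF mu1, of 0 0] by simp
  next
    case False
    define v where "v = complex_of_real (1 / norm u) *\<^sub>C u"
    have v: "norm v = 1" using False by (simp add: v_def norm_scaleC norm_divide)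
    have uv: "u = complex_of_real (norm u) *\<^sub>C v"
      using False by (simp add: v_def scaleC_scaleC scaleC_one flip: of_real_mult)
    have vL: "v \<in> L" unfolding v_def using csubspaceD(3)[OF csL u] .
    \<comment> \<open>A unit vector of \<open>L\<close> cannot have dropped by \<open>m\<close>, so
      by \<open>drop\<close> it was not negative at \<open>\<mu>1\<close>.\<close>
    have "t \<mu>2 v > - m" using lower[OF vL] v \<eta>(3) by simp
    then have "t \<mu>1 v \<ge> 0" using drop[of v] v vL LD by fastforce
    then show ?thesis using scale[OF mu1, of "of_real (norm u)" v] uv by simp
  qed
  moreover have "M \<subseteq> L"
  proof
    fix x assume "x \<in> M"
    then have "x + 0 *\<^sub>C x0 \<in> L" unfolding L_def by blast
    then show "x \<in> L" by simp
  qed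
  ultimately have "L = M" using Mmax[OF csL LD] by blast
  moreover have "0 + 1 *\<^sub>C x0 \<in> L" unfolding L_def using csubspaceD(1)[OF Msub(1)] by blast
  ultimately have "x0 \<in> M" by (simp add: scaleC_one)
  \<comment> \<open>Membership in \<open>M\<close> gives at least \<open>a\<close>, while the small
    image under \<open>T \<mu>2\<close> allows at most \<open>\<eta> \<le> a / 5\<close>.\<close>
  then have "a \<le> t \<mu>2 x0" using M_unif x0(2) by auto
  moreover have "t \<mu>2 x0 = Re (cinner (T \<mu>2 x0) x0)"
    using form_add[OF sa(2) _ x0(1), of 0] scale[OF mu2, of 0 0] \<D>(1) dom by (simp add: t_def)
  moreover have "Re (cinner (T \<mu>2 x0) x0) \<le> \<eta>"
    using norm_cinner_le[of "T \<mu>2 x0" x0] complex_Re_le_cmod[of "cinner (T \<mu>2 x0) x0"] x0 by simp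
  ultimately show False using \<eta> a_pos by simp
qed

end
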